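(* Let $\varphi$ be an elliptic automorphism of $\mathbb{D}$ with fixed point $a\in\mathbb{D}$, and let $\psi\in A(\mathbb{D})$ be not identically zero. Assume that the weighted composition operator $C_{\psi,\varphi}$ on $H^2(\mathbb{D})$ is not invertible. If $\varphi'(a)^k\neq 1$ for all positive integers $k$, then the spectrum of $C_{\psi,\varphi}$ on $H^2(\mathbb{D})$ is the disk $$\{\lambda\in\mathbb{C} : |\lambda|\leqslant|v(a)|\},$$ where $v$ is the outer part of $\psi$.
   Context: $\mathbb{D}$ is the open unit disk in $\mathbb{C}$. $H^2(\mathbb{D})$ is the Hardy-Hilbert space of analytic functions $f$ on $\mathbb{D}$ with $\|f\|^2=\sup_{0<r<1}\int_0^{2\pi}|f(re^{i\theta})|^2\frac{d\theta}{2\pi}<\infty$. $A(\mathbb{D})$ is the disk algebra: analytic functions on $\mathbb{D}$ that are continuous on $\overline{\mathbb{D}}$. For an automorphism $\varphi$ of $\mathbb{D}$ and a bounded analytic function $\psi$ on $\mathbb{D}$, $C_{\psi,\varphi}$ is the bounded operator $C_{\psi,\varphi}f=\psi\cdot(f\circ\varphi)$. An automorphism of $\mathbb{D}$ is elliptic if it has a unique fixed point in $\mathbb{D}$. Every nonzero $\psi\in H^2(\mathbb{D})$ factors as $\psi=\tau v$, uniquely up to constants of modulus one, where $\tau$ is inner (i.e. $\tau\in H^2(\mathbb{D})$ and its radial boundary values satisfy $|\tau|=1$ a.e. on $\partial\mathbb{D}$) and $v$ is outer (i.e. $v\in H^2(\mathbb{D})$ and $\frac{1}{2\pi}\int_0^{2\pi}\log|v(e^{i\theta})|\,d\theta=\log|v(0)|$,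 with $v(0)\ne0$); $v$ is called the outer part of $\psi$. *)

theory Defs
  imports "HOL-Complex_Analysis.Complex_Analysis"
begin

definition mean_square :: "(complex \<Rightarrow> complex) \<Rightarrow> real \<Rightarrow> real" where
  "mean_square f r =
     integral {0..2 * pi} (\<lambda>t. (norm (f (of_real r * cis t)))\<^sup>2) / (2 * pi)"

text \<open>
  Only the values on the open unit disk matter for \<open>hardy_class\<close>. The space \<open>H2\<close> selects the
  representatives that vanish off the disk, so that equality in \<open>H2\<close> is equality of functions
  on the disk.
\<close>

definition hardy_class :: "(complex \<Rightarrow> complex) \<Rightarrow> bool" where
  "hardy_class f \<longleftrightarrow>
     f holomorphic_on ball 0 1 \<and> bdd_above (mean_square f ` {0<..<1})"

definition H2 :: "(complex \<Rightarrow> complex) set" where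
  "H2 = {f. hardy_class f \<and> (\<forall>z. z \<notin> ball 0 1 \<longrightarrow> f z = 0)}"

definition H2_norm :: "(complex \<Rightarrow> complex) \<Rightarrow> real" where
  "H2_norm f = sqrt (SUP r\<in>{0<..<1}. mean_square f r)"

definition H2_bounded_operator :: "((complex \<Rightarrow> complex) \<Rightarrow> (complex \<Rightarrow> complex)) \<Rightarrow> bool" where
  "H2_bounded_operator T \<longleftrightarrow>
     (\<forall>f\<in>H2. T f \<in> H2) \<and>
     (\<forall>f\<in>H2. \<forall>g\<in>H2. T (\<lambda>z. f z + g z) = (\<lambda>z. T f z + T g z)) \<and>
     (\<forall>f\<in>H2. \<forall>c. T (\<lambda>z. c * f z) = (\<lambda>z. c * T f z)) \<and>
     (\<exists>K. \<forall>f\<in>H2. H2_norm (T f) \<le> K * H2_norm f)"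

definition H2_invertible :: "((complex \<Rightarrow> complex) \<Rightarrow> (complex \<Rightarrow> complex)) \<Rightarrow> bool" where
  "H2_invertible T \<longleftrightarrow>
     H2_bounded_operator T \<and>
     (\<exists>S. H2_bounded_operator S \<and> (\<forall>f\<in>H2. S (T f) = f \<and> T (S f) = f))"

definition H2_spectrum :: "((complex \<Rightarrow> complex) \<Rightarrow> (complex \<Rightarrow> complex)) \<Rightarrow> complex set" where
  "H2_spectrum T = {c. \<not> H2_invertible (\<lambda>f z. T f z - c * f z)}"

definition weighted_composition ::
    "(complex \<Rightarrow> complex) \<Rightarrow> (complex \<Rightarrow> complex) \<Rightarrow> (complex \<Rightarrow> complex) \<Rightarrow> (complex \<Rightarrow> complex)" where
  "weighted_composition \<psi> \<phi> f = (\<lambda>z. if z \<in> ball 0 1 then \<psi> z * f (\<phi> z) else 0)"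

definition disk_algebra :: "(complex \<Rightarrow> complex) set" where
  "disk_algebra = {f. f holomorphic_on ball 0 1 \<and> continuous_on (cball 0 1) f}"

definition disk_automorphism :: "(complex \<Rightarrow> complex) \<Rightarrow> bool" where
  "disk_automorphism \<phi> \<longleftrightarrow>
     \<phi> holomorphic_on ball 0 1 \<and> \<phi> ` ball 0 1 \<subseteq> ball 0 1 \<and>
     (\<exists>\<phi>'. \<phi>' holomorphic_on ball 0 1 \<and> \<phi>' ` ball 0 1 \<subseteq> ball 0 1 \<and>
        (\<forall>z\<in>ball 0 1. \<phi>' (\<phi> z) = z \<and> \<phi> (\<phi>' z) = z))"

definition elliptic_automorphism :: "(complex \<Rightarrow> complex) \<Rightarrow> bool" where
  "elliptic_automorphism \<phi> \<longleftrightarrow>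
     disk_automorphism \<phi> \<and> (\<exists>!z. z \<in> ball 0 1 \<and> \<phi> z = z)"

text \<open>
  \<open>radial_limit f t\<close> is meaningful only if the limit exists; for functions in the Hardy class this
  is the case for almost every \<open>t\<close>. Likewise \<open>ln 0 = 0\<close> is harmless in \<open>outer_function\<close>, as the
  boundary values of a nonzero function in the Hardy class vanish only on a null set.
\<close>

definition radial_limit :: "(complex \<Rightarrow> complex) \<Rightarrow> real \<Rightarrow> complex" where
  "radial_limit f t = Lim (at_left 1) (\<lambda>r. f (of_real r * cis t))"

definition inner_function :: "(complex \<Rightarrow> complex) \<Rightarrow> bool" where
  "inner_function f \<longleftrightarrow>
     hardy_class f \<and>
     (AE t in lebesgue_on {0..2 * pi}.
        \<exists>l. ((\<lambda>r. f (of_real r * cis t)) \<longlongrightarrow> l) (at_left 1) \<and> norm l = 1)"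

definition outer_function :: "(complex \<Rightarrow> complex) \<Rightarrow> bool" where
  "outer_function f \<longleftrightarrow>
     hardy_class f \<and> f 0 \<noteq> 0 \<and>
     (\<lambda>t. ln (norm (radial_limit f t))) absolutely_integrable_on {0..2 * pi} \<and>
     integral {0..2 * pi} (\<lambda>t. ln (norm (radial_limit f t))) / (2 * pi) = ln (norm (f 0))"

text \<open>The outer part is determined only up to a constant of modulus one, hence a relation.\<close>

definition is_outer_part :: "(complex \<Rightarrow> complex) \<Rightarrow> (complex \<Rightarrow> complex) \<Rightarrow> bool" where
  "is_outer_part v \<psi> \<longleftrightarrow>
     outer_function v \<and>
     (\<exists>\<tau>. inner_function \<tau> \<and> (\<forall>z\<in>ball 0 1. \<psi> z = \<tau> z * v z))"

end

theory Submission
  imports Defs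
begin

text \<open>
  After a change of variable that moves \<open>a\<close> to \<open>0\<close>, an elliptic automorphism is a rotation: the
  Blaschke factor \<open>b\<close> with zero \<open>a\<close> satisfies \<open>b \<circ> \<phi> = \<mu> b\<close> with \<open>\<mu> = \<phi>' a\<close> of modulus one
  (\<open>elliptic_is_rotation\<close>), and by hypothesis \<open>\<mu>\<close> is not a root of unity. Write \<open>T\<close> for the operator
  and \<open>\<psi>\<^sub>n\<close> for the product of \<open>\<psi> \<circ> \<phi>\<^sup>j\<close> over \<open>j < n\<close>, so that \<open>T\<^sup>n f = \<psi>\<^sub>n \<cdot> (f \<circ> \<phi>\<^sup>n)\<close>.

  Size of \<open>T\<^sup>n\<close>. Since \<open>v\<close> is outer, \<open>ln |v a|\<close> is the Poisson integral at \<open>a\<close> of \<open>ln |\<psi>|\<close>. In place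
  of Poisson integrals of logarithms the proof uses polynomials \<open>Q\<close> whose real part approximates
  \<open>ln (|\<psi>| + \<epsilon>)\<close> uniformly on the circle. A maximum principle for Hardy functions
  (\<open>bounded_of_radial_limits\<close>) gives \<open>|v| \<le> exp (Re Q)\<close> in the disk as soon as this bound holds for
  \<open>\<psi>\<close> on the circle, and the defining equation of an outer function shows that \<open>Q\<close> can be
  chosen with \<open>exp (Re (Q a))\<close> as close to \<open>|v a|\<close> as desired (\<open>outer_majorant_at_point\<close>). For a
  polynomial in \<open>b\<close> the sums along the orbit of the irrational rotation stay within a bounded distance
  of their mean; hence \<open>|\<psi>\<^sub>n| \<le> C c\<^sup>n\<close> for every \<open>c > |v a|\<close> (\<open>orbit_product_upper\<close>), and a Neumann
  series inverts \<open>T - \<lambda>\<close> for \<open>|\<lambda>| > |v a|\<close>. In the other direction \<open>|v a|\<^sup>n\<close> is at most a constant times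
  the norm of \<open>\<psi>\<^sub>n\<close> (\<open>orbit_product_lower\<close>).

  The whole disk. Suppose that \<open>T - c\<close> is invertible with \<open>0 < |c| < |v a|\<close>. As \<open>T (b f) = \<mu> b T f\<close>
  and multiplication by \<open>b\<close> is isometric, \<open>T - c / \<mu>\<^sup>k\<close> is invertible for every \<open>k\<close>, with the same bound
  for its inverse (\<open>resolvent_bound_rotate\<close>). Averaging these inverses over \<open>k\<close> imitates the Riesz
  projection onto the part of the spectrum inside the circle of radius \<open>|c|\<close>. The limit of the averages
  commutes with multiplication by \<open>b\<close>, so it is multiplication by a function \<open>h\<close>; it commutes with \<open>T\<close>, so
  \<open>h \<circ> \<phi> = h\<close> and \<open>h\<close> is constant. If \<open>h = 0\<close>, then \<open>T\<close> is invertible. If \<open>h \<noteq> 0\<close>, then the norms of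
  \<open>T\<^sup>n 1 = \<psi>\<^sub>n\<close> are at most a constant times \<open>|c|\<^sup>n\<close> (\<open>resolvent_dichotomy\<close>). The first is excluded by
  hypothesis, the second by the lower bound for \<open>\<psi>\<^sub>n\<close>. The circle \<open>|c| = |v a|\<close> belongs to the spectrum
  because the set of all \<open>c\<close> for which \<open>T - c\<close> is invertible is open.
\<close>

section \<open>Poisson's formula and Littlewood subordination\<close>

definition poisson_kernel :: "complex \<Rightarrow> real \<Rightarrow> real" where
  "poisson_kernel w t = (1 - (norm w)\<^sup>2) / (norm (cis t - w))\<^sup>2"

lemma cis_minus_nonzero: "norm w < 1 \<Longrightarrow> cis t - w \<noteq> 0"
  by (metis eq_iff_diff_eq_0 less_irrefl norm_cis)

lemma one_minus_cnj_cis: "1 - cnj w * cis t = cis t * cnj (cis t - w)"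
proof -
  have "cis t * cnj (cis t) = 1"
    by (metis complex_norm_square norm_cis of_real_1 power_one)
  thus ?thesis by (simp add: algebra_simps)
qed

text \<open>
  Being the real part of a function holomorphic in \<open>w\<close>, the kernel has the mean value property in
  \<open>w\<close>; this is what \<open>subordination_unit_circle\<close> uses.
\<close>

lemma poisson_kernel_Re:
  assumes "norm w < 1"
  shows "poisson_kernel w t = Re ((cis t + w) / (cis t - w))"
proof -
  have *: "(norm (cis t - w))\<^sup>2 \<noteq> 0"
    using cis_minus_nonzero[OF assms] by simp
  have "Re ((cis t + w) * cnj (cis t - w)) = 1 - (norm w)\<^sup>2"
    using sin_cos_squared_add[of t]
    unfolding cmod_power2 by (simp add: algebra_simps power2_eq_square)
  thus ?thesis
    unfolding poisson_kernel_def
    using Re_divide_Reals complex_div_cnj[of "cis t + w" "cis t - w"]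
    by (metis Re_divide_of_real of_real_power)
qed

lemma poisson_kernel_nonneg: "norm w < 1 \<Longrightarrow> 0 \<le> poisson_kernel w t"
  unfolding poisson_kernel_def by (simp add: abs_square_le_1)

lemma poisson_kernel_le:
  assumes "norm w < 1"
  shows "poisson_kernel w t \<le> (1 + norm w) / (1 - norm w)"
proof -
  have "1 - norm w \<le> norm (cis t - w)"
    using norm_triangle_ineq2[of "cis t" w] by simp
  hence "(1 - norm w)\<^sup>2 \<le> (norm (cis t - w))\<^sup>2"
    using assms by (intro power_mono) auto
  moreover have "0 \<le> 1 - (norm w)\<^sup>2" using assms by (simp add: abs_square_le_1)
  ultimately have "poisson_kernel w t \<le> (1 - (norm w)\<^sup>2) / (1 - norm w)\<^sup>2"
    unfolding poisson_kernel_def using assms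
    by (intro divide_left_mono mult_pos_pos zero_less_power)
       (auto intro: order.strict_trans2)
  also have "1 - (norm w)\<^sup>2 = (1 + norm w) * (1 - norm w)"
    by (simp add: power2_eq_square algebra_simps)
  also have "\<dots> / (1 - norm w)\<^sup>2 = (1 + norm w) / (1 - norm w)"
    using assms by (simp add: power2_eq_square)
  finally show ?thesis .
qed

lemma poisson_kernel_zero [simp]: "poisson_kernel 0 t = 1"
  by (simp add: poisson_kernel_def)

text \<open>
  Cauchy's formula for \<open>g u / (1 - cnj w * u)\<close>: on the unit circle the extra factor turns the Cauchy
  kernel into the Poisson kernel, by \<open>one_minus_cnj_cis\<close>, and at \<open>w\<close> it has the value
  \<open>1 / (1 - |w|\<^sup>2)\<close>.
\<close>

lemma Poisson_formula:
  assumes "continuous_on (cball 0 1) g" and hol: "g holomorphic_on ball 0 1" and w: "norm w < 1"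
  shows "((\<lambda>t. poisson_kernel w t *\<^sub>R g (cis t)) has_integral (2 * pi) *\<^sub>R g w) {0..2*pi}"
proof -
  have nz: "1 - cnj w * u \<noteq> 0" if "norm u \<le> 1" for u
  proof -
    have "norm (cnj w * u) \<le> norm w * 1"
      unfolding norm_mult complex_mod_cnj by (rule mult_left_mono) (use that in auto)
    hence "norm (cnj w * u) < 1" using w by linarith
    thus ?thesis by (metis eq_iff_diff_eq_0 less_irrefl norm_one)
  qed
  have ww: "1 - cnj w * w = of_real (1 - (norm w)\<^sup>2)"
    by (simp add: complex_norm_square[symmetric] mult.commute)
  have wnz: "1 - cnj w * w \<noteq> 0" using nz[of w] w by simp
  define f where "f = (\<lambda>u. g u / (1 - cnj w * u))"
  have "((\<lambda>u. f u/(u-w)) has_contour_integral (2 * of_real pi * \<i> * f w)) (circlepath 0 1)"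
  proof (rule Cauchy_integral_circlepath)
    show "continuous_on (cball 0 1) f"
      unfolding f_def using assms(1) nz by (auto intro!: continuous_intros)
    show "f holomorphic_on ball 0 1"
      unfolding f_def using hol nz by (auto intro!: holomorphic_intros)
  qed (use w in auto)
  hence "((\<lambda>t. f (cis t) / (cis t - w) * \<i> * cis t) has_integral (2 * of_real pi * \<i> * f w)) {0..2*pi}"
    unfolding circlepath_def by (subst (asm) has_contour_integral_part_circlepath_iff) auto
  hence "((\<lambda>t. ((1 - cnj w * w) / \<i>) * (f (cis t) / (cis t - w) * \<i> * cis t)) has_integral
       ((1 - cnj w * w) / \<i>) * (2 * of_real pi * \<i> * f w)) {0..2*pi}"
    by (rule has_integral_mult_right)
  moreover have "((1 - cnj w * w) / \<i>) * (2 * of_real pi * \<i> * f w) = (2 * pi) *\<^sub>R g w"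
    using wnz by (simp add: f_def scaleR_conv_of_real)
  moreover have "((1 - cnj w * w) / \<i>) * (f (cis t) / (cis t - w) * \<i> * cis t)
      = poisson_kernel w t *\<^sub>R g (cis t)" for t
  proof -
    have n: "cis t - w \<noteq> 0" "cnj (cis t - w) \<noteq> 0"
      using cis_minus_nonzero[OF w] by (auto simp del: complex_cnj_diff)
    have "f (cis t) / (cis t - w) * cis t = g (cis t) / (cis t * cnj (cis t - w)) / (cis t - w) * cis t"
      unfolding f_def one_minus_cnj_cis ..
    also have "\<dots> = g (cis t) / ((cis t - w) * cnj (cis t - w))"
      using n by (simp add: field_simps del: complex_cnj_diff)
    also have "\<dots> = g (cis t) / of_real ((norm (cis t - w))\<^sup>2)"
      by (simp only: complex_norm_square)
    finally have "f (cis t) / (cis t - w) * cis t = g (cis t) / of_real ((norm (cis t - w))\<^sup>2)" .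
    moreover have "((1 - cnj w * w) / \<i>) * (f (cis t) / (cis t - w) * \<i> * cis t)
       = of_real (1 - (norm w)\<^sup>2) * (f (cis t) / (cis t - w) * cis t)"
    proof -
      have "(A / \<i>) * (X * \<i> * Y) = (\<i> / \<i>) * (A * (X * Y))" for A X Y :: complex
        unfolding divide_inverse by (simp only: mult_ac)
      moreover have "\<i> / \<i> * x = x" for x by simp
      ultimately have "(A / \<i>) * (X * \<i> * Y) = A * (X * Y)" for A X Y :: complex
        by (simp only:)
      thus ?thesis unfolding ww .
    qed
    ultimately show ?thesis
      by (simp add: poisson_kernel_def scaleR_conv_of_real)
  qed
  ultimately show ?thesis by simp
qed

lemma continuous_poisson_kernel:
  assumes "continuous_on S w" "continuous_on S u" "\<And>x. x \<in> S \<Longrightarrow> norm (w x) < 1"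
  shows "continuous_on S (\<lambda>x. poisson_kernel (w x) (u x))"
  unfolding poisson_kernel_def
  using assms cis_minus_nonzero by (intro continuous_intros) auto

lemma poisson_bound:
  assumes "continuous_on (cball 0 1) g" "g holomorphic_on ball 0 1" and w: "norm w < 1"
  shows "2 * pi * norm (g w) \<le> integral {0..2*pi} (\<lambda>t. poisson_kernel w t * norm (g (cis t)))"
proof -
  have c: "continuous_on {0..2*pi} (\<lambda>t. g (cis t))"
    by (rule continuous_on_compose2[OF assms(1)]) (auto intro!: continuous_intros)
  have "norm ((2 * pi) *\<^sub>R g w) \<le> integral {0..2*pi} (\<lambda>t. poisson_kernel w t * norm (g (cis t)))"
    unfolding integral_unique[OF Poisson_formula[OF assms], symmetric]
  proof (rule integral_norm_bound_integral)
    show "(\<lambda>t. poisson_kernel w t *\<^sub>R g (cis t)) integrable_on {0..2*pi}"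
      using Poisson_formula[OF assms] by blast
    show "(\<lambda>t. poisson_kernel w t * norm (g (cis t))) integrable_on {0..2*pi}"
      using w c by (intro integrable_continuous_interval continuous_intros continuous_poisson_kernel) auto
  qed (use poisson_kernel_nonneg[OF w] in auto)
  thus ?thesis by simp
qed

lemma dilation_regular:
  assumes f: "f holomorphic_on ball 0 1" and r: "0 \<le> r" "r < 1"
  shows "continuous_on (cball 0 1) (\<lambda>z. f (of_real r * z))"
    and "(\<lambda>z. f (of_real r * z)) holomorphic_on ball 0 1"
proof -
  have "norm (of_real r * z) < 1" if "norm z \<le> 1" for z :: complex
    using r that mult_left_le[of "norm z" r] by (simp add: norm_mult)
  hence sub: "(\<lambda>z. of_real r * z) ` cball 0 1 \<subseteq> ball (0::complex) 1" by auto
  show "continuous_on (cball 0 1) (\<lambda>z. f (of_real r * z))"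
    by (rule continuous_on_compose2[OF holomorphic_on_imp_continuous_on[OF f]])
       (use sub in \<open>auto intro!: continuous_intros\<close>)
  have sub': "(\<lambda>z. of_real r * z) ` ball 0 1 \<subseteq> ball (0::complex) 1"
    using sub ball_subset_cball by (blast intro: order_trans[OF image_mono])
  show "(\<lambda>z. f (of_real r * z)) holomorphic_on ball 0 1"
    by (rule holomorphic_on_compose_gen[OF _ f sub', unfolded o_def]) (intro holomorphic_intros)
qed

text \<open>
  Littlewood subordination. The Poisson formula for \<open>g\<^sup>2\<close> bounds \<open>|g (\<theta> z)|\<^sup>2\<close> by an average of
  \<open>|g|\<^sup>2\<close> with weight \<open>poisson_kernel (\<theta> z)\<close>. In the average over \<open>|z| = r\<close> the order of integration
  is exchanged; the mean of the weight is then its value at \<open>\<theta> 0\<close>. Taking \<open>\<theta>\<close> to be a dilation, a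
  constant or an automorphism gives the growth of the mean squares in the radius, the boundedness of
  point evaluations and the boundedness of composition operators.
\<close>

lemma subordination_unit_circle:
  assumes gc: "continuous_on (cball 0 1) g" and gh: "g holomorphic_on ball 0 1"
    and \<theta>: "\<theta> holomorphic_on ball 0 1" and r: "0 \<le> r" "r < 1"
    and \<theta>1: "\<And>z. norm z \<le> r \<Longrightarrow> norm (\<theta> z) < 1"
  shows "mean_square (\<lambda>z. g (\<theta> z)) r \<le> (1 + norm (\<theta> 0)) / (1 - norm (\<theta> 0)) * mean_square g 1"
proof -
  define w where "w = (\<lambda>t. \<theta> (of_real r * cis t))"
  have nr: "norm (of_real r * z) \<le> r" if "norm z \<le> 1" for z :: complex
    using r that by (simp add: norm_mult mult_left_le)
  have w1: "norm (w t) < 1" for t unfolding w_def by (rule \<theta>1) (rule nr, simp)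
  note \<theta>c = dilation_regular(1)[OF \<theta> r] and \<theta>h = dilation_regular(2)[OF \<theta> r]
  have wc: "continuous_on UNIV w"
    unfolding w_def
    by (rule continuous_on_compose2[OF \<theta>c, of UNIV cis]) (auto intro!: continuous_intros)
  have gcis: "continuous_on UNIV (\<lambda>t. g (cis t))"
    by (rule continuous_on_compose2[OF gc]) (auto intro!: continuous_intros)
  have gw: "continuous_on UNIV (\<lambda>t. g (w t))"
    by (rule continuous_on_compose2[OF gc wc]) (auto simp: less_imp_le[OF w1])
  have g2c: "continuous_on (cball 0 1) (\<lambda>z. (g z)\<^sup>2)" and g2h: "(\<lambda>z. (g z)\<^sup>2) holomorphic_on ball 0 1"
    using gc gh by (auto intro!: continuous_intros holomorphic_intros)
  define F where "F = (\<lambda>t s. poisson_kernel (w t) s * (norm (g (cis s)))\<^sup>2)"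
  have Fc: "continuous_on UNIV (\<lambda>(t,s). F t s)"
    unfolding F_def split_def
    by (intro continuous_intros continuous_poisson_kernel
        continuous_on_compose2[OF wc] continuous_on_compose2[OF gcis]) (use w1 in auto)
  have Fc2: "continuous_on (cbox (0,0) (2*pi,2*pi)) (\<lambda>(t,s). F t s)"
    by (rule continuous_on_subset[OF Fc]) auto
  have intF: "(\<lambda>t. integral {0..2*pi} (F t)) integrable_on {0..2*pi}"
    using integral_continuous_on_param[of "{0..2*pi}" 0 "2*pi" F]
      continuous_on_subset[OF Fc subset_UNIV]
    by (intro integrable_continuous_interval) auto
  (* the kernel, as a function of its first argument, is harmonic *)
  have mean_P: "integral {0..2*pi} (\<lambda>t. F t s) \<le>
      2*pi * ((1 + norm (\<theta> 0)) / (1 - norm (\<theta> 0)) * (norm (g (cis s)))\<^sup>2)" for s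
  proof -
    define k where "k = (\<lambda>z. (cis s + \<theta> (of_real r * z)) / (cis s - \<theta> (of_real r * z)))"
    have nz: "cis s - \<theta> (of_real r * z) \<noteq> 0" if "norm z \<le> 1" for z
      by (rule cis_minus_nonzero) (use \<theta>1 nr that in auto)
    have "continuous_on (cball 0 1) k" "k holomorphic_on ball 0 1"
      unfolding k_def using \<theta>c \<theta>h nz by (auto intro!: continuous_intros holomorphic_intros)
    from Poisson_formula[OF this, of 0]
    have "((\<lambda>t. k (cis t)) has_integral (2*pi) *\<^sub>R k 0) {0..2*pi}" by simp
    from has_integral_linear[OF this bounded_linear_Re]
    have "((\<lambda>t. poisson_kernel (w t) s) has_integral 2*pi * poisson_kernel (\<theta> 0) s) {0..2*pi}"
      using poisson_kernel_Re[OF w1] poisson_kernel_Re[of "\<theta> 0"] \<theta>1[of 0] r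
      by (simp add: o_def k_def w_def)
    hence "((\<lambda>t. F t s) has_integral 2*pi * poisson_kernel (\<theta> 0) s * (norm (g (cis s)))\<^sup>2) {0..2*pi}"
      unfolding F_def by (rule has_integral_mult_left)
    hence "integral {0..2*pi} (\<lambda>t. F t s) = 2*pi * poisson_kernel (\<theta> 0) s * (norm (g (cis s)))\<^sup>2"
      by blast
    also have "\<dots> \<le> 2*pi * ((1 + norm (\<theta> 0)) / (1 - norm (\<theta> 0)) * (norm (g (cis s)))\<^sup>2)"
      using poisson_kernel_le[of "\<theta> 0" s] \<theta>1[of 0] r
      unfolding mult.assoc by (intro mult_left_mono mult_right_mono) auto
    finally show ?thesis .
  qed
  have "integral {0..2*pi} (\<lambda>t. 2 * pi * (norm (g (w t)))\<^sup>2) \<le> integral {0..2*pi} (\<lambda>t. integral {0..2*pi} (F t))"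
  proof (rule integral_le[OF _ intF])
    show "(\<lambda>t. 2 * pi * (norm (g (w t)))\<^sup>2) integrable_on {0..2*pi}"
      by (intro integrable_continuous_interval continuous_intros continuous_on_subset[OF gw]) auto
    show "2 * pi * (norm (g (w t)))\<^sup>2 \<le> integral {0..2*pi} (F t)" for t
      using poisson_bound[OF g2c g2h w1[of t]] by (simp add: F_def norm_power)
  qed
  also have "\<dots> = integral {0..2*pi} (\<lambda>s. integral {0..2*pi} (\<lambda>t. F t s))"
    using integral_swap_continuous[OF Fc2] by simp
  also have "\<dots> \<le> integral {0..2*pi} (\<lambda>s. 2*pi * ((1 + norm (\<theta> 0)) / (1 - norm (\<theta> 0)) * (norm (g (cis s)))\<^sup>2))"
  proof (rule integral_le[OF _ _ mean_P])
    have "continuous_on UNIV (\<lambda>(s,t). F t s)"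
      unfolding F_def split_def
      by (intro continuous_intros continuous_poisson_kernel
          continuous_on_compose2[OF wc] continuous_on_compose2[OF gcis]) (use w1 in auto)
    thus "(\<lambda>s. integral {0..2*pi} (\<lambda>t. F t s)) integrable_on {0..2*pi}"
      using integral_continuous_on_param[of "{0..2*pi}" 0 "2*pi" "\<lambda>s t. F t s"]
        continuous_on_subset[OF _ subset_UNIV]
      by (intro integrable_continuous_interval) auto
    show "(\<lambda>s. 2*pi * ((1 + norm (\<theta> 0)) / (1 - norm (\<theta> 0)) * (norm (g (cis s)))\<^sup>2)) integrable_on {0..2*pi}"
      by (intro integrable_continuous_interval continuous_intros continuous_on_subset[OF gcis]) auto
  qed
  finally have "2 * pi * integral {0..2*pi} (\<lambda>t. (norm (g (w t)))\<^sup>2)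
      \<le> 2 * pi * ((1 + norm (\<theta> 0)) / (1 - norm (\<theta> 0)) * integral {0..2*pi} (\<lambda>s. (norm (g (cis s)))\<^sup>2))"
    by (simp only: Henstock_Kurzweil_Integration.integral_mult_right)
  from mult_left_le_imp_le[OF this]
  have "integral {0..2*pi} (\<lambda>t. (norm (g (w t)))\<^sup>2)
      \<le> (1 + norm (\<theta> 0)) / (1 - norm (\<theta> 0)) * integral {0..2*pi} (\<lambda>s. (norm (g (cis s)))\<^sup>2)"
    by simp
  from divide_right_mono[OF this, of "2 * pi"] show ?thesis
    unfolding mean_square_def w_def by simp
qed

lemma subordination:
  assumes f: "f holomorphic_on ball 0 1"
    and \<theta>: "\<theta> holomorphic_on ball 0 1" and r: "0 \<le> r" "r < 1" and R: "R < 1"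
    and \<theta>R: "\<And>z. norm z \<le> r \<Longrightarrow> norm (\<theta> z) < R"
  shows "mean_square (\<lambda>z. f (\<theta> z)) r \<le> (R + norm (\<theta> 0)) / (R - norm (\<theta> 0)) * mean_square f R"
proof -
  have R0: "0 < R" using \<theta>R[of 0] r by (simp add: order.strict_trans1[OF norm_ge_zero])
  have "mean_square (\<lambda>z. f (of_real R * (\<theta> z / of_real R))) r
     \<le> (1 + norm (\<theta> 0 / of_real R)) / (1 - norm (\<theta> 0 / of_real R)) * mean_square (\<lambda>z. f (of_real R * z)) 1"
  proof (rule subordination_unit_circle[where \<theta> = "\<lambda>z. \<theta> z / of_real R" and g = "\<lambda>z. f (of_real R * z)"])
    show "continuous_on (cball 0 1) (\<lambda>z. f (of_real R * z))"
      "(\<lambda>z. f (of_real R * z)) holomorphic_on ball 0 1"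
      using dilation_regular[OF f, of R] R R0 by auto
    show "(\<lambda>z. \<theta> z / of_real R) holomorphic_on ball 0 1"
      using \<theta> R0 by (auto intro!: holomorphic_intros)
  qed (use r R0 \<theta>R in \<open>auto simp: norm_divide\<close>)
  moreover have "(1 + norm (\<theta> 0 / of_real R)) / (1 - norm (\<theta> 0 / of_real R))
       = (R + norm (\<theta> 0)) / (R - norm (\<theta> 0))"
    using R0 \<theta>R[of 0] r by (simp add: norm_divide field_simps)
  ultimately show ?thesis using R0 by (simp add: mean_square_def)
qed

section \<open>The norm of the Hardy space\<close>

lemma circle_in_ball: "0 \<le> r \<Longrightarrow> r < 1 \<Longrightarrow> of_real r * cis t \<in> ball 0 1"
  by (simp add: norm_mult)

lemma continuous_on_circle:
  assumes "f holomorphic_on ball 0 1" "0 \<le> r" "r < 1"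
  shows "continuous_on S (\<lambda>t. f (of_real r * cis t))"
  by (rule continuous_on_compose2[OF holomorphic_on_imp_continuous_on[OF assms(1)]])
     (use assms in \<open>auto intro!: continuous_intros simp: norm_mult\<close>)

lemma mean_square_cong:
  "(\<And>z. z \<in> ball 0 1 \<Longrightarrow> f z = g z) \<Longrightarrow> 0 \<le> r \<Longrightarrow> r < 1 \<Longrightarrow> mean_square f r = mean_square g r"
  unfolding mean_square_def using circle_in_ball[of r] by simp

lemma hardy_class_cong:
  assumes "\<And>z. z \<in> ball 0 1 \<Longrightarrow> f z = g z"
  shows "hardy_class f \<longleftrightarrow> hardy_class g"
proof -
  have "mean_square f ` {0<..<1} = mean_square g ` {0<..<1}"
    using mean_square_cong[of f g, OF assms] by (intro image_cong) auto
  moreover have "f holomorphic_on ball 0 1 \<longleftrightarrow> g holomorphic_on ball 0 1"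
    by (rule holomorphic_cong[OF refl assms])
  ultimately show ?thesis unfolding hardy_class_def by simp
qed

lemma H2_norm_cong:
  assumes "\<And>z. z \<in> ball 0 1 \<Longrightarrow> f z = g z"
  shows "H2_norm f = H2_norm g"
proof -
  have "mean_square f ` {0<..<1} = mean_square g ` {0<..<1}"
    using mean_square_cong[of f g, OF assms] by (intro image_cong) auto
  thus ?thesis unfolding H2_norm_def by simp
qed

lemma hardy_class_holo: "hardy_class f \<Longrightarrow> f holomorphic_on ball 0 1"
  by (simp add: hardy_class_def)

lemma mean_square_mono_integrand:
  assumes "f holomorphic_on ball 0 1" "g holomorphic_on ball 0 1" "0 \<le> r" "r < 1"
    and "\<And>t. norm (f (of_real r * cis t)) \<le> norm (g (of_real r * cis t))"
  shows "mean_square f r \<le> mean_square g r"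
  unfolding mean_square_def
  by (intro divide_right_mono integral_le integrable_continuous_interval continuous_intros
      continuous_on_circle power_mono) (use assms in auto)

lemma mean_square_nonneg: "0 \<le> mean_square f r"
  unfolding mean_square_def
  by (cases "(\<lambda>t. (norm (f (of_real r * cis t)))\<^sup>2) integrable_on {0..2*pi}")
     (auto intro!: divide_nonneg_nonneg integral_nonneg simp: not_integrable_integral)

lemma mean_square_mono:
  assumes "f holomorphic_on ball 0 1" "0 \<le> r" "r \<le> R" "R < 1"
  shows "mean_square f r \<le> mean_square f R"
proof (cases "r = R")
  case False
  have "mean_square (\<lambda>z. f (id z)) r \<le> (R + norm (id 0 :: complex)) / (R - norm (id 0 :: complex)) * mean_square f R"
    by (rule subordination) (use assms False in auto)
  thus ?thesis using assms False by simp
qed auto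

text \<open>
  For \<open>0 < r\<close> this is the definition of the norm as a supremum; \<open>r = 0\<close> is reached by monotonicity.
\<close>

lemma mean_square_le_norm:
  assumes "hardy_class f" "0 \<le> r" "r < 1"
  shows "mean_square f r \<le> (H2_norm f)\<^sup>2"
proof -
  have bdd: "bdd_above (mean_square f ` {0<..<1})" using assms by (simp add: hardy_class_def)
  have "mean_square f r \<le> mean_square f ((r+1)/2)"
    by (rule mean_square_mono) (use assms hardy_class_holo in auto)
  also have "\<dots> \<le> (SUP r\<in>{0<..<1}. mean_square f r)"
    by (rule cSUP_upper[OF _ bdd]) (use assms in auto)
  finally have *: "mean_square f r \<le> (SUP r\<in>{0<..<1}. mean_square f r)" .
  hence "0 \<le> (SUP r\<in>{0<..<1}. mean_square f r)" using mean_square_nonneg[of f r] by linarith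
  thus ?thesis using * by (simp add: H2_norm_def)
qed

lemma H2_norm_nonneg: "hardy_class f \<Longrightarrow> 0 \<le> H2_norm f"
  unfolding hardy_class_def H2_norm_def
  by (metis cSUP_upper2 greaterThanLessThan_iff mean_square_nonneg real_sqrt_ge_zero
      dense zero_less_one)

lemma hardy_classI:
  assumes "f holomorphic_on ball 0 1" "0 \<le> B" "\<And>r. 0 < r \<Longrightarrow> r < 1 \<Longrightarrow> mean_square f r \<le> B\<^sup>2"
  shows "hardy_class f" "H2_norm f \<le> B"
proof -
  show "hardy_class f" unfolding hardy_class_def using assms(1,3) by (auto intro!: bdd_aboveI2)
  have "(SUP r\<in>{0<..<1}. mean_square f r) \<le> B\<^sup>2"
    by (rule cSUP_least) (use assms in auto)
  thus "H2_norm f \<le> B" unfolding H2_norm_def using assms(2) by (simp add: real_le_lsqrt)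
qed

text \<open>
  Near the boundary is enough, because the mean squares increase with the radius.
\<close>

lemma hardy_classI_near:
  assumes f: "f holomorphic_on ball 0 1" "0 \<le> B" and r0: "r0 < 1"
    and le: "\<And>r. r0 < r \<Longrightarrow> 0 < r \<Longrightarrow> r < 1 \<Longrightarrow> mean_square f r \<le> B\<^sup>2"
  shows "hardy_class f" "H2_norm f \<le> B"
proof -
  have *: "mean_square f r \<le> B\<^sup>2" if "0 < r" "r < 1" for r
  proof -
    define R where "R = (max r r0 + 1) / 2"
    have R: "R < 1" "r0 < R" "r \<le> R" "0 < R" unfolding R_def using that r0 by auto
    have "mean_square f r \<le> mean_square f R" by (rule mean_square_mono) (use f R that in auto)
    also have "\<dots> \<le> B\<^sup>2" by (rule le) (use R in auto)
    finally show ?thesis .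
  qed
  show "hardy_class f" "H2_norm f \<le> B" using hardy_classI[OF f *] by auto
qed

text \<open>
  \<open>subordination\<close> with \<open>R\<close> large enough that \<open>|\<theta>| < R\<close> on the disk of radius \<open>r\<close> and that
  \<open>R \<ge> (1 + |\<theta> 0|) / 2\<close>; the second condition makes the constant independent of \<open>r\<close>.
\<close>

lemma hardy_class_compose:
  assumes f: "hardy_class f" and \<theta>: "\<theta> holomorphic_on ball 0 1"
    and \<theta>1: "\<And>z. norm z < 1 \<Longrightarrow> norm (\<theta> z) < 1"
  shows "hardy_class (\<lambda>z. f (\<theta> z))"
    and "H2_norm (\<lambda>z. f (\<theta> z)) \<le> sqrt (4 / (1 - norm (\<theta> 0))) * H2_norm f"
proof -
  have \<theta>0: "norm (\<theta> 0) < 1" using \<theta>1[of 0] by simp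
  have fh: "f holomorphic_on ball 0 1" using f by (rule hardy_class_holo)
  have hol: "(\<lambda>z. f (\<theta> z)) holomorphic_on ball 0 1"
    by (rule holomorphic_on_compose_gen[OF \<theta> fh, unfolded o_def]) (use \<theta>1 in auto)
  have "mean_square (\<lambda>z. f (\<theta> z)) r \<le> (sqrt (4 / (1 - norm (\<theta> 0))) * H2_norm f)\<^sup>2" if r: "0 < r" "r < 1" for r
  proof -
    have "continuous_on (cball 0 r) (\<lambda>z. norm (\<theta> z))"
      by (intro continuous_intros holomorphic_on_imp_continuous_on holomorphic_on_subset[OF \<theta>]) (use r in auto)
    from continuous_attains_sup[OF compact_cball _ this]
    obtain x where x: "x \<in> cball 0 r" "\<And>y. y \<in> cball 0 r \<Longrightarrow> norm (\<theta> y) \<le> norm (\<theta> x)"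
      using r by auto
    have x1: "norm (\<theta> x) < 1" using x r by (intro \<theta>1) auto
    define R where "R = (1 + norm (\<theta> x)) / 2"
    have R: "R < 1" "norm (\<theta> x) < R" "norm (\<theta> 0) \<le> norm (\<theta> x)"
      using x1 x(2)[of 0] r by (auto simp: R_def)
    have R0: "0 < R" using R(2) norm_ge_zero[of "\<theta> x"] by linarith
    define s where "s = norm (\<theta> 0)"
    have s: "0 \<le> s" "s < 1" "(1 + s) / 2 \<le> R" using \<theta>0 R by (auto simp: s_def R_def)
    have "mean_square (\<lambda>z. f (\<theta> z)) r \<le> (R + s) / (R - s) * mean_square f R"
      unfolding s_def
      by (rule subordination[OF fh \<theta>]) (use r R order.strict_trans1[OF x(2) R(2)] in auto)
    also have "\<dots> \<le> (4 / (1 - s)) * (H2_norm f)\<^sup>2"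
    proof (rule mult_mono)
      show "(R + s) / (R - s) \<le> 4 / (1 - s)"
      proof -
        have "(R + s) / (R - s) \<le> 2 / (R - s)" using s R by (intro divide_right_mono) auto
        also have "\<dots> \<le> 2 / ((1 - s) / 2)"
          using s by (intro divide_left_mono mult_pos_pos) argo+
        finally show ?thesis by simp
      qed
      show "mean_square f R \<le> (H2_norm f)\<^sup>2" by (rule mean_square_le_norm) (use f R R0 in auto)
    qed (use s mean_square_nonneg in auto)
    also have "\<dots> = (sqrt (4 / (1 - norm (\<theta> 0))) * H2_norm f)\<^sup>2"
      using s by (simp add: power_mult_distrib s_def)
    finally show ?thesis .
  qed
  note * = hardy_classI[OF hol _ this]
  show "hardy_class (\<lambda>z. f (\<theta> z))" "H2_norm (\<lambda>z. f (\<theta> z)) \<le> sqrt (4 / (1 - norm (\<theta> 0))) * H2_norm f"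
    using * H2_norm_nonneg[OF f] \<theta>0 by auto
qed

lemma mean_square_const: "mean_square (\<lambda>_. c) r = (norm c)\<^sup>2"
  by (simp add: mean_square_def)

text \<open>
  Evaluation at \<open>z\<close> is composition with the constant map \<open>z\<close>.
\<close>

lemma hardy_point_evaluation:
  assumes f: "hardy_class f" and z: "norm z < 1"
  shows "norm (f z) \<le> sqrt (4 / (1 - norm z)) * H2_norm f"
proof -
  have c: "hardy_class (\<lambda>_. f z)"
    by (rule hardy_class_compose(1)[OF f, of "\<lambda>_. z"]) (use z in auto)
  have "(norm (f z))\<^sup>2 = mean_square (\<lambda>_. f z) (1/2)" by (simp add: mean_square_const)
  also have "\<dots> \<le> (H2_norm (\<lambda>_. f z))\<^sup>2"
    by (rule mean_square_le_norm[OF c]) auto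
  finally have "norm (f z) \<le> H2_norm (\<lambda>_. f z)"
    by (rule power2_le_imp_le) (rule H2_norm_nonneg[OF c])
  also have "\<dots> \<le> sqrt (4 / (1 - norm z)) * H2_norm f"
    by (rule hardy_class_compose(2)[OF f, of "\<lambda>_. z"]) (use z in auto)
  finally show ?thesis .
qed

lemma hardy_class_const: "hardy_class (\<lambda>_. c)" and H2_norm_const: "H2_norm (\<lambda>_. c) \<le> norm c"
  using hardy_classI[of "\<lambda>_. c" "norm c"] by (auto simp: mean_square_const)

lemma hardy_bounded_mult:
  assumes f: "hardy_class f" and g: "g holomorphic_on ball 0 1"
    and C: "\<And>z. norm z < 1 \<Longrightarrow> norm (g z) \<le> C"
  shows "hardy_class (\<lambda>z. g z * f z)" "H2_norm (\<lambda>z. g z * f z) \<le> C * H2_norm f"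
proof -
  have fh: "f holomorphic_on ball 0 1" using f by (rule hardy_class_holo)
  have C0: "0 \<le> C" using order_trans[OF norm_ge_zero C[of 0]] by simp
  have hol: "(\<lambda>z. g z * f z) holomorphic_on ball 0 1" using g fh by (auto intro!: holomorphic_intros)
  have "mean_square (\<lambda>z. g z * f z) r \<le> (C * H2_norm f)\<^sup>2" if r: "0 < r" "r < 1" for r
  proof -
    have "mean_square (\<lambda>z. g z * f z) r \<le> mean_square (\<lambda>z. of_real C * f z) r"
      by (rule mean_square_mono_integrand)
         (use r fh hol C0 C in \<open>auto intro!: holomorphic_intros mult_right_mono simp: norm_mult\<close>)
    also have "\<dots> = C\<^sup>2 * mean_square f r"
      using C0 by (simp add: mean_square_def norm_mult power_mult_distrib)
    also have "\<dots> \<le> C\<^sup>2 * (H2_norm f)\<^sup>2"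
      using mean_square_le_norm[OF f] r by (intro mult_left_mono) auto
    finally show ?thesis by (simp add: power_mult_distrib)
  qed
  from hardy_classI[OF hol _ this]
  show "hardy_class (\<lambda>z. g z * f z)" "H2_norm (\<lambda>z. g z * f z) \<le> C * H2_norm f"
    using C0 H2_norm_nonneg[OF f] by auto
qed

lemma hardy_scale:
  assumes "hardy_class f"
  shows "hardy_class (\<lambda>z. c * f z)" "H2_norm (\<lambda>z. c * f z) \<le> norm c * H2_norm f"
  using hardy_bounded_mult[OF assms, of "\<lambda>_. c" "norm c"] by auto

text \<open>
  The triangle inequality follows from \<open>(x + y)\<^sup>2 \<le> (A + B) (x\<^sup>2 / A + y\<^sup>2 / B)\<close>, integrated, where
  \<open>A\<close> and \<open>B\<close> exceed the two norms by \<open>e\<close> so that they are positive.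
\<close>

lemma hardy_add:
  assumes f: "hardy_class f" and g: "hardy_class g"
  shows "hardy_class (\<lambda>z. f z + g z)" "H2_norm (\<lambda>z. f z + g z) \<le> H2_norm f + H2_norm g"
proof -
  have fh: "f holomorphic_on ball 0 1" "g holomorphic_on ball 0 1" using f g hardy_class_holo by auto
  have hol: "(\<lambda>z. f z + g z) holomorphic_on ball 0 1" using fh by (auto intro!: holomorphic_intros)
  have main: "hardy_class (\<lambda>z. f z + g z) \<and> H2_norm (\<lambda>z. f z + g z) \<le> (H2_norm f + e) + (H2_norm g + e)" if e: "e > 0" for e
  proof -
    define A B where "A = H2_norm f + e" and "B = H2_norm g + e"
    have A: "A > 0" "H2_norm f \<le> A" "0 \<le> H2_norm f" and B: "B > 0" "H2_norm g \<le> B" "0 \<le> H2_norm g"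
      using H2_norm_nonneg[OF f] H2_norm_nonneg[OF g] e by (auto simp: A_def B_def)
    have "mean_square (\<lambda>z. f z + g z) r \<le> (A + B)\<^sup>2" if r: "0 < r" "r < 1" for r
    proof -
      let ?x = "\<lambda>t. norm (f (of_real r * cis t))" and ?y = "\<lambda>t. norm (g (of_real r * cis t))"
      note c = continuous_on_circle[OF fh(1), of r "{0..2*pi}"] continuous_on_circle[OF fh(2), of r "{0..2*pi}"]
      have i: "(\<lambda>t. (?x t)\<^sup>2) integrable_on {0..2*pi}" "(\<lambda>t. (?y t)\<^sup>2) integrable_on {0..2*pi}"
        using c r by (auto intro!: integrable_continuous_interval continuous_intros)
      have CS: "(x + y)\<^sup>2 \<le> (A + B) / A * x\<^sup>2 + (A + B) / B * y\<^sup>2" for x y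
      proof -
        have "(A + B) / A * x\<^sup>2 + (A + B) / B * y\<^sup>2 - (x + y)\<^sup>2 = (B * x - A * y)\<^sup>2 / (A * B)"
          using A B by (simp add: field_simps power2_eq_square)
        moreover have "0 \<le> (B * x - A * y)\<^sup>2 / (A * B)" using A B by simp
        ultimately show ?thesis by linarith
      qed
      have "integral {0..2*pi} (\<lambda>t. (norm (f (of_real r * cis t) + g (of_real r * cis t)))\<^sup>2)
          \<le> integral {0..2*pi} (\<lambda>t. (A + B) / A * (?x t)\<^sup>2 + (A + B) / B * (?y t)\<^sup>2)"
      proof (rule integral_le)
        show "(\<lambda>t. (norm (f (of_real r * cis t) + g (of_real r * cis t)))\<^sup>2) integrable_on {0..2*pi}"
          using c r by (auto intro!: integrable_continuous_interval continuous_intros)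
        show "(\<lambda>t. (A + B) / A * (?x t)\<^sup>2 + (A + B) / B * (?y t)\<^sup>2) integrable_on {0..2*pi}"
          by (rule integrable_add[OF integrable_on_mult_right[OF i(1)] integrable_on_mult_right[OF i(2)]])
        show "(norm (f (of_real r * cis t) + g (of_real r * cis t)))\<^sup>2 \<le> (A + B) / A * (?x t)\<^sup>2 + (A + B) / B * (?y t)\<^sup>2" for t
          by (rule order_trans[OF power_mono[OF norm_triangle_ineq] CS]) auto
      qed
      also have "\<dots> = (A + B) / A * integral {0..2*pi} (\<lambda>t. (?x t)\<^sup>2) + (A + B) / B * integral {0..2*pi} (\<lambda>t. (?y t)\<^sup>2)"
        by (simp only: Henstock_Kurzweil_Integration.integral_add[OF integrable_on_mult_right[OF i(1)]
            integrable_on_mult_right[OF i(2)]] Henstock_Kurzweil_Integration.integral_mult_right)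
      finally have "integral {0..2*pi} (\<lambda>t. (norm (f (of_real r * cis t) + g (of_real r * cis t)))\<^sup>2) / (2*pi)
          \<le> ((A + B) / A * integral {0..2*pi} (\<lambda>t. (?x t)\<^sup>2) + (A + B) / B * integral {0..2*pi} (\<lambda>t. (?y t)\<^sup>2)) / (2*pi)"
        by (rule divide_right_mono) simp
      hence "mean_square (\<lambda>z. f z + g z) r \<le> (A + B) / A * mean_square f r + (A + B) / B * mean_square g r"
        unfolding mean_square_def add_divide_distrib times_divide_eq_right .
      also have "\<dots> \<le> (A + B) / A * A\<^sup>2 + (A + B) / B * B\<^sup>2"
      proof (intro add_mono mult_left_mono)
        show "mean_square f r \<le> A\<^sup>2"
          using mean_square_le_norm[OF f, of r] r power_mono[OF A(2,3), of 2] by linarith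
        show "mean_square g r \<le> B\<^sup>2"
          using mean_square_le_norm[OF g, of r] r power_mono[OF B(2,3), of 2] by linarith
      qed (use A B in auto)
      also have "(A + B) / A * A\<^sup>2 = (A + B) * A" using A by (simp add: power2_eq_square)
      also have "(A + B) / B * B\<^sup>2 = (A + B) * B" using B by (simp add: power2_eq_square)
      also have "(A + B) * A + (A + B) * B = (A + B)\<^sup>2" by (simp add: power2_eq_square algebra_simps)
      finally show ?thesis .
    qed
    from hardy_classI[OF hol _ this] show ?thesis using A B unfolding A_def B_def by auto
  qed
  show "hardy_class (\<lambda>z. f z + g z)" using main[of 1] by simp
  show "H2_norm (\<lambda>z. f z + g z) \<le> H2_norm f + H2_norm g"
  proof (rule field_le_epsilon)
    fix e :: real assume "e > 0"
    thus "H2_norm (\<lambda>z. f z + g z) \<le> H2_norm f + H2_norm g + e" using main[of "e/2"] by simp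
  qed
qed

lemma hardy_diff:
  assumes f: "hardy_class f" and g: "hardy_class g"
  shows "hardy_class (\<lambda>z. f z - g z)" "H2_norm (\<lambda>z. f z - g z) \<le> H2_norm f + H2_norm g"
  using hardy_add[OF f hardy_scale(1)[OF g, of "-1"]] hardy_scale(2)[OF g, of "-1"] by auto

lemma hardy_sum:
  fixes f :: "nat \<Rightarrow> complex \<Rightarrow> complex"
  assumes "\<And>k. k < n \<Longrightarrow> hardy_class (f k)"
  shows "hardy_class (\<lambda>z. \<Sum>k<n. f k z) \<and> H2_norm (\<lambda>z. \<Sum>k<n. f k z) \<le> (\<Sum>k<n. H2_norm (f k))"
  using assms
proof (induction n)
  case 0
  show ?case using hardy_class_const[of 0] H2_norm_const[of 0] by simp
next
  case (Suc n)
  thus ?case using hardy_add[of "\<lambda>z. \<Sum>k<n. f k z" "f n"] by force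
qed

text \<open>
  Point evaluations are uniformly bounded on each smaller circle, so the mean squares converge by
  dominated convergence.
\<close>

lemma hardy_Fatou:
  assumes f: "\<And>n. hardy_class (f n)" "\<And>n. H2_norm (f n) \<le> B"
    and F: "F holomorphic_on ball 0 1" and lim: "\<And>z. norm z < 1 \<Longrightarrow> (\<lambda>n. f n z) \<longlonglongrightarrow> F z"
  shows "hardy_class F" "H2_norm F \<le> B"
proof -
  have B0: "0 \<le> B" using order_trans[OF H2_norm_nonneg[OF f(1)[of 0]] f(2)[of 0]] .
  have "mean_square F r \<le> B\<^sup>2" if r: "0 < r" "r < 1" for r
  proof -
    let ?E = "sqrt (4 / (1 - r)) * B"
    have E: "norm (f n (of_real r * cis t)) \<le> ?E" for n t
    proof -
      have "norm (f n (of_real r * cis t)) \<le> sqrt (4 / (1 - r)) * H2_norm (f n)"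
        using hardy_point_evaluation[OF f(1)[of n], of "of_real r * cis t"] r by (simp add: norm_mult)
      also have "\<dots> \<le> ?E" using f(2)[of n] r by (intro mult_left_mono) auto
      finally show ?thesis .
    qed
    have "(\<lambda>n. integral {0..2*pi} (\<lambda>t. (norm (f n (of_real r * cis t)))\<^sup>2))
        \<longlonglongrightarrow> integral {0..2*pi} (\<lambda>t. (norm (F (of_real r * cis t)))\<^sup>2)"
    proof (rule dominated_convergence(2))
      show "(\<lambda>t. (norm (f n (of_real r * cis t)))\<^sup>2) integrable_on {0..2*pi}" for n
        using r continuous_on_circle[OF hardy_class_holo[OF f(1)[of n]], of r]
        by (intro integrable_continuous_interval continuous_intros) auto
      show "(\<lambda>t. ?E\<^sup>2) integrable_on {0..2*pi}" by auto
      show "norm ((norm (f n (of_real r * cis t)))\<^sup>2) \<le> ?E\<^sup>2" for n t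
        using power_mono[OF E[of n t], of 2] by simp
      show "(\<lambda>n. (norm (f n (of_real r * cis t)))\<^sup>2) \<longlonglongrightarrow> (norm (F (of_real r * cis t)))\<^sup>2" for t
        using r by (intro tendsto_intros lim) (simp add: norm_mult)
    qed
    hence "(\<lambda>n. mean_square (f n) r) \<longlonglongrightarrow> mean_square F r"
      unfolding mean_square_def by (intro tendsto_intros) auto
    moreover have "mean_square (f n) r \<le> B\<^sup>2" for n
      using mean_square_le_norm[OF f(1)[of n], of r] r
        power_mono[OF f(2)[of n] H2_norm_nonneg[OF f(1)[of n]], of 2] by linarith
    ultimately show ?thesis by (intro LIMSEQ_le_const2[of _ "mean_square F r"]) auto
  qed
  from hardy_classI[OF F B0 this] show "hardy_class F" "H2_norm F \<le> B" by auto
qed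

lemma hardy_Montel:
  assumes f: "\<And>n. hardy_class (f n)" "\<And>n. H2_norm (f n) \<le> B"
  obtains F r where "strict_mono (r :: nat \<Rightarrow> nat)" "hardy_class F" "H2_norm F \<le> B"
    "\<And>z. norm z < 1 \<Longrightarrow> (\<lambda>n. f (r n) z) \<longlonglongrightarrow> F z"
proof -
  have B0: "0 \<le> B" using order_trans[OF H2_norm_nonneg[OF f(1)[of 0]] f(2)[of 0]] .
  have bdd: "\<exists>C. \<forall>h\<in>range f. \<forall>z\<in>K. norm (h z) \<le> C" if K: "compact K" "K \<subseteq> ball 0 1" for K
  proof (cases "K = {}")
    case False
    have "continuous_on K norm" by (intro continuous_intros)
    from continuous_attains_sup[OF K(1) False this]
    obtain x where x: "x \<in> K" "\<And>y. y \<in> K \<Longrightarrow> norm y \<le> norm x" by blast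
    have x1: "norm x < 1" using x K by auto
    have "norm (f n z) \<le> sqrt (4 / (1 - norm x)) * B" if "z \<in> K" for n z
    proof -
      have z: "norm z \<le> norm x" "norm z < 1" using x(2)[OF that] x1 by linarith+
      have "norm (f n z) \<le> sqrt (4 / (1 - norm z)) * H2_norm (f n)"
        by (rule hardy_point_evaluation[OF f(1) z(2)])
      also have "\<dots> \<le> sqrt (4 / (1 - norm x)) * B"
        using z x1 f(2)[of n] H2_norm_nonneg[OF f(1)[of n]]
        by (intro mult_mono real_sqrt_le_mono divide_left_mono) auto
      finally show ?thesis .
    qed
    thus ?thesis by blast
  qed auto
  have hol: "h holomorphic_on ball 0 1" if "h \<in> range f" for h
    using that hardy_class_holo[OF f(1)] by blast
  have "\<exists>F r. F holomorphic_on ball 0 1 \<and> strict_mono (r :: nat \<Rightarrow> nat) \<and>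
      (\<forall>z\<in>ball 0 1. (\<lambda>n. f (r n) z) \<longlonglongrightarrow> F z)"
  proof (rule Montel[OF open_ball hol bdd subset_refl])
    fix F and r :: "nat \<Rightarrow> nat"
    assume "F holomorphic_on ball 0 1" "strict_mono r" "\<And>z. z \<in> ball 0 1 \<Longrightarrow> (\<lambda>n. f (r n) z) \<longlonglongrightarrow> F z"
    thus ?thesis by (intro exI[of _ F] exI[of _ r]) auto
  qed
  then obtain F r where F: "F holomorphic_on ball 0 1" and r: "strict_mono (r :: nat \<Rightarrow> nat)"
    and lim: "\<And>z. z \<in> ball 0 1 \<Longrightarrow> (\<lambda>n. f (r n) z) \<longlonglongrightarrow> F z"
    by blast
  have "hardy_class F" "H2_norm F \<le> B"
    using hardy_Fatou[of "\<lambda>n. f (r n)" B F, OF f F] lim by auto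
  with r lim show ?thesis by (intro that[of r F]) auto
qed

text \<open>
  Montel's theorem supplies the holomorphy of the limit. This is the form in which the completeness of
  the Hardy space is used.
\<close>

lemma hardy_pointwise_limit:
  assumes f: "\<And>n. hardy_class (f n)" "\<And>n. H2_norm (f n) \<le> B"
    and lim: "\<And>z. norm z < 1 \<Longrightarrow> (\<lambda>n. f n z) \<longlonglongrightarrow> F z"
  shows "hardy_class F" "H2_norm F \<le> B"
proof -
  obtain G r where r: "strict_mono (r :: nat \<Rightarrow> nat)" and G: "hardy_class G" "H2_norm G \<le> B"
    and limG: "\<And>z. norm z < 1 \<Longrightarrow> (\<lambda>n. f (r n) z) \<longlonglongrightarrow> G z"
    using hardy_Montel[of f B, OF f] by blast
  have "F z = G z" if "z \<in> ball 0 1" for z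
  proof (rule LIMSEQ_unique)
    show "(\<lambda>n. f (r n) z) \<longlonglongrightarrow> F z"
      using LIMSEQ_subseq_LIMSEQ[OF lim[of z] r] that by (simp add: o_def)
    show "(\<lambda>n. f (r n) z) \<longlonglongrightarrow> G z" using limG[of z] that by simp
  qed
  hence "hardy_class F = hardy_class G" "H2_norm F = H2_norm G"
    by (intro hardy_class_cong H2_norm_cong; simp)+
  thus "hardy_class F" "H2_norm F \<le> B" using G by auto
qed

section \<open>Blaschke factors and rotations about a point\<close>

definition blaschke :: "complex \<Rightarrow> complex \<Rightarrow> complex" where
  "blaschke a z = (z - a) / (1 - cnj a * z)"

text \<open>
  The automorphism of the disk that fixes \<open>a\<close> and becomes multiplication by \<open>\<mu>\<close> in the coordinate
  \<open>blaschke a\<close>.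
\<close>

definition rotation_about :: "complex \<Rightarrow> complex \<Rightarrow> complex \<Rightarrow> complex" where
  "rotation_about a \<mu> z = blaschke (- a) (\<mu> * blaschke a z)"

lemma one_minus_norm_le_blaschke_denom:
  assumes "norm z \<le> 1"
  shows "1 - norm a \<le> norm (1 - cnj a * z)"
proof -
  have "norm (cnj a * z) \<le> norm a * 1"
    unfolding norm_mult complex_mod_cnj by (rule mult_left_mono) (use assms in auto)
  thus ?thesis using norm_triangle_ineq2[of 1 "cnj a * z"] by simp
qed

lemma blaschke_denom_nonzero:
  assumes "norm a < 1" "norm z \<le> 1"
  shows "1 - cnj a * z \<noteq> 0"
  using one_minus_norm_le_blaschke_denom[OF assms(2), of a] assms(1) by auto

lemma one_minus_norm_blaschke:
  assumes "norm a < 1" "norm z \<le> 1"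
  shows "1 - (norm (blaschke a z))\<^sup>2 = (1 - (norm a)\<^sup>2) * (1 - (norm z)\<^sup>2) / (norm (1 - cnj a * z))\<^sup>2"
proof -
  have nz: "(norm (1 - cnj a * z))\<^sup>2 \<noteq> 0" using blaschke_denom_nonzero[OF assms] by simp
  have "(norm (1 - cnj a * z))\<^sup>2 - (norm (z - a))\<^sup>2 = (1 - (norm a)\<^sup>2) * (1 - (norm z)\<^sup>2)"
    unfolding cmod_power2 by (simp add: power2_eq_square algebra_simps)
  moreover have "1 - (norm (blaschke a z))\<^sup>2
      = ((norm (1 - cnj a * z))\<^sup>2 - (norm (z - a))\<^sup>2) / (norm (1 - cnj a * z))\<^sup>2"
  proof -
    have "(norm (blaschke a z))\<^sup>2 = (norm (z - a))\<^sup>2 / (norm (1 - cnj a * z))\<^sup>2"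
      by (simp only: blaschke_def norm_divide power_divide)
    thus ?thesis using nz by (simp add: diff_divide_distrib del: norm_eq_zero power_eq_0_iff)
  qed
  ultimately show ?thesis by simp
qed

lemma norm_blaschke_less: 
  assumes "norm a < 1" "norm z < 1"
  shows "norm (blaschke a z) < 1"
proof -
  have "0 < (1 - (norm a)\<^sup>2) * (1 - (norm z)\<^sup>2) / (norm (1 - cnj a * z))\<^sup>2"
    using assms blaschke_denom_nonzero[of a z]
    by (intro divide_pos_pos mult_pos_pos) (auto simp: abs_square_less_1)
  hence "(norm (blaschke a z))\<^sup>2 < 1"
    using one_minus_norm_blaschke[of a z] assms by linarith
  thus ?thesis by (simp add: abs_square_less_1)
qed

lemma norm_blaschke_eq: 
  assumes "norm a < 1" "norm z = 1"
  shows "norm (blaschke a z) = 1"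
proof -
  have "(norm (blaschke a z))\<^sup>2 = 1\<^sup>2"
    using one_minus_norm_blaschke[of a z] assms by simp
  thus ?thesis by (simp add: power2_eq_1_iff)
     (metis norm_ge_zero not_one_le_zero le_minus_one_simps(3))
qed

lemma norm_blaschke_le: "norm a < 1 \<Longrightarrow> norm z \<le> 1 \<Longrightarrow> norm (blaschke a z) \<le> 1"
  using norm_blaschke_less[of a z] norm_blaschke_eq[of a z] by linarith

lemma blaschke_holomorphic: "norm a < 1 \<Longrightarrow> blaschke a holomorphic_on ball 0 1"
  unfolding blaschke_def using blaschke_denom_nonzero[of a] by (auto intro!: holomorphic_intros)

lemma blaschke_continuous: "norm a < 1 \<Longrightarrow> continuous_on (cball 0 1) (blaschke a)"
  unfolding blaschke_def using blaschke_denom_nonzero[of a] by (auto intro!: continuous_intros)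

lemma blaschke_eq_0_iff: "norm a < 1 \<Longrightarrow> norm z \<le> 1 \<Longrightarrow> blaschke a z = 0 \<longleftrightarrow> z = a"
  using blaschke_denom_nonzero[of a z] by (auto simp: blaschke_def)

lemma blaschke_inverse:
  assumes "norm a < 1" "norm z \<le> 1"
  shows "blaschke (- a) (blaschke a z) = z"
proof -
  have nz: "1 - cnj a * z \<noteq> 0" by (rule blaschke_denom_nonzero[OF assms])
  have aa: "1 - cnj a * a \<noteq> 0" using blaschke_denom_nonzero[of a a] assms by auto
  have "blaschke a z + a = z * (1 - cnj a * a) / (1 - cnj a * z)"
    unfolding blaschke_def using nz by (simp add: field_simps)
  moreover have "1 + cnj a * blaschke a z = (1 - cnj a * a) / (1 - cnj a * z)"
    unfolding blaschke_def using nz by (simp add: field_simps)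
  ultimately show ?thesis
    using nz aa by (simp add: blaschke_def[of "- a"])
qed

lemma blaschke_inverse': "norm a < 1 \<Longrightarrow> norm z \<le> 1 \<Longrightarrow> blaschke a (blaschke (- a) z) = z"
  using blaschke_inverse[of "- a" z] by simp

context
  fixes a \<mu> :: complex
  assumes a: "norm a < 1" and \<mu>: "norm \<mu> = 1"
begin

lemma norm_rotation_less: "norm z < 1 \<Longrightarrow> norm (rotation_about a \<mu> z) < 1"
  unfolding rotation_about_def using a \<mu> norm_blaschke_less[of a z]
  by (intro norm_blaschke_less) (auto simp: norm_mult)

lemma norm_rotation_eq: "norm z = 1 \<Longrightarrow> norm (rotation_about a \<mu> z) = 1"
  unfolding rotation_about_def using a \<mu> norm_blaschke_eq[of a z]
  by (intro norm_blaschke_eq) (auto simp: norm_mult)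

lemma norm_rotation_le: "norm z \<le> 1 \<Longrightarrow> norm (rotation_about a \<mu> z) \<le> 1"
  using norm_rotation_less[of z] norm_rotation_eq[of z] by linarith

lemma rotation_holomorphic: "rotation_about a \<mu> holomorphic_on ball 0 1"
proof -
  have "(\<lambda>z. \<mu> * blaschke a z) ` ball 0 1 \<subseteq> ball 0 1"
    using a \<mu> norm_blaschke_less[of a] by (auto simp: norm_mult)
  moreover have "(\<lambda>z. \<mu> * blaschke a z) holomorphic_on ball 0 1"
    using a by (intro holomorphic_on_mult holomorphic_on_const blaschke_holomorphic)
  ultimately have "(blaschke (- a) \<circ> (\<lambda>z. \<mu> * blaschke a z)) holomorphic_on ball 0 1"
    using a by (intro holomorphic_on_compose_gen[where t = "ball 0 1"] blaschke_holomorphic) auto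
  thus ?thesis unfolding rotation_about_def[abs_def] o_def .
qed

lemma rotation_continuous: "continuous_on (cball 0 1) (rotation_about a \<mu>)"
  unfolding rotation_about_def[abs_def]
  by (rule continuous_on_compose2[OF blaschke_continuous])
     (use a \<mu> norm_blaschke_le[of a] in \<open>auto intro!: continuous_intros blaschke_continuous simp: norm_mult\<close>)

lemma blaschke_rotation: "norm z \<le> 1 \<Longrightarrow> blaschke a (rotation_about a \<mu> z) = \<mu> * blaschke a z"
  unfolding rotation_about_def using a \<mu> norm_blaschke_le[of a z]
  by (intro blaschke_inverse') (auto simp: norm_mult)

lemma rotation_fixes: "rotation_about a \<mu> a = a"
  unfolding rotation_about_def by (simp add: blaschke_def)

lemma rotation_rotation:
  "norm z \<le> 1 \<Longrightarrow> rotation_about a \<nu> (rotation_about a \<mu> z) = rotation_about a (\<nu> * \<mu>) z"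
  unfolding rotation_about_def[of a \<nu>] rotation_about_def[of a "\<nu> * \<mu>"]
  by (simp add: blaschke_rotation mult.assoc)

end

lemma rotation_one: "norm a < 1 \<Longrightarrow> norm z \<le> 1 \<Longrightarrow> rotation_about a 1 z = z"
  by (simp add: rotation_about_def blaschke_inverse)

lemma hardy_blaschke_mult:
  assumes "norm a < 1" "hardy_class f"
  shows "hardy_class (\<lambda>z. blaschke a z * f z)" "H2_norm (\<lambda>z. blaschke a z * f z) \<le> H2_norm f"
  using hardy_bounded_mult[OF assms(2) blaschke_holomorphic[OF assms(1)], of 1]
    norm_blaschke_le[OF assms(1)] by auto

text \<open>
  Multiplication by a Blaschke factor is isometric: \<open>|b|\<close> tends to one uniformly at the boundary, and
  the norm is determined by circles near the boundary.
\<close>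

lemma hardy_blaschke_cancel:
  assumes a: "norm a < 1" and f: "f holomorphic_on ball 0 1"
    and bf: "hardy_class (\<lambda>z. blaschke a z * f z)"
  shows "hardy_class f" "H2_norm f \<le> H2_norm (\<lambda>z. blaschke a z * f z)"
proof -
  define B where "B = H2_norm (\<lambda>z. blaschke a z * f z)"
  have B0: "0 \<le> B" unfolding B_def by (rule H2_norm_nonneg[OF bf])
  define K where "K = (1 + norm a) / (1 - norm a)"
  have K: "K > 0" unfolding K_def using a by (auto intro!: divide_pos_pos add_pos_nonneg)
  have lower: "1 - K * (1 - r\<^sup>2) \<le> (norm (blaschke a (of_real r * cis t)))\<^sup>2" if r: "0 < r" "r < 1" for r t
  proof -
    let ?z = "of_real r * cis t"
    have z: "norm ?z = r" using r by (simp add: norm_mult)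
    have den: "(1 - norm a)\<^sup>2 \<le> (norm (1 - cnj a * ?z))\<^sup>2"
      using one_minus_norm_le_blaschke_denom[of ?z a] a r z by (intro power_mono) auto
    have "1 - (norm (blaschke a ?z))\<^sup>2 = (1 - (norm a)\<^sup>2) * (1 - r\<^sup>2) / (norm (1 - cnj a * ?z))\<^sup>2"
      using one_minus_norm_blaschke[of a ?z] a r z by simp
    also have "\<dots> \<le> (1 - (norm a)\<^sup>2) * (1 - r\<^sup>2) / (1 - norm a)\<^sup>2"
    proof (rule divide_left_mono[OF den])
      show "0 \<le> (1 - (norm a)\<^sup>2) * (1 - r\<^sup>2)"
        using a r by (intro mult_nonneg_nonneg) (auto simp: abs_square_le_1)
      show "0 < (norm (1 - cnj a * ?z))\<^sup>2 * (1 - norm a)\<^sup>2"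
        using blaschke_denom_nonzero[of a ?z] a r z by (intro mult_pos_pos zero_less_power) auto
    qed
    also have "(1 - (norm a)\<^sup>2) = (1 + norm a) * (1 - norm a)" by (simp add: power2_eq_square algebra_simps)
    also have "(1 + norm a) * (1 - norm a) * (1 - r\<^sup>2) / (1 - norm a)\<^sup>2 = K * (1 - r\<^sup>2)"
      using a unfolding K_def by (simp add: power2_eq_square)
    finally show ?thesis by linarith
  qed
  have main: "hardy_class f \<and> H2_norm f \<le> B / q" if q: "0 < q" "q < 1" for q
  proof -
    have q2: "0 < 1 - q\<^sup>2" "0 < q\<^sup>2" using q by (auto simp: abs_square_less_1)
  (* for \<open>r > r0\<close> the bound \<open>lower\<close> gives \<open>|b| \<ge> q\<close> on the circle of radius \<open>r\<close> *)
    define r0 where "r0 = sqrt (max 0 (1 - (1 - q\<^sup>2) / K))"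
    have r0: "r0 < 1" "0 \<le> r0" unfolding r0_def using q2 K by auto
    have r0sq: "1 - (1 - q\<^sup>2) / K \<le> r0\<^sup>2" unfolding r0_def by simp
    have ms: "mean_square f r \<le> (B / q)\<^sup>2" if r: "r0 < r" "0 < r" "r < 1" for r
    proof -
      have "r0\<^sup>2 \<le> r\<^sup>2" using r r0 by (intro power_mono) auto
      hence "1 - r\<^sup>2 \<le> (1 - q\<^sup>2) / K" using r0sq by linarith
      hence "K * (1 - r\<^sup>2) \<le> 1 - q\<^sup>2" using K by (simp add: pos_le_divide_eq mult.commute)
      hence qb: "q\<^sup>2 \<le> (norm (blaschke a (of_real r * cis t)))\<^sup>2" for t
        using lower[OF r(2,3), of t] by linarith
      have qb': "q \<le> norm (blaschke a (of_real r * cis t))" for t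
        using qb[of t] q by (simp add: power2_le_iff_abs_le)
      have "q\<^sup>2 * mean_square f r = mean_square (\<lambda>z. of_real q * f z) r"
        using q by (simp add: mean_square_def norm_mult power_mult_distrib)
      also have "\<dots> \<le> mean_square (\<lambda>z. blaschke a z * f z) r"
      proof (rule mean_square_mono_integrand)
        show "(\<lambda>z. of_real q * f z) holomorphic_on ball 0 1" using f by (intro holomorphic_intros)
        show "(\<lambda>z. blaschke a z * f z) holomorphic_on ball 0 1" by (rule hardy_class_holo[OF bf])
      qed (use r qb' q in \<open>auto intro!: mult_right_mono simp: norm_mult\<close>)
      also have "\<dots> \<le> B\<^sup>2" unfolding B_def using mean_square_le_norm[OF bf, of r] r by simp
      finally show ?thesis using q2 by (simp add: power_divide pos_le_divide_eq mult.commute)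
    qed
    show ?thesis using hardy_classI_near[OF f _ r0(1) ms] B0 q by auto
  qed
  show "hardy_class f" using main[of "1/2"] by simp
  show "H2_norm f \<le> H2_norm (\<lambda>z. blaschke a z * f z)"
    unfolding B_def[symmetric]
  proof (rule field_le_mult_one_interval)
    fix q :: real assume "0 < q" "q < 1"
    with main[of q] show "q * H2_norm f \<le> B" by (simp add: pos_le_divide_eq mult.commute)
  qed
qed

lemma hardy_blaschke_divide:
  assumes a: "norm a < 1" and f: "hardy_class f" and fa: "f a = 0"
  obtains g where "hardy_class g" "H2_norm g \<le> H2_norm f"
    "\<And>z. norm z < 1 \<Longrightarrow> f z = blaschke a z * g z"
proof -
  have fh: "f holomorphic_on ball 0 1" using f by (rule hardy_class_holo)
  define h where "h = (\<lambda>z. if z = a then deriv f a else f z / (z - a))"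
  have h: "h holomorphic_on ball 0 1"
    by (rule pole_theorem_open_0[OF fh, of a]) (auto simp: h_def fa)
  define g where "g = (\<lambda>z. (1 - cnj a * z) * h z)"
  have g: "g holomorphic_on ball 0 1" unfolding g_def using h by (auto intro!: holomorphic_intros)
  have eq: "f z = blaschke a z * g z" if "norm z < 1" for z
    using that blaschke_denom_nonzero[OF a, of z] fa by (auto simp: g_def h_def blaschke_def)
  have c: "hardy_class f \<longleftrightarrow> hardy_class (\<lambda>z. blaschke a z * g z)"
    "H2_norm f = H2_norm (\<lambda>z. blaschke a z * g z)"
    using eq by (auto intro!: hardy_class_cong H2_norm_cong)
  show ?thesis
    using hardy_blaschke_cancel[OF a g] f c eq by (intro that[of g]) auto
qed

section \<open>Approximating boundary data by real parts of polynomials\<close>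

text \<open>
  On the unit circle \<open>cnj z = 1 / z\<close>, and a monomial and its conjugate have the same real part. Thus
  the real parts of polynomials are closed under multiplication on the circle, as the
  Stone-Weierstrass theorem requires.
\<close>

lemma Re_poly_mult_cnj_poly:
  fixes p q :: "complex poly"
  shows "\<exists>r. \<forall>z. norm z = 1 \<longrightarrow> Re (poly p z * cnj (poly q z)) = Re (poly r z)"
proof (induction p arbitrary: q)
  case 0
  show ?case by (rule exI[of _ 0]) simp
next
  case (pCons c p)
  obtain d s where q: "q = pCons d s" by (rule pCons_cases)
  obtain r where r: "\<And>z. norm z = 1 \<Longrightarrow> Re (poly p z * cnj (poly s z)) = Re (poly r z)"
    using pCons.IH[of s] by blast
  show ?case
  proof (intro exI allI impI)
    fix z :: complex assume z: "norm z = 1"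
    have zz: "z * cnj z = 1" using z complex_norm_square[of z] by simp
    have "poly (pCons c p) z * cnj (poly q z)
        = c * cnj d + c * cnj (z * poly s z) + cnj d * (z * poly p z)
          + (z * cnj z) * (poly p z * cnj (poly s z))"
      by (simp add: q algebra_simps)
    moreover have "Re (c * cnj (z * poly s z)) = Re (cnj c * (z * poly s z))"
      by (simp add: algebra_simps)
    moreover have "poly ([:c * cnj d:] + smult (cnj c) (pCons 0 s) + smult (cnj d) (pCons 0 p) + r) z
        = c * cnj d + cnj c * (z * poly s z) + cnj d * (z * poly p z) + poly r z"
      by (simp add: algebra_simps)
    ultimately show "Re (poly (pCons c p) z * cnj (poly q z))
        = Re (poly ([:c * cnj d:] + smult (cnj c) (pCons 0 s) + smult (cnj d) (pCons 0 p) + r) z)"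
      by (simp only: plus_complex.sel zz mult_1 r[OF z])
  qed
qed

lemma Re_poly_dense:
  fixes w :: "complex \<Rightarrow> real"
  assumes "continuous_on (sphere 0 1) w" "0 < e"
  obtains p :: "complex poly" where "\<And>z. norm z = 1 \<Longrightarrow> \<bar>w z - Re (poly p z)\<bar> < e"
proof -
  let ?P = "\<lambda>f. \<exists>p :: complex poly. \<forall>z. norm z = 1 \<longrightarrow> f z = Re (poly p z)"
  have "\<exists>g. ?P g \<and> (\<forall>x\<in>sphere 0 1. \<bar>w x - g x\<bar> < e)"
  proof (rule Stone_Weierstrass_HOL)
    show "?P (\<lambda>x. c)" for c
      by (rule exI[of _ "[:of_real c:]"]) simp
    show "continuous_on (sphere 0 1) f" if "?P f" for f
    proof -
      from that obtain p :: "complex poly" where p: "\<And>z. norm z = 1 \<Longrightarrow> f z = Re (poly p z)" by blast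
      have "continuous_on (sphere 0 1) (\<lambda>z. Re (poly p z))" by (intro continuous_intros)
      thus ?thesis by (rule continuous_on_eq) (simp add: p)
    qed
    show "?P (\<lambda>x. f x + g x)" if fg: "?P f \<and> ?P g" for f g
    proof -
      obtain p q :: "complex poly" where "\<And>z. norm z = 1 \<Longrightarrow> f z = Re (poly p z)"
        "\<And>z. norm z = 1 \<Longrightarrow> g z = Re (poly q z)" using fg by blast
      thus ?thesis by (intro exI[of _ "p + q"]) simp
    qed
    show "?P (\<lambda>x. f x * g x)" if fg: "?P f \<and> ?P g" for f g
    proof -
      obtain p q :: "complex poly" where p: "\<And>z. norm z = 1 \<Longrightarrow> f z = Re (poly p z)"
        and q: "\<And>z. norm z = 1 \<Longrightarrow> g z = Re (poly q z)" using fg by blast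
      obtain r where r: "\<And>z. norm z = 1 \<Longrightarrow> Re (poly p z * cnj (poly q z)) = Re (poly r z)"
        using Re_poly_mult_cnj_poly[of p q] by blast
      have "f z * g z = Re (poly (smult (1/2) (p * q + r)) z)" if "norm z = 1" for z
        using p[OF that] q[OF that] r[OF that] by (simp add: field_simps)
      thus ?thesis by blast
    qed
    show "\<exists>f. ?P f \<and> f x \<noteq> f y" if xy: "x \<in> sphere 0 1 \<and> y \<in> sphere 0 1 \<and> x \<noteq> y" for x y :: complex
    proof (cases "Re x = Re y")
      case True
      hence "Im x \<noteq> Im y" using xy by (auto simp: complex_eq_iff)
      thus ?thesis by (intro exI[of _ Im] conjI exI[of _ "[:0, - \<i>:]"]) auto
    next
      case False
      thus ?thesis by (intro exI[of _ Re] conjI exI[of _ "[:0, 1:]"]) auto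
    qed
  qed (use assms in auto)
  then obtain g and p :: "complex poly" where "\<forall>z. norm z = 1 \<longrightarrow> g z = Re (poly p z)"
    "\<forall>x\<in>sphere 0 1. \<bar>w x - g x\<bar> < e"
    by blast
  thus ?thesis by (intro that[of p]) force
qed

lemma Re_poly_majorant:
  fixes w :: "complex \<Rightarrow> real"
  assumes "continuous_on (sphere 0 1) w" "0 < \<delta>"
  obtains Q :: "complex poly" where
    "\<And>z. norm z = 1 \<Longrightarrow> w z \<le> Re (poly Q z)" "\<And>z. norm z = 1 \<Longrightarrow> Re (poly Q z) \<le> w z + \<delta>"
proof -
  have "continuous_on (sphere 0 1) (\<lambda>z. w z + \<delta> / 2)" using assms by (intro continuous_intros)
  from Re_poly_dense[OF this, of "\<delta> / 2"] assms obtain p :: "complex poly"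
    where p: "\<And>z. norm z = 1 \<Longrightarrow> \<bar>w z + \<delta> / 2 - Re (poly p z)\<bar> < \<delta> / 2" by auto
  have "w z \<le> Re (poly p z) \<and> Re (poly p z) \<le> w z + \<delta>" if "norm z = 1" for z
    using p[OF that] by (simp add: abs_less_iff field_simps)
  thus ?thesis by (intro that[of p]) auto
qed

lemma mean_Re_poly:
  fixes Q :: "complex poly"
  shows "((\<lambda>t. Re (poly Q (cis t))) has_integral 2 * pi * Re (poly Q 0)) {0..2*pi}"
proof -
  have "((\<lambda>t. poisson_kernel 0 t *\<^sub>R poly Q (cis t)) has_integral (2*pi) *\<^sub>R poly Q 0) {0..2*pi}"
    by (rule Poisson_formula) (auto intro!: continuous_intros holomorphic_intros)
  from has_integral_linear[OF this bounded_linear_Re] show ?thesis by (simp add: o_def)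
qed

lemma integral_poisson_kernel:
  assumes "norm w < 1"
  shows "((\<lambda>t. poisson_kernel w t) has_integral 2 * pi) {0..2*pi}"
proof -
  have "((\<lambda>t. poisson_kernel w t *\<^sub>R (1::complex)) has_integral (2*pi) *\<^sub>R 1) {0..2*pi}"
    by (rule Poisson_formula) (use assms in auto)
  from has_integral_linear[OF this bounded_linear_Re] show ?thesis by (simp add: o_def)
qed

section \<open>Boundary values and the outer part\<close>

definition radii :: "nat \<Rightarrow> real" where "radii n = 1 - 1 / real (n + 2)"

lemma radii: "0 < radii n" "radii n < 1"
  unfolding radii_def by (auto simp: field_simps)

lemma radii_tendsto: "radii \<longlonglongrightarrow> 1"
  unfolding radii_def by real_asymp

lemma radii_at_left: "filterlim radii (at_left 1) sequentially"
  unfolding filterlim_at using radii_tendsto radii(2)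
  by (auto intro!: always_eventually simp: less_imp_neq)

text \<open>
  A maximum principle. \<open>|g (r z)|\<close> is at most a Poisson average of \<open>|g|\<close> over the circle of
  radius \<open>r\<close>, and \<open>x \<le> 1 + max 0 (min x K - 1) + x\<^sup>2 / K\<close> for \<open>x \<ge> 0\<close> and \<open>K \<ge> 1\<close>. The middle term is bounded and tends
  to zero almost everywhere as \<open>r\<close> tends to one, and the last one contributes at most a constant times
  \<open>1 / K\<close> because \<open>g\<close> has finite norm. For holomorphic functions without such a bound the conclusion
  fails: the inverse of a singular inner function has boundary values of modulus one.
\<close>

lemma bounded_of_radial_limits:
  assumes g: "hardy_class g" and N: "negligible N"
    and lim: "\<And>t. t \<in> {0..2*pi} - N \<Longrightarrow>
        \<exists>l. ((\<lambda>r. g (of_real r * cis t)) \<longlongrightarrow> l) (at_left 1) \<and> norm l \<le> 1"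
    and z: "norm z < 1"
  shows "norm (g z) \<le> 1"
proof -
  have gh: "g holomorphic_on ball 0 1" using g by (rule hardy_class_holo)
  define k where "k = (1 + norm z) / (1 - norm z)"
  have k0: "0 \<le> k" unfolding k_def using z by auto
  define B where "B = (H2_norm g)\<^sup>2"
  have main: "norm (g z) \<le> 1 + k * B / K" if K: "K \<ge> 1" for K :: real
  proof -
    define h where "h = (\<lambda>n t. max 0 (min (norm (g (of_real (radii n) * cis t))) K - 1))"
    have cg: "continuous_on {0..2*pi} (\<lambda>t. g (of_real (radii n) * cis t))" for n
      by (rule continuous_on_circle[OF gh]) (use radii[of n] in auto)
    have hi: "h n integrable_on {0..2*pi}" for n
      unfolding h_def by (intro integrable_continuous_interval continuous_intros cg)
    define h' where "h' = (\<lambda>n t. if t \<in> N then 0 else h n t)"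
    have eqi: "integral {0..2*pi} (h n) = integral {0..2*pi} (h' n)" for n
      by (rule integral_spike[OF N]) (auto simp: h'_def)
    have h'i: "h' n integrable_on {0..2*pi}" for n
      by (rule integrable_spike[OF hi[of n] N]) (auto simp: h'_def)
    have "(\<lambda>n. integral {0..2*pi} (h' n)) \<longlonglongrightarrow> integral {0..2*pi} (\<lambda>t. 0)"
    proof (rule dominated_convergence(2)[OF h'i])
      show "(\<lambda>t. K) integrable_on {0..2*pi}" by auto
      show "norm (h' n t) \<le> K" for n t using K by (auto simp: h'_def h_def)
      fix t assume t: "t \<in> {0..2*pi}"
      show "(\<lambda>n. h' n t) \<longlonglongrightarrow> 0"
      proof (cases "t \<in> N")
        case False
        with lim t obtain l where l: "((\<lambda>r. g (of_real r * cis t)) \<longlongrightarrow> l) (at_left 1)" "norm l \<le> 1" by blast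
        from filterlim_compose[OF l(1) radii_at_left]
        have "(\<lambda>n. g (of_real (radii n) * cis t)) \<longlonglongrightarrow> l" .
        hence "(\<lambda>n. h n t) \<longlonglongrightarrow> max 0 (min (norm l) K - 1)"
          unfolding h_def by (intro tendsto_intros)
        thus ?thesis using l(2) False by (simp add: h'_def)
      qed (auto simp: h'_def)
    qed
    hence h0: "(\<lambda>n. integral {0..2*pi} (h n)) \<longlonglongrightarrow> 0" by (simp add: eqi)
    have ineq: "2 * pi * norm (g (of_real (radii n) * z)) \<le> 2 * pi + k * integral {0..2*pi} (h n) + (k / K) * (2 * pi * B)" for n
    proof -
      let ?x = "\<lambda>t. norm (g (of_real (radii n) * cis t))"
      have "2 * pi * norm (g (of_real (radii n) * z)) \<le> integral {0..2*pi} (\<lambda>t. poisson_kernel z t * ?x t)"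
      proof (rule poisson_bound[OF _ _ z, where g = "\<lambda>z. g (of_real (radii n) * z)"])
        show "continuous_on (cball 0 1) (\<lambda>z. g (of_real (radii n) * z))"
          "(\<lambda>z. g (of_real (radii n) * z)) holomorphic_on ball 0 1"
          using dilation_regular[OF gh, of "radii n"] radii[of n] by auto
      qed
      also have "\<dots> \<le> integral {0..2*pi} (\<lambda>t. poisson_kernel z t + (k * h n t + (k / K) * (?x t)\<^sup>2))"
      proof (rule integral_le)
        show "(\<lambda>t. poisson_kernel z t * ?x t) integrable_on {0..2*pi}"
          by (intro integrable_continuous_interval continuous_intros continuous_poisson_kernel cg) (use z in auto)
        show "(\<lambda>t. poisson_kernel z t + (k * h n t + (k / K) * (?x t)\<^sup>2)) integrable_on {0..2*pi}"
          unfolding h_def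
          by (intro integrable_continuous_interval continuous_intros continuous_poisson_kernel cg) (use z in auto)
        fix t
        have "?x t \<le> 1 + (h n t + (?x t)\<^sup>2 / K)"
        proof (cases "?x t \<le> K")
          case True
          moreover have "0 \<le> (?x t)\<^sup>2 / K" using K by simp
          ultimately show ?thesis by (simp add: h_def)
        next
          case False
          hence "K * ?x t \<le> (?x t)\<^sup>2" by (simp add: power2_eq_square mult_right_mono)
          hence "?x t \<le> (?x t)\<^sup>2 / K" using K by (simp add: pos_le_divide_eq mult.commute)
          moreover have "0 \<le> h n t" by (simp add: h_def)
          ultimately show ?thesis by linarith
        qed
        hence "poisson_kernel z t * ?x t \<le> poisson_kernel z t * (1 + (h n t + (?x t)\<^sup>2 / K))"
          using poisson_kernel_nonneg[OF z] by (rule mult_left_mono)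
        also have "\<dots> = poisson_kernel z t + poisson_kernel z t * (h n t + (?x t)\<^sup>2 / K)"
          by (simp add: algebra_simps)
        also have "\<dots> \<le> poisson_kernel z t + k * (h n t + (?x t)\<^sup>2 / K)"
          unfolding k_def using K
          by (intro add_left_mono mult_right_mono poisson_kernel_le z) (auto simp: h_def intro!: add_nonneg_nonneg)
        finally show "poisson_kernel z t * ?x t \<le> poisson_kernel z t + (k * h n t + (k / K) * (?x t)\<^sup>2)"
          by (simp add: algebra_simps)
      qed
      also have "\<dots> = integral {0..2*pi} (poisson_kernel z) + (k * integral {0..2*pi} (h n)
          + (k / K) * integral {0..2*pi} (\<lambda>t. (?x t)\<^sup>2))"
      proof -
        have i: "poisson_kernel z integrable_on {0..2*pi}" "(\<lambda>t. (?x t)\<^sup>2) integrable_on {0..2*pi}"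
          using integral_poisson_kernel[OF z]
          by blast (intro integrable_continuous_interval continuous_intros cg)
        note j = integrable_on_mult_right[OF hi[of n], of k] integrable_on_mult_right[OF i(2), of "k / K"]
        show ?thesis
          by (simp only: Henstock_Kurzweil_Integration.integral_add[OF i(1) integrable_add[OF j]]
              Henstock_Kurzweil_Integration.integral_add[OF j] Henstock_Kurzweil_Integration.integral_mult_right)
      qed
      also have "integral {0..2*pi} (poisson_kernel z) = 2 * pi"
        using integral_poisson_kernel[OF z] by blast
      also have "integral {0..2*pi} (\<lambda>t. (?x t)\<^sup>2) = 2 * pi * mean_square g (radii n)"
        by (simp add: mean_square_def)
      also have "2 * pi + (k * integral {0..2*pi} (h n) + (k / K) * (2 * pi * mean_square g (radii n)))
        \<le> 2 * pi + (k * integral {0..2*pi} (h n) + (k / K) * (2 * pi * B))"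
        unfolding B_def using mean_square_le_norm[OF g, of "radii n"] radii[of n] K k0
        by (intro add_left_mono mult_left_mono) auto
      finally show ?thesis by simp
    qed
    have "(\<lambda>n. of_real (radii n) * z) \<longlonglongrightarrow> of_real 1 * z"
      by (intro tendsto_intros radii_tendsto)
    moreover have "isCont g z"
      using holomorphic_on_imp_continuous_on[OF gh] z by (auto simp: continuous_on_eq_continuous_at)
    ultimately have gz: "(\<lambda>n. g (of_real (radii n) * z)) \<longlonglongrightarrow> g z"
      by (auto intro: isCont_tendsto_compose)
    have "(\<lambda>n. 2 * pi * norm (g (of_real (radii n) * z))) \<longlonglongrightarrow> 2 * pi * norm (g z)"
      by (intro tendsto_intros gz)
    moreover have "(\<lambda>n. 2 * pi + k * integral {0..2*pi} (h n) + (k / K) * (2 * pi * B))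
        \<longlonglongrightarrow> 2 * pi + k * 0 + (k / K) * (2 * pi * B)"
      by (intro tendsto_intros h0)
    ultimately have "2 * pi * norm (g z) \<le> 2 * pi + k * 0 + (k / K) * (2 * pi * B)"
      by (rule LIMSEQ_le) (use ineq in blast)
    also have "\<dots> = 2 * pi * (1 + k * B / K)" by (simp add: algebra_simps)
    finally show ?thesis by simp
  qed
  have "((\<lambda>K. 1 + k * B / K) \<longlongrightarrow> 1 + 0) at_top"
    by (intro tendsto_add tendsto_const real_tendsto_divide_at_top[of _ "k * B"] filterlim_ident)
  moreover have "\<forall>\<^sub>F K in at_top. norm (g z) \<le> 1 + k * B / K"
    using eventually_ge_at_top[of 1] by eventually_elim (rule main)
  ultimately show ?thesis
    by (intro tendsto_le[OF trivial_limit_at_top_linorder _ tendsto_const, of "\<lambda>K. 1 + k * B / K" 1]) auto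
qed

lemma AE_interval_negligible:
  assumes "AE t in lebesgue_on {0..2*pi}. P t"
  obtains N where "negligible N" "\<And>t. t \<in> {0..2*pi} - N \<Longrightarrow> P t"
proof -
  have "AE t in lebesgue. t \<in> {0..2*pi} \<longrightarrow> P t"
    using assms by (subst (asm) AE_restrict_space_iff) auto
  then obtain N where N: "{t \<in> space lebesgue. \<not> (t \<in> {0..2*pi} \<longrightarrow> P t)} \<subseteq> N" "N \<in> null_sets lebesgue"
    by (auto elim!: AE_E simp: null_sets_def)
  show ?thesis
    by (rule that[of N]) (use N in \<open>auto simp: negligible_iff_null_sets\<close>)
qed

lemma disk_algebra_bounded:
  assumes "\<psi> \<in> disk_algebra"
  obtains M where "0 \<le> M" "\<And>z. norm z \<le> 1 \<Longrightarrow> norm (\<psi> z) \<le> M"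
proof -
  have "continuous_on (cball 0 1) (\<lambda>z. norm (\<psi> z))"
    using assms by (auto simp: disk_algebra_def intro!: continuous_intros)
  from continuous_attains_sup[OF compact_cball _ this]
  obtain x where "\<And>y. y \<in> cball 0 1 \<Longrightarrow> norm (\<psi> y) \<le> norm (\<psi> x)" by force
  thus ?thesis by (intro that[of "norm (\<psi> x)"]) auto
qed

lemma continuous_on_cis: "continuous_on (cball 0 1) f \<Longrightarrow> continuous_on S (\<lambda>t. f (cis t))"
  by (rule continuous_on_compose2) (auto intro!: continuous_intros)

lemma continuous_on_ln_norm_plus:
  assumes "continuous_on S f" "0 < \<epsilon>"
  shows "continuous_on S (\<lambda>z. ln (norm (f z) + \<epsilon>))"
proof -
  have "norm (f z) + \<epsilon> \<noteq> 0" for z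
    using add_nonneg_pos[OF norm_ge_zero[of "f z"] assms(2)] by simp
  thus ?thesis by (intro continuous_intros assms) auto
qed

lemma norm_exp_minus_mult: "norm (exp (- q) * w) = norm (w::complex) / exp (Re q)"
  unfolding norm_mult norm_exp_eq_Re by (simp add: exp_minus divide_inverse mult.commute)

lemma radial_limit_closed_disk:
  assumes "continuous_on (cball 0 1) f"
  shows "((\<lambda>r. f (of_real r * cis t)) \<longlongrightarrow> f (cis t)) (at_left 1)"
proof -
  have "continuous_on {0..1} (\<lambda>r. f (of_real r * cis t))"
    by (rule continuous_on_compose2[OF assms]) (auto intro!: continuous_intros simp: norm_mult)
  hence "((\<lambda>r. f (of_real r * cis t)) \<longlongrightarrow> f (of_real 1 * cis t)) (at 1 within {0..1})"
    unfolding continuous_on_def by (drule_tac bspec[of _ _ 1]) auto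
  moreover have "at 1 within {0..1} = at_left (1::real)"
    by (rule at_within_nhd[of _ "{0<..<2}"]) auto
  ultimately show ?thesis by simp
qed

lemma exp_poly_bounded:
  fixes Q :: "complex poly"
  obtains C where "\<And>z. norm z < 1 \<Longrightarrow> norm (exp (- poly Q z)) \<le> C"
proof -
  have "(\<lambda>z. exp (- poly Q z)) \<in> disk_algebra"
    unfolding disk_algebra_def by (auto intro!: continuous_intros holomorphic_intros)
  from disk_algebra_bounded[OF this] show ?thesis using that by (metis less_imp_le)
qed

context
  fixes \<psi> v :: "complex \<Rightarrow> complex"
  assumes \<psi>: "\<psi> \<in> disk_algebra" and v: "is_outer_part v \<psi>"
begin

lemma outer_part_hardy: "hardy_class v" "v 0 \<noteq> 0"
  using v by (auto simp: is_outer_part_def outer_function_def)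

lemma symbol_continuous: "continuous_on (cball 0 1) \<psi>"
  using \<psi> by (auto simp: disk_algebra_def)

text \<open>
  The inner factor has modulus one on the boundary and \<open>\<psi>\<close> is continuous there, so the quotient
  \<open>v\<close> has radial limits of modulus \<open>|\<psi>|\<close>.
\<close>

lemma outer_part_boundary:
  obtains N where "negligible N" "\<And>t. t \<in> {0..2*pi} - N \<Longrightarrow>
     \<exists>l. ((\<lambda>r. v (of_real r * cis t)) \<longlongrightarrow> l) (at_left 1) \<and> norm l = norm (\<psi> (cis t))"
proof -
  obtain \<tau> where \<tau>: "inner_function \<tau>" and eq: "\<And>z. z \<in> ball 0 1 \<Longrightarrow> \<psi> z = \<tau> z * v z"
    using v by (auto simp: is_outer_part_def)
  have ae: "AE t in lebesgue_on {0..2*pi}.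
      \<exists>l. ((\<lambda>r. \<tau> (of_real r * cis t)) \<longlongrightarrow> l) (at_left 1) \<and> norm l = 1"
    using \<tau> by (simp add: inner_function_def)
  obtain N where N: "negligible N" and lim: "\<And>t. t \<in> {0..2*pi} - N \<Longrightarrow>
      \<exists>l. ((\<lambda>r. \<tau> (of_real r * cis t)) \<longlongrightarrow> l) (at_left 1) \<and> norm l = 1"
    by (rule AE_interval_negligible[OF ae]) blast
  have "\<exists>l. ((\<lambda>r. v (of_real r * cis t)) \<longlongrightarrow> l) (at_left 1) \<and> norm l = norm (\<psi> (cis t))"
    if t: "t \<in> {0..2*pi} - N" for t
  proof -
    obtain l where l: "((\<lambda>r. \<tau> (of_real r * cis t)) \<longlongrightarrow> l) (at_left 1)" "norm l = 1"
      using lim[OF t] by blast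
    have l0: "l \<noteq> 0" using l(2) by auto
    have "((\<lambda>r. \<psi> (of_real r * cis t) / \<tau> (of_real r * cis t)) \<longlongrightarrow> \<psi> (cis t) / l) (at_left 1)"
      by (intro tendsto_divide radial_limit_closed_disk symbol_continuous l l0)
    moreover have "\<forall>\<^sub>F r in at_left 1. \<psi> (of_real r * cis t) / \<tau> (of_real r * cis t) = v (of_real r * cis t)"
    proof -
      have "\<forall>\<^sub>F r in at_left 1. \<tau> (of_real r * cis t) \<noteq> 0"
        using tendsto_imp_eventually_ne[OF l(1) l0] .
      moreover have "\<forall>\<^sub>F r in at_left (1::real). r \<in> {0<..<1}"
        by (rule eventually_at_leftI[of 0]) auto
      ultimately show ?thesis
        by eventually_elim (use eq circle_in_ball in auto)
    qed
    ultimately have "((\<lambda>r. v (of_real r * cis t)) \<longlongrightarrow> \<psi> (cis t) / l) (at_left 1)"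
      by (rule Lim_transform_eventually)
    thus ?thesis using l(2) by (intro exI[of _ "\<psi> (cis t) / l"]) (simp add: norm_divide)
  qed
  thus ?thesis using N that by blast
qed

lemma outer_part_div_exp_le_1:
  fixes Q :: "complex poly"
  assumes Q: "\<And>z. norm z = 1 \<Longrightarrow> norm (\<psi> z) \<le> exp (Re (poly Q z))"
  shows "hardy_class (\<lambda>z. exp (- poly Q z) * v z)"
    and "norm z < 1 \<Longrightarrow> norm (exp (- poly Q z) * v z) \<le> 1"
proof -
  obtain C where C: "\<And>z. norm z < 1 \<Longrightarrow> norm (exp (- poly Q z)) \<le> C" by (rule exp_poly_bounded[of Q]) blast
  show g: "hardy_class (\<lambda>z. exp (- poly Q z) * v z)"
    by (rule hardy_bounded_mult(1)[OF outer_part_hardy(1) _ C]) (auto intro!: holomorphic_intros)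
  obtain N where N: "negligible N" and lim: "\<And>t. t \<in> {0..2*pi} - N \<Longrightarrow>
     \<exists>l. ((\<lambda>r. v (of_real r * cis t)) \<longlongrightarrow> l) (at_left 1) \<and> norm l = norm (\<psi> (cis t))"
    by (rule outer_part_boundary) blast
  show "norm (exp (- poly Q z) * v z) \<le> 1" if z: "norm z < 1"
  proof (rule bounded_of_radial_limits[OF g N _ z])
    fix t assume "t \<in> {0..2*pi} - N"
    then obtain l where l: "((\<lambda>r. v (of_real r * cis t)) \<longlongrightarrow> l) (at_left 1)" "norm l = norm (\<psi> (cis t))"
      using lim by blast
    have "((\<lambda>r. exp (- poly Q (of_real r * cis t)) * v (of_real r * cis t)) \<longlongrightarrow> exp (- poly Q (cis t)) * l) (at_left 1)"
      by (intro tendsto_mult l radial_limit_closed_disk continuous_intros)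
    moreover have "norm (exp (- poly Q (cis t)) * l) \<le> 1"
      using Q[of "cis t"] by (simp only: norm_exp_minus_mult l(2)) (simp add: divide_simps)
    ultimately show "\<exists>l. ((\<lambda>r. exp (- poly Q (of_real r * cis t)) * v (of_real r * cis t)) \<longlongrightarrow> l) (at_left 1)
        \<and> norm l \<le> 1" by blast
  qed
qed

lemma outer_part_le_exp:
  fixes Q :: "complex poly"
  assumes Q: "\<And>z. norm z = 1 \<Longrightarrow> norm (\<psi> z) \<le> exp (Re (poly Q z))" and z: "norm z < 1"
  shows "norm (v z) \<le> exp (Re (poly Q z))"
  using outer_part_div_exp_le_1(2)[OF Q z] by (simp only: norm_exp_minus_mult) (simp add: divide_simps)

text \<open>
  With \<open>\<epsilon>\<close> the logarithm is continuous on the circle even where \<open>\<psi>\<close> vanishes, and it can be approximated by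
  real parts of polynomials. The first bound is Jensen's inequality for \<open>v\<close>; it is obtained
  from the maximum principle, which is insensitive to zeros of \<open>v\<close>.
\<close>

lemma regularized_log_mean:
  assumes \<epsilon>: "0 < \<epsilon>"
  shows "2 * pi * ln (norm (v 0)) \<le> integral {0..2*pi} (\<lambda>t. ln (norm (\<psi> (cis t)) + \<epsilon>))"
    and "0 < \<delta> \<Longrightarrow> \<exists>Q :: complex poly. (\<forall>z. norm z = 1 \<longrightarrow> norm (\<psi> z) \<le> exp (Re (poly Q z))) \<and>
        2 * pi * Re (poly Q 0) \<le> integral {0..2*pi} (\<lambda>t. ln (norm (\<psi> (cis t)) + \<epsilon>)) + 2 * pi * \<delta>"
proof -
  let ?I = "integral {0..2*pi} (\<lambda>t. ln (norm (\<psi> (cis t)) + \<epsilon>))"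
  have pos: "norm (\<psi> z) + \<epsilon> > 0" for z by (rule add_nonneg_pos[OF norm_ge_zero \<epsilon>])
  have c: "continuous_on (cball 0 1) (\<lambda>z. ln (norm (\<psi> z) + \<epsilon>))"
    by (rule continuous_on_ln_norm_plus[OF symbol_continuous]) (rule \<epsilon>)
  have ex: "\<exists>Q :: complex poly. (\<forall>z. norm z = 1 \<longrightarrow> norm (\<psi> z) \<le> exp (Re (poly Q z))) \<and>
        2 * pi * Re (poly Q 0) \<le> ?I + 2 * pi * \<delta>" if \<delta>: "0 < \<delta>" for \<delta>
  proof -
    obtain Q :: "complex poly" where Q1: "\<And>z. norm z = 1 \<Longrightarrow> ln (norm (\<psi> z) + \<epsilon>) \<le> Re (poly Q z)"
      and Q2: "\<And>z. norm z = 1 \<Longrightarrow> Re (poly Q z) \<le> ln (norm (\<psi> z) + \<epsilon>) + \<delta>"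
      by (rule Re_poly_majorant[OF continuous_on_subset[OF c] \<delta>]) auto
    have "norm (\<psi> z) \<le> exp (Re (poly Q z))" if "norm z = 1" for z
    proof -
      have "norm (\<psi> z) \<le> exp (ln (norm (\<psi> z) + \<epsilon>))" using pos[of z] \<epsilon> by simp
      thus ?thesis using Q1[OF that] by (meson exp_le_cancel_iff order_trans)
    qed
    moreover have "2 * pi * Re (poly Q 0) \<le> ?I + 2 * pi * \<delta>"
    proof -
      have i: "(\<lambda>t. ln (norm (\<psi> (cis t)) + \<epsilon>)) integrable_on {0..2*pi}"
        by (intro integrable_continuous_interval continuous_on_cis[OF c])
      have "((\<lambda>t. ln (norm (\<psi> (cis t)) + \<epsilon>) + \<delta>) has_integral ?I + measure lborel {0..2*pi} *\<^sub>R \<delta>) {0..2*pi}"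
        by (rule has_integral_add[OF integrable_integral[OF i] has_integral_const_real])
      from has_integral_le[OF mean_Re_poly this] Q2 show ?thesis by simp
    qed
    ultimately show ?thesis by blast
  qed
  show "0 < \<delta> \<Longrightarrow> \<exists>Q :: complex poly. (\<forall>z. norm z = 1 \<longrightarrow> norm (\<psi> z) \<le> exp (Re (poly Q z))) \<and>
        2 * pi * Re (poly Q 0) \<le> ?I + 2 * pi * \<delta>" by (rule ex)
  show "2 * pi * ln (norm (v 0)) \<le> ?I"
  proof (rule field_le_epsilon)
    fix e :: real assume e: "e > 0"
    obtain Q :: "complex poly" where Q: "\<And>z. norm z = 1 \<Longrightarrow> norm (\<psi> z) \<le> exp (Re (poly Q z))"
      and Q0: "2 * pi * Re (poly Q 0) \<le> ?I + 2 * pi * (e / (2*pi))"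
      using ex[of "e / (2*pi)"] e by auto
    have "norm (v 0) \<le> exp (Re (poly Q 0))" using outer_part_le_exp[OF Q, of 0] by simp
    hence "ln (norm (v 0)) \<le> ln (exp (Re (poly Q 0)))"
      using outer_part_hardy(2) by (subst ln_le_cancel_iff) auto
    hence "ln (norm (v 0)) \<le> Re (poly Q 0)" by simp
    hence "2 * pi * ln (norm (v 0)) \<le> 2 * pi * Re (poly Q 0)" by simp
    moreover have "2 * pi * Re (poly Q 0) \<le> ?I + e" using Q0 by simp
    ultimately show "2 * pi * ln (norm (v 0)) \<le> ?I + e" by linarith
  qed
qed

text \<open>
  On the zero set \<open>ln (|\<psi>| + \<epsilon>)\<close> equals \<open>ln \<epsilon>\<close>. If that set had positive measure, the means in
  \<open>regularized_log_mean\<close> would tend to minus infinity with \<open>\<epsilon>\<close>, although they are bounded below.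
  Consequently the convention \<open>ln 0 = 0\<close> does not affect the integral in \<open>outer_function\<close>.
\<close>

lemma symbol_zeros_negligible: "negligible {t \<in> {0..2*pi}. \<psi> (cis t) = 0}"
proof -
  define Z where "Z = {t \<in> {0..2*pi}. \<psi> (cis t) = 0}"
  have "closed ({0..2*pi} \<inter> (\<lambda>t. \<psi> (cis t)) -` {0})"
    by (rule continuous_closed_preimage[OF continuous_on_cis[OF symbol_continuous]]) auto
  moreover have ZZ: "{0..2*pi} \<inter> (\<lambda>t. \<psi> (cis t)) -` {0} = Z" "{0..2*pi} \<inter> Z = Z"
    by (auto simp: Z_def)
  ultimately have "compact Z"
    using compact_Int_closed[of "{0..2*pi}" Z] by simp
  hence Zm: "Z \<in> lmeasurable" by (rule lmeasurable_compact)
  obtain M where M: "0 \<le> M" "\<And>z. norm z \<le> 1 \<Longrightarrow> norm (\<psi> z) \<le> M"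
    using disk_algebra_bounded[OF \<psi>] by blast
  define m where "m = measure lebesgue Z"
  have m0: "0 \<le> m" by (simp add: m_def)
  (* \<open>\<epsilon> = exp (- x)\<close> *)
  have ineq: "2 * pi * ln (norm (v 0)) \<le> 2 * pi * ln (M + 1) - x * m" if x: "x > 0" for x
  proof -
    have e1: "exp (- x) < 1" using x by simp
    have hi: "((\<lambda>t. if t \<in> Z then 1 else 0) has_integral m) {0..2*pi}"
    proof -
      have "((\<lambda>t. 1::real) has_integral m) Z"
        using Zm integrable_integral[of "\<lambda>_. 1::real" Z]
        by (simp add: m_def lmeasure_integral lmeasurable_iff_integrable_on)
      moreover have "Z \<subseteq> {0..2*pi}" by (auto simp: Z_def)
      ultimately show ?thesis by (simp add: has_integral_restrict)
    qed
    have "((\<lambda>t. ln (M + 1) + (- x) * (if t \<in> Z then 1 else 0)) has_integral measure lborel {0..2*pi} *\<^sub>R ln (M + 1) + (- x) * m) {0..2*pi}"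
      by (rule has_integral_add[OF has_integral_const_real has_integral_mult_right[OF hi]])
    hence I: "((\<lambda>t. ln (M + 1) + (- x) * (if t \<in> Z then 1 else 0)) has_integral 2 * pi * ln (M + 1) - x * m) {0..2*pi}"
      by simp
    have pos: "norm (\<psi> z) + exp (- x) > 0" for z by (rule add_nonneg_pos[OF norm_ge_zero exp_gt_zero])
    have c: "continuous_on (cball 0 1) (\<lambda>z. ln (norm (\<psi> z) + exp (- x)))"
      by (rule continuous_on_ln_norm_plus[OF symbol_continuous]) (rule exp_gt_zero)
    have "integral {0..2*pi} (\<lambda>t. ln (norm (\<psi> (cis t)) + exp (- x))) \<le> 2 * pi * ln (M + 1) - x * m"
      unfolding integral_unique[OF I, symmetric]
    proof (rule integral_le)
      show "(\<lambda>t. ln (norm (\<psi> (cis t)) + exp (- x))) integrable_on {0..2*pi}"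
        by (intro integrable_continuous_interval continuous_on_cis[OF c])
      show "(\<lambda>t. ln (M + 1) + (- x) * (if t \<in> Z then 1 else 0)) integrable_on {0..2*pi}" using I by blast
      fix t assume t: "t \<in> {0..2*pi}"
      show "ln (norm (\<psi> (cis t)) + exp (- x)) \<le> ln (M + 1) + (- x) * (if t \<in> Z then 1 else 0)"
      proof (cases "t \<in> Z")
        case True
        thus ?thesis using M(1) by (simp add: Z_def)
      next
        case False
        have "norm (\<psi> (cis t)) + exp (- x) \<le> M + 1" using M(2)[of "cis t", simplified] e1 by linarith
        thus ?thesis using False pos[of "cis t"] by (simp add: ln_mono)
      qed
    qed
    thus ?thesis using regularized_log_mean(1)[of "exp (- x)"] by simp
  qed
  have "m = 0"
  proof (rule ccontr)
    assume "m \<noteq> 0"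
    hence m: "m > 0" using m0 by simp
    define D where "D = 2 * pi * ln (M + 1) - 2 * pi * ln (norm (v 0))"
    have "x * m \<le> D" if "x > 0" for x using ineq[OF that] by (simp add: D_def)
    from this[of "(\<bar>D\<bar> + 1) / m"] m show False by simp
  qed
  hence "negligible Z" using Zm by (simp add: negligible_iff_measure m_def)
  thus ?thesis by (simp add: Z_def)
qed

text \<open>
  The only place where the equation in \<open>outer_function\<close> enters: as \<open>\<epsilon>\<close> tends to zero, the
  means of \<open>ln (|\<psi>| + \<epsilon>)\<close> decrease to the mean of \<open>ln |\<psi>|\<close>, which is \<open>ln |v 0|\<close>.
\<close>

lemma outer_majorant_at_0:
  assumes \<eta>: "0 < \<eta>"
  obtains Q :: "complex poly" where "\<And>z. norm z = 1 \<Longrightarrow> norm (\<psi> z) \<le> exp (Re (poly Q z))"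
    "Re (poly Q 0) \<le> ln (norm (v 0)) + \<eta>"
proof -
  let ?I = "\<lambda>\<epsilon>. integral {0..2*pi} (\<lambda>t. ln (norm (\<psi> (cis t)) + \<epsilon>))"
  define L where "L = (\<lambda>t. ln (norm (radial_limit v t)))"
  have Lint: "L absolutely_integrable_on {0..2*pi}" and L0: "integral {0..2*pi} L = 2 * pi * ln (norm (v 0))"
    using v unfolding is_outer_part_def outer_function_def L_def by (auto simp: field_simps)
  obtain N where N: "negligible N" and lim: "\<And>t. t \<in> {0..2*pi} - N \<Longrightarrow>
     \<exists>l. ((\<lambda>r. v (of_real r * cis t)) \<longlongrightarrow> l) (at_left 1) \<and> norm l = norm (\<psi> (cis t))"
    by (rule outer_part_boundary) blast
  define E where "E = N \<union> {t \<in> {0..2*pi}. \<psi> (cis t) = 0}"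
  have E: "negligible E" unfolding E_def using N symbol_zeros_negligible by simp
  have LE: "L t = ln (norm (\<psi> (cis t)))" if t: "t \<in> {0..2*pi} - E" for t
  proof -
    obtain l where l: "((\<lambda>r. v (of_real r * cis t)) \<longlongrightarrow> l) (at_left 1)" "norm l = norm (\<psi> (cis t))"
      using lim[of t] t by (auto simp: E_def)
    from tendsto_Lim[OF _ l(1)] have "radial_limit v t = l"
      unfolding radial_limit_def by simp
    thus ?thesis using l(2) by (simp add: L_def)
  qed
  obtain M where M: "0 \<le> M" "\<And>z. norm z \<le> 1 \<Longrightarrow> norm (\<psi> z) \<le> M"
    using disk_algebra_bounded[OF \<psi>] by blast
  define e where "e = (\<lambda>n. 1 / real (n + 2))"
  have e: "e n > 0" "e n \<le> 1" for n by (auto simp: e_def)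
  have elim: "e \<longlonglongrightarrow> 0" unfolding e_def by real_asymp
  define f where "f = (\<lambda>n t. if t \<in> E then 0 else ln (norm (\<psi> (cis t)) + e n))"
  have fI: "f n integrable_on {0..2*pi}" "integral {0..2*pi} (f n) = ?I (e n)" for n
  proof -
    have c: "continuous_on (cball 0 1) (\<lambda>z. ln (norm (\<psi> z) + e n))"
      by (rule continuous_on_ln_norm_plus[OF symbol_continuous]) (rule e(1))
    have i: "(\<lambda>t. ln (norm (\<psi> (cis t)) + e n)) integrable_on {0..2*pi}"
      by (intro integrable_continuous_interval continuous_on_cis[OF c])
    show "f n integrable_on {0..2*pi}"
      by (rule integrable_spike[OF i E]) (auto simp: f_def)
    show "integral {0..2*pi} (f n) = ?I (e n)"
      by (rule integral_spike[OF E]) (auto simp: f_def)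
  qed
  have "(\<lambda>n. integral {0..2*pi} (f n)) \<longlonglongrightarrow> integral {0..2*pi} (\<lambda>t. if t \<in> E then 0 else L t)"
  proof (rule dominated_convergence(2)[OF fI(1)])
    show "(\<lambda>t. \<bar>L t\<bar> + ln (M + 1)) integrable_on {0..2*pi}"
      using Lint by (intro integrable_add) (auto simp: absolutely_integrable_on_def)
    fix t assume t: "t \<in> {0..2*pi}"
    show "norm (f n t) \<le> \<bar>L t\<bar> + ln (M + 1)" for n
    proof (cases "t \<in> E")
      case True
      thus ?thesis using M(1) by (simp add: f_def)
    next
      case False
      hence nz: "0 < norm (\<psi> (cis t))" using t by (auto simp: E_def)
      have "ln (norm (\<psi> (cis t))) \<le> ln (norm (\<psi> (cis t)) + e n)"
        using nz e[of n] by (intro ln_mono) auto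
      moreover have "ln (norm (\<psi> (cis t)) + e n) \<le> ln (M + 1)"
        using add_pos_pos[OF nz e(1)[of n]] e(2)[of n] M(2)[of "cis t"] by (intro ln_mono) auto
      moreover have "0 \<le> ln (M + 1)" using M by simp
      ultimately show ?thesis using LE[of t] t False by (simp add: f_def)
    qed
    show "(\<lambda>n. f n t) \<longlonglongrightarrow> (if t \<in> E then 0 else L t)"
    proof (cases "t \<in> E")
      case True
      thus ?thesis by (simp add: f_def)
    next
      case False
      hence nz: "norm (\<psi> (cis t)) + 0 \<noteq> 0" using t by (auto simp: E_def)
      have "(\<lambda>n. ln (norm (\<psi> (cis t)) + e n)) \<longlonglongrightarrow> ln (norm (\<psi> (cis t)) + 0)"
        by (intro tendsto_intros elim nz)
      thus ?thesis using False LE[of t] t by (simp add: f_def)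
    qed
  qed
  also have "integral {0..2*pi} (\<lambda>t. if t \<in> E then 0 else L t) = integral {0..2*pi} L"
    by (rule integral_spike[OF E]) auto
  finally have lim: "(\<lambda>n. ?I (e n)) \<longlonglongrightarrow> 2 * pi * ln (norm (v 0))"
    by (simp add: fI L0)
  have "2 * pi * ln (norm (v 0)) < 2 * pi * ln (norm (v 0)) + pi * \<eta>" using \<eta> by simp
  from eventually_happens'[OF _ order_tendstoD(2)[OF lim this]]
  obtain n where n: "?I (e n) < 2 * pi * ln (norm (v 0)) + pi * \<eta>" by auto
  obtain Q :: "complex poly" where Q: "\<And>z. norm z = 1 \<Longrightarrow> norm (\<psi> z) \<le> exp (Re (poly Q z))"
    and Q0: "2 * pi * Re (poly Q 0) \<le> ?I (e n) + 2 * pi * (\<eta> / 2)"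
    using regularized_log_mean(2)[OF e(1)[of n], of "\<eta> / 2"] \<eta> by auto
  have "2 * pi * Re (poly Q 0) \<le> 2 * pi * (ln (norm (v 0)) + \<eta>)"
    using n Q0 by (simp add: algebra_simps)
  hence "Re (poly Q 0) \<le> ln (norm (v 0)) + \<eta>" by simp
  with Q show ?thesis by (rule that)
qed

end

lemma mean_square_minus_center:
  assumes g: "g holomorphic_on ball 0 1" and r: "0 \<le> r" "r < 1"
  shows "mean_square (\<lambda>z. g z - g 0) r = mean_square g r - (norm (g 0))\<^sup>2"
proof -
  let ?g = "\<lambda>t. g (of_real r * cis t)"
  note c = dilation_regular(1)[OF g r] and h = dilation_regular(2)[OF g r]
  have m: "(?g has_integral 2 * pi * g 0) {0..2*pi}"
    using Poisson_formula[OF c h, of 0] by (simp add: scaleR_conv_of_real)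
  have "((\<lambda>t. Re (cnj (g 0) * ?g t)) has_integral Re (cnj (g 0) * (2 * pi * g 0))) {0..2*pi}"
    using has_integral_linear[OF has_integral_mult_right[OF m] bounded_linear_Re] by (simp only: o_def)
  moreover have "Re (cnj (g 0) * (2 * pi * g 0)) = 2 * pi * (norm (g 0))\<^sup>2"
    unfolding cmod_power2 by (simp add: power2_eq_square algebra_simps)
  ultimately have m': "((\<lambda>t. Re (cnj (g 0) * ?g t)) has_integral 2 * pi * (norm (g 0))\<^sup>2) {0..2*pi}" by simp
  have "((\<lambda>t. (norm (?g t))\<^sup>2) has_integral 2 * pi * mean_square g r) {0..2*pi}"
    using integrable_integral[of "\<lambda>t. (norm (?g t))\<^sup>2" "{0..2*pi}"] continuous_on_circle[OF g r]
    by (simp add: mean_square_def integrable_continuous_interval continuous_intros)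
  from has_integral_add[OF has_integral_diff[OF this has_integral_mult_right[OF m', of 2]]
      has_integral_const_real[of "(norm (g 0))\<^sup>2" 0 "2*pi"]]
  have I: "((\<lambda>t. (norm (?g t))\<^sup>2 - 2 * Re (cnj (g 0) * ?g t) + (norm (g 0))\<^sup>2) has_integral
      2 * pi * (mean_square g r - (norm (g 0))\<^sup>2)) {0..2*pi}"
    by (simp add: algebra_simps)
  have "(norm (x - y))\<^sup>2 = (norm x)\<^sup>2 - 2 * Re (cnj y * x) + (norm y)\<^sup>2" for x y :: complex
    unfolding cmod_power2 by (simp add: power2_eq_square algebra_simps)
  hence "integral {0..2*pi} (\<lambda>t. (norm (?g t - g 0))\<^sup>2) = 2 * pi * (mean_square g r - (norm (g 0))\<^sup>2)"
    using integral_unique[OF I] by simp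
  thus ?thesis by (simp add: mean_square_def)
qed

text \<open>
  A function bounded by one that nearly attains the value one in modulus at the centre is nearly
  constant: the norm of \<open>g - g 0\<close> is at most \<open>sqrt (1 - |g 0|\<^sup>2)\<close>.
\<close>

lemma bounded_by_1_oscillation:
  assumes g: "g holomorphic_on ball 0 1" and g1: "\<And>z. norm z < 1 \<Longrightarrow> norm (g z) \<le> 1" and a: "norm a < 1"
  shows "(norm (g a - g 0))\<^sup>2 \<le> 4 / (1 - norm a) * (1 - (norm (g 0))\<^sup>2)"
proof -
  define s where "s = 1 - (norm (g 0))\<^sup>2"
  have s: "0 \<le> s" using g1[of 0] by (simp add: s_def abs_square_le_1)
  have hol: "(\<lambda>z. g z - g 0) holomorphic_on ball 0 1" using g by (intro holomorphic_intros)
  have ms: "mean_square (\<lambda>z. g z - g 0) r \<le> (sqrt s)\<^sup>2" if r: "0 < r" "r < 1" for r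
  proof -
    have "mean_square g r \<le> mean_square (\<lambda>_. 1) r"
      by (rule mean_square_mono_integrand[OF g]) (use g1 r in \<open>auto simp: norm_mult\<close>)
    thus ?thesis using mean_square_minus_center[OF g, of r] r s by (simp add: mean_square_const s_def)
  qed
  note H = hardy_classI[OF hol _ ms]
  have "norm (g a - g 0) \<le> sqrt (4 / (1 - norm a)) * H2_norm (\<lambda>z. g z - g 0)"
    using hardy_point_evaluation[OF H(1) a] s by simp
  also have "\<dots> \<le> sqrt (4 / (1 - norm a)) * sqrt s"
    using H(2) s a by (intro mult_left_mono) auto
  finally have "(norm (g a - g 0))\<^sup>2 \<le> (sqrt (4 / (1 - norm a)) * sqrt s)\<^sup>2" by (intro power_mono) auto
  thus ?thesis using s a by (simp add: power_mult_distrib s_def)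
qed

text \<open>
  The passage from \<open>0\<close> to \<open>a\<close> is made by \<open>g = v exp (- Q)\<close>, which is bounded by one. By the choice of
  \<open>Q\<close>, \<open>|g 0|\<close> is nearly one, hence so is \<open>|g a|\<close>, that is, \<open>exp (Re (Q a))\<close> is nearly \<open>|v a|\<close>.
\<close>

lemma outer_majorant_at_point:
  assumes \<psi>: "\<psi> \<in> disk_algebra" and v: "is_outer_part v \<psi>" and a: "norm a < 1" and c: "norm (v a) < c"
  obtains Q :: "complex poly" where "\<And>z. norm z = 1 \<Longrightarrow> norm (\<psi> z) \<le> exp (Re (poly Q z))"
    "exp (Re (poly Q a)) < c"
proof -
  define E where "E = 4 / (1 - norm a)"
  have E: "E > 0" using a by (simp add: E_def)
  (* the lower bound for \<open>|g a|\<close> that results when \<open>Q\<close> has excess \<open>\<eta>\<close> at \<open>0\<close> *)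
  define s where "s = (\<lambda>\<eta>::real. exp (- \<eta>) - sqrt (E * (1 - (exp (- \<eta>))\<^sup>2)))"
  have c0: "c > 0" using c norm_ge_zero[of "v a"] by linarith
  have q: "norm (v a) / c < 1" using c c0 by simp
  have "(s \<longlongrightarrow> exp (- 0) - sqrt (E * (1 - (exp (- 0))\<^sup>2))) (at_right 0)"
    unfolding s_def by (intro tendsto_intros)
  hence "(s \<longlongrightarrow> 1) (at_right 0)" by simp
  from order_tendstoD(1)[OF this q]
  have "\<forall>\<^sub>F \<eta> in at_right 0. norm (v a) / c < s \<eta> \<and> \<eta> > 0"
    using eventually_at_right_less[of 0] by eventually_elim auto
  from eventually_happens'[OF _ this] obtain \<eta> where \<eta>: "norm (v a) / c < s \<eta>" "\<eta> > 0" by auto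
  have s0: "s \<eta> > 0" using \<eta>(1) c0 by (meson divide_nonneg_pos norm_ge_zero order.strict_trans1)
  obtain Q :: "complex poly" where Q: "\<And>z. norm z = 1 \<Longrightarrow> norm (\<psi> z) \<le> exp (Re (poly Q z))"
    and Q0: "Re (poly Q 0) \<le> ln (norm (v 0)) + \<eta>"
    using outer_majorant_at_0[OF \<psi> v \<eta>(2)] by blast
  define g where "g = (\<lambda>z. exp (- poly Q z) * v z)"
  have gh: "g holomorphic_on ball 0 1"
    unfolding g_def by (rule hardy_class_holo[OF outer_part_div_exp_le_1(1)[OF \<psi> v Q]])
  have g1: "norm (g z) \<le> 1" if "norm z < 1" for z
    unfolding g_def by (rule outer_part_div_exp_le_1(2)[OF \<psi> v Q that])
  have ng: "norm (g z) = exp (- Re (poly Q z)) * norm (v z)" for z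
    unfolding g_def norm_exp_minus_mult by (simp add: exp_minus field_simps)
  have g0: "exp (- \<eta>) \<le> norm (g 0)"
  proof -
    have "norm (v 0) > 0" using outer_part_hardy(2)[OF \<psi> v] by simp
    hence "norm (g 0) = exp (ln (norm (v 0)) - Re (poly Q 0))"
      by (simp add: ng exp_diff exp_minus field_simps)
    thus ?thesis using Q0 by simp
  qed
  have "norm (g a - g 0) \<le> sqrt (E * (1 - (exp (- \<eta>))\<^sup>2))"
  proof (rule real_le_rsqrt)
    have "(norm (g a - g 0))\<^sup>2 \<le> E * (1 - (norm (g 0))\<^sup>2)"
      unfolding E_def by (rule bounded_by_1_oscillation[OF gh g1 a])
    also have "\<dots> \<le> E * (1 - (exp (- \<eta>))\<^sup>2)"
      using E power_mono[OF g0, of 2] by (intro mult_left_mono) auto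
    finally show "(norm (g a - g 0))\<^sup>2 \<le> E * (1 - (exp (- \<eta>))\<^sup>2)" .
  qed
  moreover have "norm (g 0) \<le> norm (g a) + norm (g a - g 0)"
    using norm_triangle_ineq3[of "g a" "g 0"] by linarith
  ultimately have "s \<eta> \<le> norm (g a)" using g0 by (simp add: s_def)
  hence "s \<eta> * exp (Re (poly Q a)) \<le> norm (v a)"
    by (simp add: ng exp_minus field_simps)
  also have "\<dots> < s \<eta> * c" using \<eta>(1) c0 by (simp add: pos_divide_less_eq)
  finally have "exp (Re (poly Q a)) < c" using s0 by simp
  with Q show ?thesis by (rule that)
qed

section \<open>Growth of the products of the weight along an orbit\<close>

definition orbit_product :: "(complex \<Rightarrow> complex) \<Rightarrow> complex \<Rightarrow> complex \<Rightarrow> nat \<Rightarrow> complex \<Rightarrow> complex" where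
  "orbit_product \<psi> a \<mu> n z = (\<Prod>j<n. \<psi> (rotation_about a (\<mu> ^ j) z))"

lemma norm_power_unit: "norm (\<mu>::complex) = 1 \<Longrightarrow> norm (\<mu> ^ j) = 1"
  by (simp add: norm_power)

lemma prod_add_le:
  fixes x :: "nat \<Rightarrow> real"
  assumes "0 \<le> \<epsilon>" "\<And>j. 0 \<le> x j" "\<And>j. x j \<le> M"
  shows "(\<Prod>j<n. x j + \<epsilon>) \<le> (\<Prod>j<n. x j) + ((M + \<epsilon>) ^ n - M ^ n)"
proof (induction n)
  case (Suc n)
  have M: "0 \<le> M" using assms(2,3)[of 0] by linarith
  have D: "0 \<le> (M + \<epsilon>) ^ n - M ^ n" using assms M by (simp add: power_mono)
  have P: "(\<Prod>j<n. x j) \<le> M ^ n"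
    using prod_mono[of "{..<n}" x "\<lambda>_. M"] assms by simp
  have "(\<Prod>j<Suc n. x j + \<epsilon>) \<le> ((\<Prod>j<n. x j) + ((M + \<epsilon>) ^ n - M ^ n)) * (x n + \<epsilon>)"
    using Suc assms by (simp add: mult_right_mono)
  also have "\<dots> = (\<Prod>j<Suc n. x j) + (\<Prod>j<n. x j) * \<epsilon> + ((M + \<epsilon>) ^ n - M ^ n) * (x n + \<epsilon>)"
    by (simp add: algebra_simps)
  also have "\<dots> \<le> (\<Prod>j<Suc n. x j) + M ^ n * \<epsilon> + ((M + \<epsilon>) ^ n - M ^ n) * (M + \<epsilon>)"
    using P D assms by (intro add_mono mult_right_mono mult_left_mono) auto
  finally show ?case by (simp add: algebra_simps)
qed simp

text \<open>
  For a monomial of positive degree the sum is geometric with ratio \<open>\<mu>\<^sup>i \<noteq> 1\<close>, hence bounded.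
\<close>

lemma orbit_sums_of_poly_bounded:
  fixes p :: "complex poly"
  assumes \<mu>: "norm \<mu> = 1" and irr: "\<And>k. 0 < k \<Longrightarrow> \<mu> ^ k \<noteq> 1"
  obtains C where "\<And>n u. norm u \<le> 1 \<Longrightarrow> norm ((\<Sum>j<n. poly p (\<mu> ^ j * u)) - of_nat n * poly p 0) \<le> C"
proof -
  define C where "C = (\<Sum>i\<in>{1..degree p}. norm (coeff p i) * (2 / norm (1 - \<mu> ^ i)))"
  have "norm ((\<Sum>j<n. poly p (\<mu> ^ j * u)) - of_nat n * poly p 0) \<le> C" if u: "norm u \<le> 1" for n u
  proof -
    have eq: "poly p x = poly p 0 + (\<Sum>i\<in>{1..degree p}. coeff p i * x ^ i)" for x
    proof -
      have "{..degree p} = insert 0 {1..degree p}" by auto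
      thus ?thesis by (simp add: poly_altdef poly_0_coeff_0)
    qed
    have "(\<Sum>j<n. poly p (\<mu> ^ j * u))
        = (\<Sum>j<n. poly p 0 + (\<Sum>i\<in>{1..degree p}. coeff p i * (\<mu> ^ j * u) ^ i))"
      by (intro sum.cong refl eq)
    also have "\<dots> = of_nat n * poly p 0 + (\<Sum>j<n. \<Sum>i\<in>{1..degree p}. coeff p i * (\<mu> ^ j * u) ^ i)"
      by (simp add: sum.distrib)
    also have "(\<Sum>j<n. \<Sum>i\<in>{1..degree p}. coeff p i * (\<mu> ^ j * u) ^ i)
        = (\<Sum>i\<in>{1..degree p}. coeff p i * (u ^ i * (\<Sum>j<n. (\<mu> ^ i) ^ j)))"
      by (subst sum.swap) (simp add: sum_distrib_left power_mult_distrib power_mult[symmetric] mult_ac)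
    finally have "norm ((\<Sum>j<n. poly p (\<mu> ^ j * u)) - of_nat n * poly p 0)
        = norm (\<Sum>i\<in>{1..degree p}. coeff p i * (u ^ i * (\<Sum>j<n. (\<mu> ^ i) ^ j)))" by simp
    also have "\<dots> \<le> C"
      unfolding C_def
    proof (rule sum_norm_le)
      fix i assume i: "i \<in> {1..degree p}"
      hence ne: "\<mu> ^ i \<noteq> 1" using irr[of i] by auto
      have "norm (1 - (\<mu> ^ i) ^ n) \<le> 2"
        using norm_triangle_ineq4[of 1 "(\<mu> ^ i) ^ n"] \<mu> by (simp add: norm_power)
      hence "norm (\<Sum>j<n. (\<mu> ^ i) ^ j) \<le> 2 / norm (1 - \<mu> ^ i)"
        using ne by (simp add: geometric_sum norm_divide norm_minus_commute divide_right_mono)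
      moreover have "norm (u ^ i) \<le> 1" using u by (simp add: norm_power power_le_one)
      ultimately have "norm (u ^ i * (\<Sum>j<n. (\<mu> ^ i) ^ j)) \<le> 1 * (2 / norm (1 - \<mu> ^ i))"
        unfolding norm_mult by (intro mult_mono) auto
      from mult_left_mono[OF this, of "norm (coeff p i)"]
      show "norm (coeff p i * (u ^ i * (\<Sum>j<n. (\<mu> ^ i) ^ j))) \<le> norm (coeff p i) * (2 / norm (1 - \<mu> ^ i))"
        by (simp add: norm_mult)
    qed
    finally show ?thesis .
  qed
  thus ?thesis by (rule that)
qed

lemma max_Re_closed_disk:
  assumes "continuous_on (cball 0 1) q" "q holomorphic_on ball 0 1"
    and "\<And>z. norm z = 1 \<Longrightarrow> Re (q z) \<le> B" and "norm z \<le> 1"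
  shows "Re (q z) \<le> B"
  by (rule maximum_real_frontier[of q "cball 0 1"]) (use assms in auto)

lemma max_norm_closed_disk:
  assumes "continuous_on (cball 0 1) q" "q holomorphic_on ball 0 1"
    and "\<And>z. norm z = 1 \<Longrightarrow> norm (q z) \<le> B" and "norm z \<le> 1"
  shows "norm (q z) \<le> B"
  by (rule maximum_modulus_frontier[of q "cball 0 1"]) (use assms in auto)

text \<open>
  In the coordinate \<open>blaschke a\<close> the majorant \<open>Q\<close> becomes a function \<open>q\<close>, which is replaced by a
  polynomial \<open>p\<close> at the cost of \<open>\<delta>\<close>, in order that \<open>orbit_sums_of_poly_bounded\<close> applies. The same cost
  occurs again when \<open>p 0\<close> is compared with \<open>q 0 = Q a\<close>, whence the factor two in the definition of \<open>\<delta>\<close>.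
\<close>

lemma orbit_product_upper:
  assumes a: "norm a < 1" and \<mu>: "norm \<mu> = 1" and irr: "\<And>k. 0 < k \<Longrightarrow> \<mu> ^ k \<noteq> 1"
    and \<psi>: "\<psi> \<in> disk_algebra" and v: "is_outer_part v \<psi>" and c: "norm (v a) < c"
  obtains C where "0 \<le> C" "\<And>n z. norm z < 1 \<Longrightarrow> norm (orbit_product \<psi> a \<mu> n z) \<le> C * c ^ n"
proof -
  obtain Q :: "complex poly" where Q: "\<And>z. norm z = 1 \<Longrightarrow> norm (\<psi> z) \<le> exp (Re (poly Q z))"
    and Qa: "exp (Re (poly Q a)) < c"
    using outer_majorant_at_point[OF \<psi> v a c] by blast
  have c0: "0 < c" using Qa by (meson exp_gt_zero order.strict_trans)
  define \<delta> where "\<delta> = (ln c - Re (poly Q a)) / 2"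
  have "Re (poly Q a) < ln c"
    using Qa c0 by (metis exp_less_cancel_iff exp_ln)
  hence \<delta>: "0 < \<delta>" by (simp add: \<delta>_def)
  have Qd: "norm (\<psi> z) \<le> exp (Re (poly Q z))" if z: "norm z \<le> 1" for z
  proof -
    have "norm (exp (- poly Q z) * \<psi> z) \<le> 1"
      by (rule max_norm_closed_disk[OF _ _ _ z])
         (use \<psi> Q in \<open>auto simp: disk_algebra_def norm_exp_minus_mult divide_simps
            simp del: mult_exp_exp intro!: continuous_intros holomorphic_intros\<close>)
    thus ?thesis unfolding norm_exp_minus_mult by (simp add: divide_simps)
  qed
  define q where "q = (\<lambda>u. poly Q (blaschke (- a) u))"
  have a': "norm (- a) < 1" using a by simp
  have qc: "continuous_on (cball 0 1) q"
    unfolding q_def by (intro continuous_intros blaschke_continuous a')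
  have qh: "q holomorphic_on ball 0 1"
    unfolding q_def using blaschke_holomorphic[OF a'] by (intro holomorphic_intros)
  have "continuous_on (sphere 0 1) (\<lambda>z. Re (q z))"
    by (intro continuous_intros continuous_on_subset[OF qc]) auto
  from Re_poly_dense[OF this \<delta>] obtain p :: "complex poly"
    where p: "\<And>z. norm z = 1 \<Longrightarrow> \<bar>Re (q z) - Re (poly p z)\<bar> < \<delta>" by blast
  have qp: "Re (q z) \<le> Re (poly p z) + \<delta>" if "norm z \<le> 1" for z
  proof -
    have "Re (q z - poly p z) \<le> \<delta>"
      by (rule max_Re_closed_disk[OF _ _ _ that])
         (use qc qh p in \<open>force intro!: continuous_intros holomorphic_intros simp: abs_less_iff\<close>)+
    thus ?thesis by simp
  qed
  have pq: "Re (poly p z) \<le> Re (q z) + \<delta>" if "norm z \<le> 1" for z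
  proof -
    have "Re (poly p z - q z) \<le> \<delta>"
      by (rule max_Re_closed_disk[OF _ _ _ that])
         (use qc qh p in \<open>force intro!: continuous_intros holomorphic_intros simp: abs_less_iff\<close>)+
    thus ?thesis by simp
  qed
  have q0: "q 0 = poly Q a" by (simp add: q_def blaschke_def)
  obtain B where B: "\<And>n u. norm u \<le> 1 \<Longrightarrow>
      norm ((\<Sum>j<n. poly p (\<mu> ^ j * u)) - of_nat n * poly p 0) \<le> B"
    using orbit_sums_of_poly_bounded[OF \<mu> irr] by blast
  have "norm (orbit_product \<psi> a \<mu> n z) \<le> exp B * c ^ n" if z: "norm z < 1" for n z
  proof -
    define u where "u = blaschke a z"
    have u: "norm u \<le> 1" unfolding u_def using norm_blaschke_le[OF a, of z] z by simp
    have step: "norm (\<psi> (rotation_about a (\<mu> ^ j) z)) \<le> exp (Re (poly p (\<mu> ^ j * u)) + \<delta>)" for j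
    proof -
      have "norm (\<mu> ^ j * u) \<le> 1" using u \<mu> by (simp add: norm_mult norm_power)
      moreover have "norm (rotation_about a (\<mu> ^ j) z) \<le> 1"
        using norm_rotation_le[OF a norm_power_unit[OF \<mu>], of z] z by simp
      ultimately have "norm (\<psi> (rotation_about a (\<mu> ^ j) z)) \<le> exp (Re (q (\<mu> ^ j * u)))"
          "Re (q (\<mu> ^ j * u)) \<le> Re (poly p (\<mu> ^ j * u)) + \<delta>"
        using Qd[of "rotation_about a (\<mu> ^ j) z"] qp by (auto simp: q_def u_def rotation_about_def)
      thus ?thesis by (meson exp_le_cancel_iff order_trans)
    qed
    have "norm (orbit_product \<psi> a \<mu> n z) = (\<Prod>j<n. norm (\<psi> (rotation_about a (\<mu> ^ j) z)))"
      unfolding orbit_product_def by (rule prod_norm[symmetric])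
    also have "\<dots> \<le> (\<Prod>j<n. exp (Re (poly p (\<mu> ^ j * u)) + \<delta>))"
      by (rule prod_mono) (use step in auto)
    also have "\<dots> = exp (\<Sum>j<n. Re (poly p (\<mu> ^ j * u)) + \<delta>)" by (simp add: exp_sum)
    also have "(\<Sum>j<n. Re (poly p (\<mu> ^ j * u)) + \<delta>)
        = Re ((\<Sum>j<n. poly p (\<mu> ^ j * u)) - of_nat n * poly p 0) + real n * (Re (poly p 0) + \<delta>)"
      by (simp add: sum.distrib algebra_simps)
    also have "\<dots> \<le> B + real n * ln c"
    proof (rule add_mono)
      show "Re ((\<Sum>j<n. poly p (\<mu> ^ j * u)) - of_nat n * poly p 0) \<le> B"
        using complex_Re_le_cmod B[OF u, of n] by (rule order_trans)
      have "Re (poly p 0) + \<delta> \<le> ln c" using pq[of 0] q0 by (simp add: \<delta>_def field_simps)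
      thus "real n * (Re (poly p 0) + \<delta>) \<le> real n * ln c" by (intro mult_left_mono) auto
    qed
    finally have "norm (orbit_product \<psi> a \<mu> n z) \<le> exp (B + real n * ln c)" by simp
    also have "\<dots> = exp B * c ^ n" using c0 by (simp add: exp_add exp_of_nat_mult)
    finally show ?thesis .
  qed
  thus ?thesis by (intro that[of "exp B"]) auto
qed

lemma mean_square_boundary_le_norm:
  assumes G: "continuous_on (cball 0 1) G" and hG: "hardy_class G"
  shows "mean_square G 1 \<le> (H2_norm G)\<^sup>2"
proof -
  obtain C where C: "\<And>z. norm z \<le> 1 \<Longrightarrow> norm (G z) \<le> C"
    using disk_algebra_bounded[of G] G hardy_class_holo[OF hG] by (auto simp: disk_algebra_def)
  have ci: "continuous_on {0..2*pi} (\<lambda>t. G (of_real (radii n) * cis t))" for n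
    by (rule continuous_on_circle[OF hardy_class_holo[OF hG]]) (use radii[of n] in auto)
  have "(\<lambda>n. integral {0..2*pi} (\<lambda>t. (norm (G (of_real (radii n) * cis t)))\<^sup>2))
      \<longlonglongrightarrow> integral {0..2*pi} (\<lambda>t. (norm (G (of_real 1 * cis t)))\<^sup>2)"
  proof (rule dominated_convergence(2))
    show "(\<lambda>t. (norm (G (of_real (radii n) * cis t)))\<^sup>2) integrable_on {0..2*pi}" for n
      by (intro integrable_continuous_interval continuous_intros ci)
    show "(\<lambda>t. C\<^sup>2) integrable_on {0..2*pi}" by auto
    show "norm ((norm (G (of_real (radii n) * cis t)))\<^sup>2) \<le> C\<^sup>2" for n t
      using C[of "of_real (radii n) * cis t"] radii[of n] by (simp add: norm_mult power_mono)
    show "(\<lambda>n. (norm (G (of_real (radii n) * cis t)))\<^sup>2) \<longlonglongrightarrow> (norm (G (of_real 1 * cis t)))\<^sup>2" for t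
      using filterlim_compose[OF radial_limit_closed_disk[OF G] radii_at_left]
      by (auto intro!: tendsto_intros)
  qed
  hence "(\<lambda>n. mean_square G (radii n)) \<longlonglongrightarrow> mean_square G 1"
    unfolding mean_square_def by (intro tendsto_divide tendsto_const) auto
  moreover have "mean_square G (radii n) \<le> (H2_norm G)\<^sup>2" for n
    by (rule mean_square_le_norm[OF hG]) (use radii[of n] in auto)
  ultimately show ?thesis by (intro LIMSEQ_le_const2[of _ "mean_square G 1"]) auto
qed

lemma orbit_product_regular:
  assumes a: "norm a < 1" and \<mu>: "norm \<mu> = 1" and \<psi>: "\<psi> \<in> disk_algebra"
  shows "continuous_on (cball 0 1) (orbit_product \<psi> a \<mu> n)" "hardy_class (orbit_product \<psi> a \<mu> n)"
proof -
  have c: "continuous_on (cball 0 1) (\<lambda>z. \<psi> (rotation_about a (\<mu> ^ j) z))" for j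
  proof (rule continuous_on_compose2[where t = "cball 0 1" and g = \<psi>])
    show "continuous_on (cball 0 1) \<psi>" using \<psi> by (simp add: disk_algebra_def)
  qed (use rotation_continuous[OF a norm_power_unit[OF \<mu>]] norm_rotation_le[OF a norm_power_unit[OF \<mu>]] in auto)
  have h: "(\<lambda>z. \<psi> (rotation_about a (\<mu> ^ j) z)) holomorphic_on ball 0 1" for j
  proof -
    have "(\<psi> \<circ> rotation_about a (\<mu> ^ j)) holomorphic_on ball 0 1"
      using \<psi> rotation_holomorphic[OF a norm_power_unit[OF \<mu>], of j]
        norm_rotation_less[OF a norm_power_unit[OF \<mu>], of _ j]
      by (intro holomorphic_on_compose_gen[where t = "ball 0 1"]) (auto simp: disk_algebra_def)
    thus ?thesis by (simp add: o_def)
  qed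
  show C: "continuous_on (cball 0 1) (orbit_product \<psi> a \<mu> n)"
    unfolding orbit_product_def[abs_def] by (intro continuous_intros c)
  have H: "orbit_product \<psi> a \<mu> n holomorphic_on ball 0 1"
    unfolding orbit_product_def[abs_def] by (intro holomorphic_intros h)
  obtain B where "\<And>z. norm z \<le> 1 \<Longrightarrow> norm (orbit_product \<psi> a \<mu> n z) \<le> B"
    using disk_algebra_bounded[of "orbit_product \<psi> a \<mu> n"] C H by (auto simp: disk_algebra_def)
  hence "hardy_class (\<lambda>z. orbit_product \<psi> a \<mu> n z * 1)"
    by (intro hardy_bounded_mult(1)[OF hardy_class_const H, of B]) auto
  thus "hardy_class (orbit_product \<psi> a \<mu> n)" by simp
qed

text \<open>
  With \<open>Re Q\<close> close to \<open>ln (|\<psi>|\<^sup>2 + x) / 2\<close> on the circle, the zero-free function \<open>F\<close>, the product of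
  \<open>exp (Q \<circ> \<phi>\<^sup>j)\<close>, takes at \<open>a\<close> a value of modulus \<open>exp (Re (Q a))\<^sup>n \<ge> |v a|\<^sup>n\<close>, while on the circle the
  square of its modulus exceeds that of the orbit product by at most an error that vanishes with \<open>x\<close>
  for fixed \<open>n\<close>. The bound for point evaluation at \<open>a\<close> connects the two facts.
\<close>

lemma orbit_product_lower:
  assumes a: "norm a < 1" and \<mu>: "norm \<mu> = 1"
    and \<psi>: "\<psi> \<in> disk_algebra" and v: "is_outer_part v \<psi>"
  shows "norm (v a) ^ n \<le> sqrt ((1 + norm a) / (1 - norm a)) * H2_norm (orbit_product \<psi> a \<mu> n)"
proof -
  let ?P = "orbit_product \<psi> a \<mu> n" and ?R = "\<lambda>j. rotation_about a (\<mu> ^ j)"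
  define k where "k = (1 + norm a) / (1 - norm a)"
  have k: "0 < k" unfolding k_def using a by (intro divide_pos_pos) (auto intro: add_pos_nonneg)
  obtain M where M: "0 \<le> M" "\<And>z. norm z \<le> 1 \<Longrightarrow> norm (\<psi> z) \<le> M"
    using disk_algebra_bounded[OF \<psi>] by blast
  note R = norm_power_unit[OF \<mu>]
  note reg = orbit_product_regular[OF a \<mu> \<psi>, of n]
  have main: "(norm (v a) ^ n)\<^sup>2 \<le> k * (exp (2 * real n * x) * ((H2_norm ?P)\<^sup>2 + ((M\<^sup>2 + x) ^ n - (M\<^sup>2) ^ n)))"
    if x: "x > 0" for x
  proof -
    have pos: "(norm (\<psi> z))\<^sup>2 + x > 0" for z using x by (simp add: add_nonneg_pos)
    have cw: "continuous_on (sphere 0 1) (\<lambda>z. ln ((norm (\<psi> z))\<^sup>2 + x) / 2)"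
    proof -
      have "continuous_on (sphere 0 1) (\<lambda>z. ln (norm ((\<psi> z)\<^sup>2) + x))"
        by (rule continuous_on_ln_norm_plus[OF _ x])
           (use \<psi> in \<open>auto simp: disk_algebra_def intro!: continuous_intros intro: continuous_on_subset\<close>)
      hence "continuous_on (sphere 0 1) (\<lambda>z. ln (norm ((\<psi> z)\<^sup>2) + x) / 2)"
        by (intro continuous_on_divide continuous_on_const) auto
      thus ?thesis by (simp only: norm_power)
    qed
    obtain Q :: "complex poly" where Q1: "\<And>z. norm z = 1 \<Longrightarrow> ln ((norm (\<psi> z))\<^sup>2 + x) / 2 \<le> Re (poly Q z)"
      and Q2: "\<And>z. norm z = 1 \<Longrightarrow> Re (poly Q z) \<le> ln ((norm (\<psi> z))\<^sup>2 + x) / 2 + x"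
      using Re_poly_majorant[OF cw x] by blast
    have Q1': "norm (\<psi> z) \<le> exp (Re (poly Q z))" if "norm z = 1" for z
    proof (rule power2_le_imp_le)
      have "(norm (\<psi> z))\<^sup>2 \<le> exp (ln ((norm (\<psi> z))\<^sup>2 + x))" using pos[of z] x by simp
      also have "\<dots> \<le> exp (2 * Re (poly Q z))" using Q1[OF that] by simp
      also have "\<dots> = (exp (Re (poly Q z)))\<^sup>2" by (simp add: exp_double)
      finally show "(norm (\<psi> z))\<^sup>2 \<le> (exp (Re (poly Q z)))\<^sup>2" .
    qed simp
    have Q2': "(exp (Re (poly Q z)))\<^sup>2 \<le> exp (2 * x) * ((norm (\<psi> z))\<^sup>2 + x)" if "norm z = 1" for z
    proof -
      have "(exp (Re (poly Q z)))\<^sup>2 = exp (2 * Re (poly Q z))" by (simp add: exp_double)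
      also have "\<dots> \<le> exp (2 * x + ln ((norm (\<psi> z))\<^sup>2 + x))" using Q2[OF that] by simp
      finally show ?thesis using pos[of z] by (simp add: exp_add)
    qed
    have va: "norm (v a) \<le> exp (Re (poly Q a))" by (rule outer_part_le_exp[OF \<psi> v Q1' a])
    define F where "F = (\<lambda>z. \<Prod>j<n. exp (poly Q (?R j z)))"
    have Fc: "continuous_on (cball 0 1) F"
      unfolding F_def by (intro continuous_intros rotation_continuous[OF a R])
    have Fh: "F holomorphic_on ball 0 1"
      unfolding F_def by (intro holomorphic_intros) (use rotation_holomorphic[OF a R] in auto)
    have Fa: "norm (F a) = exp (Re (poly Q a)) ^ n"
      by (simp add: F_def rotation_fixes[OF a R] norm_power)
    have "(norm (v a) ^ n)\<^sup>2 \<le> (norm (F a))\<^sup>2"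
      unfolding Fa by (intro power_mono va) auto
    also have "\<dots> = mean_square (\<lambda>z. F ((\<lambda>_. a) z)) 0" by (simp add: mean_square_const)
    also have "\<dots> \<le> k * mean_square F 1"
      unfolding k_def by (rule subordination_unit_circle[OF Fc Fh]) (use a in auto)
    also have "mean_square F 1 \<le> exp (2 * real n * x) * (mean_square ?P 1 + ((M\<^sup>2 + x) ^ n - (M\<^sup>2) ^ n))"
    proof -
      have ptw: "(norm (F z))\<^sup>2 \<le> exp (2 * real n * x) * ((norm (?P z))\<^sup>2 + ((M\<^sup>2 + x) ^ n - (M\<^sup>2) ^ n))"
        if z: "norm z = 1" for z
      proof -
        have Rz: "norm (?R j z) = 1" for j by (rule norm_rotation_eq[OF a R z])
        have "(norm (F z))\<^sup>2 = (\<Prod>j<n. (exp (Re (poly Q (?R j z))))\<^sup>2)"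
          by (simp add: F_def prod_norm[symmetric] prod_power_distrib)
        also have "\<dots> \<le> (\<Prod>j<n. exp (2 * x) * ((norm (\<psi> (?R j z)))\<^sup>2 + x))"
          by (rule prod_mono) (use Q2'[OF Rz] in auto)
        also have "\<dots> = exp (2 * real n * x) * (\<Prod>j<n. (norm (\<psi> (?R j z)))\<^sup>2 + x)"
          by (simp add: prod.distrib exp_of_nat_mult[symmetric] mult_ac)
        also have "\<dots> \<le> exp (2 * real n * x) * ((\<Prod>j<n. (norm (\<psi> (?R j z)))\<^sup>2) + ((M\<^sup>2 + x) ^ n - (M\<^sup>2) ^ n))"
          by (intro mult_left_mono prod_add_le) (use x M(2) Rz in \<open>auto intro!: power_mono\<close>)
        also have "(\<Prod>j<n. (norm (\<psi> (?R j z)))\<^sup>2) = (norm (?P z))\<^sup>2"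
          by (simp add: orbit_product_def prod_norm[symmetric] prod_power_distrib)
        finally show ?thesis .
      qed
      let ?D = "(M\<^sup>2 + x) ^ n - (M\<^sup>2) ^ n" and ?e = "exp (2 * real n * x)"
      have iP: "((\<lambda>t. (norm (?P (cis t)))\<^sup>2) has_integral 2 * pi * mean_square ?P 1) {0..2*pi}"
        using integrable_integral[OF integrable_continuous_interval, of 0 "2*pi" "\<lambda>t. (norm (?P (cis t)))\<^sup>2"]
          continuous_on_cis[OF reg(1)] by (simp add: mean_square_def continuous_intros)
      have iF: "((\<lambda>t. (norm (F (cis t)))\<^sup>2) has_integral 2 * pi * mean_square F 1) {0..2*pi}"
        using integrable_integral[OF integrable_continuous_interval, of 0 "2*pi" "\<lambda>t. (norm (F (cis t)))\<^sup>2"]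
          continuous_on_cis[OF Fc] by (simp add: mean_square_def continuous_intros)
      have "((\<lambda>t. ?e * ((norm (?P (cis t)))\<^sup>2 + ?D)) has_integral
          ?e * (2 * pi * mean_square ?P 1 + measure lborel {0..2*pi} *\<^sub>R ?D)) {0..2*pi}"
        by (intro has_integral_mult_right has_integral_add iP has_integral_const_real)
      from has_integral_le[OF iF this] ptw
      have "2 * pi * mean_square F 1 \<le> 2 * pi * (?e * (mean_square ?P 1 + ?D))"
        by (simp add: algebra_simps)
      thus ?thesis by simp
    qed
    also have "mean_square ?P 1 \<le> (H2_norm ?P)\<^sup>2" by (rule mean_square_boundary_le_norm[OF reg])
    finally show ?thesis using k by simp
  qed
  have "((\<lambda>x. k * (exp (2 * real n * x) * ((H2_norm ?P)\<^sup>2 + ((M\<^sup>2 + x) ^ n - (M\<^sup>2) ^ n)))) \<longlongrightarrow>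
      k * (exp (2 * real n * 0) * ((H2_norm ?P)\<^sup>2 + ((M\<^sup>2 + 0) ^ n - (M\<^sup>2) ^ n)))) (at_right 0)"
    by (intro tendsto_intros)
  moreover have "\<forall>\<^sub>F x in at_right 0. (norm (v a) ^ n)\<^sup>2
      \<le> k * (exp (2 * real n * x) * ((H2_norm ?P)\<^sup>2 + ((M\<^sup>2 + x) ^ n - (M\<^sup>2) ^ n)))"
    using eventually_at_right_less[of 0] by eventually_elim (rule main)
  ultimately have "(norm (v a) ^ n)\<^sup>2 \<le> k * (exp (2 * real n * 0) * ((H2_norm ?P)\<^sup>2 + ((M\<^sup>2 + 0) ^ n - (M\<^sup>2) ^ n)))"
    by (intro tendsto_le[OF trivial_limit_at_right_real _ tendsto_const])
  hence "(norm (v a) ^ n)\<^sup>2 \<le> (sqrt k * H2_norm ?P)\<^sup>2"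
    using k by (simp add: power_mult_distrib)
  thus ?thesis unfolding k_def[symmetric]
    using k H2_norm_nonneg[OF reg(2)] by (intro power2_le_imp_le[of "norm (v a) ^ n"]) auto
qed

section \<open>Resolvents of a weighted rotation\<close>

lemma hardy_series:
  assumes f: "\<And>k. hardy_class (f k)" "\<And>k. H2_norm (f k) \<le> A * \<rho> ^ k"
    and A: "0 \<le> A" and \<rho>: "0 \<le> \<rho>" "\<rho> < 1"
  shows "hardy_class (\<lambda>z. \<Sum>k. f k z)" "H2_norm (\<lambda>z. \<Sum>k. f k z) \<le> A / (1 - \<rho>)"
    and "norm z < 1 \<Longrightarrow> summable (\<lambda>k. f k z)"
proof -
  have sum: "summable (\<lambda>k. f k z)" if z: "norm z < 1" for z
  proof (rule summable_comparison_test')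
    show "summable (\<lambda>k. sqrt (4 / (1 - norm z)) * (A * \<rho> ^ k))"
      using \<rho> by (intro summable_mult summable_geometric) auto
    show "norm (f k z) \<le> sqrt (4 / (1 - norm z)) * (A * \<rho> ^ k)" for k
      by (rule order_trans[OF hardy_point_evaluation[OF f(1) z] mult_left_mono[OF f(2)]]) (use z in auto)
  qed
  thus "norm z < 1 \<Longrightarrow> summable (\<lambda>k. f k z)" .
  have geo: "(\<Sum>k<n. A * \<rho> ^ k) \<le> A / (1 - \<rho>)" for n
  proof -
    have "(\<Sum>k<n. A * \<rho> ^ k) \<le> (\<Sum>k. A * \<rho> ^ k)"
      using A \<rho> by (intro sum_le_suminf summable_mult summable_geometric) auto
    also have "\<dots> = A / (1 - \<rho>)"
      using \<rho> by (subst suminf_mult) (auto simp: suminf_geometric summable_geometric)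
    finally show ?thesis .
  qed
  have part: "hardy_class (\<lambda>z. \<Sum>k<n. f k z)" "H2_norm (\<lambda>z. \<Sum>k<n. f k z) \<le> A / (1 - \<rho>)" for n
  proof -
    show "hardy_class (\<lambda>z. \<Sum>k<n. f k z)" using hardy_sum[of n f] f by auto
    have "H2_norm (\<lambda>z. \<Sum>k<n. f k z) \<le> (\<Sum>k<n. H2_norm (f k))" using hardy_sum[of n f] f by auto
    also have "\<dots> \<le> (\<Sum>k<n. A * \<rho> ^ k)" by (rule sum_mono) (rule f)
    also have "\<dots> \<le> A / (1 - \<rho>)" by (rule geo)
    finally show "H2_norm (\<lambda>z. \<Sum>k<n. f k z) \<le> A / (1 - \<rho>)" .
  qed
  have "(\<lambda>n. \<Sum>k<n. f k z) \<longlonglongrightarrow> (\<Sum>k. f k z)" if "norm z < 1" for z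
    using sum[OF that] by (rule summable_LIMSEQ)
  from hardy_pointwise_limit[OF part this]
  show "hardy_class (\<lambda>z. \<Sum>k. f k z)" "H2_norm (\<lambda>z. \<Sum>k. f k z) \<le> A / (1 - \<rho>)" by auto
qed

text \<open>
  Invertibility of the weighted composition operator minus \<open>c\<close>, with \<open>M\<close> as a bound for the inverse, in terms of the
  functions on the disk. Values off the disk are ignored, so that this can be handled without
  choosing the representatives that vanish there.
\<close>

definition resolvent_bound :: "(complex \<Rightarrow> complex) \<Rightarrow> (complex \<Rightarrow> complex) \<Rightarrow> complex \<Rightarrow> real \<Rightarrow> bool" where
  "resolvent_bound \<psi> \<phi> c M \<longleftrightarrow> 0 \<le> M \<and>
     (\<forall>f. hardy_class f \<longrightarrow> (\<exists>g. hardy_class g \<and> H2_norm g \<le> M * H2_norm f \<and>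
        (\<forall>z\<in>ball 0 1. \<psi> z * g (\<phi> z) - c * g z = f z))) \<and>
     (\<forall>g. hardy_class g \<longrightarrow> (\<forall>z\<in>ball 0 1. \<psi> z * g (\<phi> z) - c * g z = 0) \<longrightarrow> (\<forall>z\<in>ball 0 1. g z = 0))"

lemma H2_norm_zero_imp:
  assumes "hardy_class g" "H2_norm g \<le> 0" "norm z < 1"
  shows "g z = 0"
proof -
  have "norm (g z) \<le> sqrt (4 / (1 - norm z)) * H2_norm g"
    by (rule hardy_point_evaluation) (use assms in auto)
  also have "\<dots> \<le> 0" using assms by (intro mult_nonneg_nonpos) auto
  finally show ?thesis by simp
qed

definition cut :: "(complex \<Rightarrow> complex) \<Rightarrow> complex \<Rightarrow> complex" where
  "cut f z = (if z \<in> ball 0 1 then f z else 0)"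

lemma cut_hardy: "hardy_class (cut f) \<longleftrightarrow> hardy_class f" "H2_norm (cut f) = H2_norm f"
  by (auto intro!: hardy_class_cong H2_norm_cong simp: cut_def)

lemma cut_in_H2: "hardy_class f \<Longrightarrow> cut f \<in> H2"
  by (simp add: H2_def cut_hardy) (simp add: cut_def)

lemma H2_hardy: "f \<in> H2 \<Longrightarrow> hardy_class f" by (simp add: H2_def)

lemma H2_eqI: "f \<in> H2 \<Longrightarrow> g \<in> H2 \<Longrightarrow> (\<And>z. z \<in> ball 0 1 \<Longrightarrow> f z = g z) \<Longrightarrow> f = g"
  unfolding fun_eq_iff H2_def by (metis (mono_tags, lifting) mem_Collect_eq)

lemma H2_add: "f \<in> H2 \<Longrightarrow> g \<in> H2 \<Longrightarrow> (\<lambda>z. f z + g z) \<in> H2"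
  by (auto simp: H2_def hardy_add)

lemma H2_scale: "f \<in> H2 \<Longrightarrow> (\<lambda>z. c * f z) \<in> H2"
  by (auto simp: H2_def hardy_scale)

locale weighted_selfmap =
  fixes \<psi> \<phi> :: "complex \<Rightarrow> complex"
  assumes \<psi>_disk: "\<psi> \<in> disk_algebra"
    and \<phi>_holo: "\<phi> holomorphic_on ball 0 1"
    and \<phi>_maps: "\<And>z. norm z < 1 \<Longrightarrow> norm (\<phi> z) < 1"
begin

lemma \<psi>_holo: "\<psi> holomorphic_on ball 0 1"
  using \<psi>_disk by (simp add: disk_algebra_def)

lemma operator_bound:
  obtains K where "0 \<le> K"
    "\<And>f. hardy_class f \<Longrightarrow> hardy_class (\<lambda>z. \<psi> z * f (\<phi> z)) \<and> H2_norm (\<lambda>z. \<psi> z * f (\<phi> z)) \<le> K * H2_norm f"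
proof -
  obtain M where M: "0 \<le> M" "\<And>z. norm z \<le> 1 \<Longrightarrow> norm (\<psi> z) \<le> M"
    using disk_algebra_bounded[OF \<psi>_disk] by blast
  let ?E = "sqrt (4 / (1 - norm (\<phi> 0)))"
  have E: "0 \<le> ?E" using \<phi>_maps[of 0] by simp
  have "hardy_class (\<lambda>z. \<psi> z * f (\<phi> z)) \<and> H2_norm (\<lambda>z. \<psi> z * f (\<phi> z)) \<le> (M * ?E) * H2_norm f"
    if f: "hardy_class f" for f
  proof -
    note c = hardy_class_compose[OF f \<phi>_holo \<phi>_maps]
    have "H2_norm (\<lambda>z. \<psi> z * f (\<phi> z)) \<le> M * H2_norm (\<lambda>z. f (\<phi> z))"
      by (rule hardy_bounded_mult(2)[OF c(1) \<psi>_holo]) (use M in auto)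
    also have "\<dots> \<le> M * (?E * H2_norm f)" by (rule mult_left_mono[OF c(2) M(1)])
    finally show ?thesis
      using hardy_bounded_mult(1)[OF c(1) \<psi>_holo, of M] M(2) by (auto simp: mult.assoc)
  qed
  thus ?thesis using M(1) E by (intro that[of "M * ?E"]) auto
qed

lemma operator_hardy: "hardy_class f \<Longrightarrow> hardy_class (\<lambda>z. \<psi> z * f (\<phi> z))"
  by (rule operator_bound) blast

lemma resolvent_bound_imp_invertible:
  assumes "resolvent_bound \<psi> \<phi> c M"
  shows "H2_invertible (\<lambda>f z. weighted_composition \<psi> \<phi> f z - c * f z)"
proof -
  let ?T = "\<lambda>f z. weighted_composition \<psi> \<phi> f z - c * f z"
  have M: "0 \<le> M" using assms by (simp add: resolvent_bound_def)
  have T_cut: "?T f = cut (\<lambda>z. \<psi> z * f (\<phi> z) - c * f z)" if "f \<in> H2" for f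
    using that by (auto simp: weighted_composition_def cut_def H2_def)
  have \<phi>b: "\<phi> z \<in> ball 0 1" if "z \<in> ball 0 1" for z using \<phi>_maps that by auto
  obtain K where K: "0 \<le> K"
    "\<And>f. hardy_class f \<Longrightarrow> hardy_class (\<lambda>z. \<psi> z * f (\<phi> z)) \<and> H2_norm (\<lambda>z. \<psi> z * f (\<phi> z)) \<le> K * H2_norm f"
    using operator_bound by blast
  have T_H2: "?T f \<in> H2" and T_bd: "H2_norm (?T f) \<le> (K + norm c) * H2_norm f" if "f \<in> H2" for f
  proof -
    note h = H2_hardy[OF that]
    note d = hardy_diff[OF conjunct1[OF K(2)[OF h]] hardy_scale(1)[OF h, of c]]
    show "?T f \<in> H2" unfolding T_cut[OF that] by (rule cut_in_H2[OF d(1)])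
    show "H2_norm (?T f) \<le> (K + norm c) * H2_norm f"
      unfolding T_cut[OF that] cut_hardy
      using d(2) K(2)[OF h] hardy_scale(2)[OF h, of c] by (simp add: algebra_simps)
  qed
  have T_op: "H2_bounded_operator ?T"
    unfolding H2_bounded_operator_def
  proof (intro conjI ballI allI exI)
    show "?T f \<in> H2" if "f \<in> H2" for f by (rule T_H2[OF that])
    show "H2_norm (?T f) \<le> (K + norm c) * H2_norm f" if "f \<in> H2" for f by (rule T_bd[OF that])
  qed (auto simp: weighted_composition_def algebra_simps fun_eq_iff)
  have uniq: "f = g" if "f \<in> H2" "g \<in> H2" "?T f = ?T g" for f g
  proof -
    have "\<forall>z\<in>ball 0 1. \<psi> z * (f (\<phi> z) - g (\<phi> z)) - c * (f z - g z) = 0"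
    proof
      fix z :: complex assume "z \<in> ball 0 1"
      thus "\<psi> z * (f (\<phi> z) - g (\<phi> z)) - c * (f z - g z) = 0"
        using fun_cong[OF that(3), of z] by (simp add: weighted_composition_def algebra_simps)
    qed
    hence "\<forall>z\<in>ball 0 1. f z - g z = 0"
      using assms hardy_diff(1)[OF H2_hardy[OF that(1)] H2_hardy[OF that(2)]]
      unfolding resolvent_bound_def by blast
    thus ?thesis by (intro H2_eqI that) auto
  qed
  have ex: "\<exists>g\<in>H2. ?T g = f \<and> H2_norm g \<le> M * H2_norm f" if f: "f \<in> H2" for f
  proof -
    obtain g where g: "hardy_class g" "H2_norm g \<le> M * H2_norm f"
      "\<And>z. z \<in> ball 0 1 \<Longrightarrow> \<psi> z * g (\<phi> z) - c * g z = f z"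
      using assms H2_hardy[OF f] unfolding resolvent_bound_def by blast
    have "?T (cut g) = f"
    proof (rule H2_eqI[OF T_H2[OF cut_in_H2[OF g(1)]] f])
      fix z :: complex assume z: "z \<in> ball 0 1"
      show "?T (cut g) z = f z" using z \<phi>b[OF z] g(3)[OF z] by (simp add: weighted_composition_def cut_def)
    qed
    thus ?thesis using cut_in_H2[OF g(1)] g(2) cut_hardy(2)[of g] by (intro bexI[of _ "cut g"]) auto
  qed
  then obtain S where S: "\<And>f. f \<in> H2 \<Longrightarrow> S f \<in> H2 \<and> ?T (S f) = f \<and> H2_norm (S f) \<le> M * H2_norm f"
    by metis
  have TS: "weighted_composition \<psi> \<phi> (S f) z - c * S f z = f z" if "f \<in> H2" for f z
    using fun_cong[of _ _ z, OF conjunct1[OF conjunct2[OF S[OF that]]]] .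
  have S_op: "H2_bounded_operator S"
    unfolding H2_bounded_operator_def
  proof (intro conjI ballI allI exI)
    show "S f \<in> H2" if "f \<in> H2" for f using S[OF that] by blast
    show "H2_norm (S f) \<le> M * H2_norm f" if "f \<in> H2" for f using S[OF that] by blast
    show "S (\<lambda>z. f z + g z) = (\<lambda>z. S f z + S g z)" if fg: "f \<in> H2" "g \<in> H2" for f g
    proof (rule uniq)
      show "S (\<lambda>z. f z + g z) \<in> H2" using S[OF H2_add[OF fg]] by blast
      show "(\<lambda>z. S f z + S g z) \<in> H2" using S[OF fg(1)] S[OF fg(2)] H2_add by blast
      have "?T (\<lambda>z. S f z + S g z) = (\<lambda>z. ?T (S f) z + ?T (S g) z)"
        by (auto simp: weighted_composition_def algebra_simps fun_eq_iff)
      also have "\<dots> = (\<lambda>z. f z + g z)" by (simp only: TS[OF fg(1)] TS[OF fg(2)])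
      finally show "?T (S (\<lambda>z. f z + g z)) = ?T (\<lambda>z. S f z + S g z)" using S[OF H2_add[OF fg]] by simp
    qed
    show "S (\<lambda>z. d * f z) = (\<lambda>z. d * S f z)" if f: "f \<in> H2" for f d
    proof (rule uniq)
      show "S (\<lambda>z. d * f z) \<in> H2" using S[OF H2_scale[OF f]] by blast
      show "(\<lambda>z. d * S f z) \<in> H2" using S[OF f] H2_scale by blast
      have "?T (\<lambda>z. d * S f z) = (\<lambda>z. d * ?T (S f) z)"
        by (auto simp: weighted_composition_def algebra_simps fun_eq_iff)
      also have "\<dots> = (\<lambda>z. d * f z)" by (simp only: TS[OF f])
      finally show "?T (S (\<lambda>z. d * f z)) = ?T (\<lambda>z. d * S f z)" using S[OF H2_scale[OF f]] by simp
    qed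
  qed
  have ST: "S (?T f) = f" if f: "f \<in> H2" for f
  proof (rule uniq[OF _ f])
    show "S (?T f) \<in> H2" using S[OF T_H2[OF f]] by (rule conjunct1)
    show "?T (S (?T f)) = ?T f" using S[OF T_H2[OF f]] by (rule conjunct1[OF conjunct2])
  qed
  show ?thesis
    unfolding H2_invertible_def
  proof (intro conjI exI[of _ S] ballI T_op S_op)
    fix f assume f: "f \<in> H2"
    show "S (?T f) = f" by (rule ST[OF f])
    show "?T (S f) = f" using S[OF f] by (rule conjunct1[OF conjunct2])
  qed
qed

lemma invertible_imp_resolvent_bound:
  assumes "H2_invertible (\<lambda>f z. weighted_composition \<psi> \<phi> f z - c * f z)"
  shows "\<exists>M. resolvent_bound \<psi> \<phi> c M"
proof -
  let ?T = "\<lambda>f z. weighted_composition \<psi> \<phi> f z - c * f z"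
  obtain S where S: "H2_bounded_operator S" and inv: "\<And>f. f \<in> H2 \<Longrightarrow> S (?T f) = f \<and> ?T (S f) = f"
    using assms unfolding H2_invertible_def by blast
  obtain K where K: "\<And>f. f \<in> H2 \<Longrightarrow> H2_norm (S f) \<le> K * H2_norm f" and SH: "\<And>f. f \<in> H2 \<Longrightarrow> S f \<in> H2"
    and S_scale: "\<And>f c. f \<in> H2 \<Longrightarrow> S (\<lambda>z. c * f z) = (\<lambda>z. c * S f z)"
    using S unfolding H2_bounded_operator_def by blast
  have \<phi>b: "\<phi> z \<in> ball 0 1" if "z \<in> ball 0 1" for z using \<phi>_maps that by auto
  have zH2: "(\<lambda>_. 0) \<in> H2" using hardy_class_const by (simp add: H2_def)
  have S0: "S (\<lambda>_. 0) = (\<lambda>_. 0)" using S_scale[OF zH2, of 0] by simp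
  have "resolvent_bound \<psi> \<phi> c (max K 0)"
    unfolding resolvent_bound_def
  proof (intro conjI allI impI)
    fix f assume f: "hardy_class f"
    let ?g = "S (cut f)"
    have g: "?g \<in> H2" by (rule SH[OF cut_in_H2[OF f]])
    have "H2_norm ?g \<le> K * H2_norm f" using K[OF cut_in_H2[OF f]] by (simp add: cut_hardy)
    also have "\<dots> \<le> max K 0 * H2_norm f" using H2_norm_nonneg[OF f] by (intro mult_right_mono) auto
    finally have n: "H2_norm ?g \<le> max K 0 * H2_norm f" .
    have "\<psi> z * ?g (\<phi> z) - c * ?g z = f z" if z: "z \<in> ball 0 1" for z
    proof -
      have "?T ?g = cut f" using inv[OF cut_in_H2[OF f]] by blast
      from fun_cong[OF this, of z] show ?thesis
        using z by (simp add: weighted_composition_def cut_def)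
    qed
    thus "\<exists>g. hardy_class g \<and> H2_norm g \<le> max K 0 * H2_norm f \<and> (\<forall>z\<in>ball 0 1. \<psi> z * g (\<phi> z) - c * g z = f z)"
      using n H2_hardy[OF g] by blast
  next
    fix g assume g: "hardy_class g" and 0: "\<forall>z\<in>ball 0 1. \<psi> z * g (\<phi> z) - c * g z = 0"
    have "?T (cut g) = (\<lambda>_. 0)"
      using 0 \<phi>b by (auto simp: weighted_composition_def cut_def)
    hence "cut g = (\<lambda>_. 0)" using inv[OF cut_in_H2[OF g]] S0 by simp
    thus "\<forall>z\<in>ball 0 1. g z = 0" by (auto simp: cut_def fun_eq_iff split: if_splits)
  qed simp
  thus ?thesis by blast
qed

text \<open>The resolvent set is open: the perturbation is absorbed by a Neumann series.\<close>

text \<open>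
  The resolvent set is open: with \<open>G\<close> the inverse at \<open>c\<close> and \<open>d = c' - c\<close>, the solution at \<open>c'\<close> is the
  Neumann series with terms \<open>d\<^sup>k G\<^sup>k\<^sup>+\<^sup>1 f\<close>.
\<close>

lemma resolvent_bound_perturb:
  assumes rb: "resolvent_bound \<psi> \<phi> c M" and small: "norm (c' - c) * M < 1"
  shows "\<exists>M'. resolvent_bound \<psi> \<phi> c' M'"
proof -
  define d where "d = c' - c"
  have M: "0 \<le> M" using rb by (simp add: resolvent_bound_def)
  define \<rho> where "\<rho> = norm d * M"
  have \<rho>: "0 \<le> \<rho>" "\<rho> < 1" using M small by (auto simp: \<rho>_def d_def)
  obtain G where G: "\<And>f. hardy_class f \<Longrightarrow> hardy_class (G f) \<and> H2_norm (G f) \<le> M * H2_norm f \<and>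
      (\<forall>z\<in>ball 0 1. \<psi> z * G f (\<phi> z) - c * G f z = f z)"
    using rb unfolding resolvent_bound_def by metis
  have uniq: "\<And>g. hardy_class g \<Longrightarrow> (\<forall>z\<in>ball 0 1. \<psi> z * g (\<phi> z) - c * g z = 0) \<Longrightarrow> (\<forall>z\<in>ball 0 1. g z = 0)"
    using rb unfolding resolvent_bound_def by blast
  have "resolvent_bound \<psi> \<phi> c' (M / (1 - \<rho>))"
    unfolding resolvent_bound_def
  proof (intro conjI allI impI)
    show "0 \<le> M / (1 - \<rho>)" using M \<rho> by simp
    fix f assume f: "hardy_class f"
    define g where "g = (\<lambda>k. (G ^^ Suc k) f)"
    have g: "hardy_class (g k) \<and> H2_norm (g k) \<le> M ^ Suc k * H2_norm f" for k
    proof (induction k)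
      case 0
      thus ?case using G[OF f] by (simp add: g_def)
    next
      case (Suc k)
      have "g (Suc k) = G (g k)" by (simp add: g_def)
      moreover have "M * H2_norm (g k) \<le> M * (M ^ Suc k * H2_norm f)" using Suc M by (intro mult_left_mono) auto
      ultimately show ?case using G[of "g k"] Suc by (auto simp: mult.assoc)
    qed
    define u where "u = (\<lambda>k z. d ^ k * g k z)"
    have u: "hardy_class (u k)" "H2_norm (u k) \<le> (M * H2_norm f) * \<rho> ^ k" for k
    proof -
      show "hardy_class (u k)" unfolding u_def using hardy_scale(1) g by blast
      have "H2_norm (u k) \<le> norm (d ^ k) * H2_norm (g k)" unfolding u_def using hardy_scale(2) g by blast
      also have "\<dots> \<le> norm (d ^ k) * (M ^ Suc k * H2_norm f)" using g by (intro mult_left_mono) auto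
      also have "\<dots> = (M * H2_norm f) * \<rho> ^ k" by (simp add: \<rho>_def norm_power power_mult_distrib)
      finally show "H2_norm (u k) \<le> (M * H2_norm f) * \<rho> ^ k" .
    qed
    have A: "0 \<le> M * H2_norm f" using M H2_norm_nonneg[OF f] by simp
    note ser = hardy_series[of u, OF u A \<rho>]
    define F where "F = (\<lambda>z. \<Sum>k. u k z)"
    have "\<psi> z * F (\<phi> z) - c' * F z = f z" if z: "z \<in> ball 0 1" for z
    proof -
      have s1: "summable (\<lambda>k. u k z)" and s2: "summable (\<lambda>k. u k (\<phi> z))"
        using ser(3) \<phi>_maps z by auto
      have rec: "\<psi> z * u k (\<phi> z) - c * u k z = (if k = 0 then f z else d * u (k - 1) z)" for k
      proof -
        have "\<psi> z * g k (\<phi> z) - c * g k z = (if k = 0 then f z else g (k - 1) z)"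
          using G[OF f] G[of "g (k - 1)"] g z by (cases k) (auto simp: g_def)
        hence "d ^ k * (\<psi> z * g k (\<phi> z) - c * g k z) = d ^ k * (if k = 0 then f z else g (k - 1) z)" by simp
        thus ?thesis by (cases k) (auto simp: u_def algebra_simps)
      qed
      have "(\<lambda>k. \<psi> z * u k (\<phi> z) - c * u k z) sums (\<psi> z * F (\<phi> z) - c * F z)"
        unfolding F_def by (intro sums_diff sums_mult summable_sums s1 s2)
      hence "(\<lambda>k. if k = 0 then f z else d * u (k - 1) z) sums (\<psi> z * F (\<phi> z) - c * F z)"
        by (simp add: rec)
      moreover have "(\<lambda>k. if k = 0 then f z else d * u (k - 1) z) sums (d * F z + f z)"
        using sums_Suc[of "\<lambda>k. if k = 0 then f z else d * u (k - 1) z" "d * F z"]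
          sums_mult[OF summable_sums[OF s1], of d] by (simp add: F_def)
      ultimately have "\<psi> z * F (\<phi> z) - c * F z = d * F z + f z" by (rule sums_unique2)
      thus ?thesis by (simp add: d_def algebra_simps)
    qed
    thus "\<exists>g. hardy_class g \<and> H2_norm g \<le> M / (1 - \<rho>) * H2_norm f \<and> (\<forall>z\<in>ball 0 1. \<psi> z * g (\<phi> z) - c' * g z = f z)"
      using ser(1,2) by (intro exI[of _ F]) (auto simp: F_def)
  next
    fix g assume g: "hardy_class g" and 0: "\<forall>z\<in>ball 0 1. \<psi> z * g (\<phi> z) - c' * g z = 0"
    note dg = hardy_scale[OF g, of d]
    have Gd: "hardy_class (G (\<lambda>z. d * g z))" "H2_norm (G (\<lambda>z. d * g z)) \<le> M * H2_norm (\<lambda>z. d * g z)"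
      "\<And>z. z \<in> ball 0 1 \<Longrightarrow> \<psi> z * G (\<lambda>z. d * g z) (\<phi> z) - c * G (\<lambda>z. d * g z) z = d * g z"
      using G[OF dg(1)] by auto
    have "\<forall>z\<in>ball 0 1. g z - G (\<lambda>z. d * g z) z = 0"
    proof (rule uniq[OF hardy_diff(1)[OF g Gd(1)]], intro ballI)
      fix z :: complex assume z: "z \<in> ball 0 1"
      have "\<psi> z * g (\<phi> z) - c * g z = d * g z" using 0 z by (simp add: d_def algebra_simps)
      thus "\<psi> z * (g (\<phi> z) - G (\<lambda>z. d * g z) (\<phi> z)) - c * (g z - G (\<lambda>z. d * g z) z) = 0"
        using Gd(3)[OF z] by (simp add: algebra_simps)
    qed
    hence "H2_norm g = H2_norm (G (\<lambda>z. d * g z))" by (intro H2_norm_cong) auto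
    also have "\<dots> \<le> M * (norm d * H2_norm g)"
      using Gd(2) dg(2) M by (meson mult_left_mono order_trans)
    also have "\<dots> = \<rho> * H2_norm g" by (simp add: \<rho>_def)
    finally have "(1 - \<rho>) * H2_norm g \<le> 0" by (simp add: algebra_simps)
    hence "H2_norm g \<le> 0" using \<rho> by (simp add: mult_le_0_iff)
    thus "\<forall>z\<in>ball 0 1. g z = 0" using H2_norm_zero_imp[OF g] by auto
  qed
  thus ?thesis by blast
qed

end

lemma zero_on_open_imp_zero:
  assumes X: "X holomorphic_on ball 0 1" and S: "open S" "S \<noteq> {}" "S \<subseteq> ball 0 1"
    and 0: "\<And>z. z \<in> S \<Longrightarrow> X z = 0" and z: "z \<in> ball 0 1"
  shows "X z = 0"
  by (rule analytic_continuation_open[OF S(1) open_ball S(2) connected_ball S(3) X, of "\<lambda>_. 0"])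
     (use 0 z in auto)

lemma open_nonzero_set:
  assumes "f holomorphic_on ball 0 1"
  shows "open {z \<in> ball 0 1. f z \<noteq> 0}"
proof -
  have "open (ball 0 1 \<inter> f -` (- {0}))"
    by (rule continuous_open_preimage[OF holomorphic_on_imp_continuous_on[OF assms]]) auto
  also have "ball 0 1 \<inter> f -` (- {0}) = {z \<in> ball 0 1. f z \<noteq> 0}" by auto
  finally show ?thesis .
qed

lemma holomorphic_mult_eq_0:
  assumes f: "f holomorphic_on ball 0 1" and g: "g holomorphic_on ball 0 1"
    and fg: "\<And>z. z \<in> ball 0 1 \<Longrightarrow> f z * g z = 0"
    and z0: "z0 \<in> ball 0 1" "f z0 \<noteq> 0" and z: "z \<in> ball 0 1"
  shows "g z = 0"
  by (rule zero_on_open_imp_zero[OF g open_nonzero_set[OF f] _ _ _ z]) (use fg z0 in auto)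

lemma blaschke_mult_eq_0:
  assumes a: "norm a < 1" and X: "X holomorphic_on ball 0 1"
    and 0: "\<And>z. z \<in> ball 0 1 \<Longrightarrow> blaschke a z * X z = 0" and z: "z \<in> ball 0 1"
  shows "X z = 0"
proof -
  define z0 :: complex where "z0 = (if a = 0 then 1/2 else 0)"
  have "z0 \<in> ball 0 1" "z0 \<noteq> a" by (auto simp: z0_def)
  thus ?thesis
    using holomorphic_mult_eq_0[OF blaschke_holomorphic[OF a] X 0, of z0] z blaschke_eq_0_iff[OF a, of z0] by auto
qed

locale weighted_rotation =
  fixes a \<mu> :: complex and \<psi> :: "complex \<Rightarrow> complex"
  assumes a: "norm a < 1" and \<mu>: "norm \<mu> = 1" and irr: "\<And>k. 0 < k \<Longrightarrow> \<mu> ^ k \<noteq> 1"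
    and \<psi>: "\<psi> \<in> disk_algebra" and \<psi>_nz: "\<exists>z\<in>ball 0 1. \<psi> z \<noteq> 0"
begin

abbreviation \<phi> :: "complex \<Rightarrow> complex" where "\<phi> \<equiv> rotation_about a \<mu>"
abbreviation b :: "complex \<Rightarrow> complex" where "b \<equiv> blaschke a"

sublocale weighted_selfmap \<psi> \<phi>
  by unfold_locales (use \<psi> rotation_holomorphic[OF a \<mu>] norm_rotation_less[OF a \<mu>] in auto)

lemma \<mu>_nz: "\<mu> \<noteq> 0" using \<mu> by auto

lemma \<phi>_ball: "z \<in> ball 0 1 \<Longrightarrow> \<phi> z \<in> ball 0 1"
  using \<phi>_maps by auto

lemma b_\<phi>: "z \<in> ball 0 1 \<Longrightarrow> b (\<phi> z) = \<mu> * b z"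
  using blaschke_rotation[OF a \<mu>, of z] by auto

lemma compose_\<phi>_holo: "h holomorphic_on ball 0 1 \<Longrightarrow> (\<lambda>z. h (\<phi> z)) holomorphic_on ball 0 1"
  by (rule holomorphic_on_compose_gen[OF \<phi>_holo, unfolded o_def]) (use \<phi>_maps in auto)

text \<open>
  If \<open>h - h a\<close> had a zero of order \<open>n\<close> at \<open>a\<close>, comparison of the leading coefficients in powers of
  \<open>b\<close> on both sides of \<open>h \<circ> \<phi> = h\<close> would give \<open>\<mu>\<^sup>n = 1\<close>.
\<close>

lemma invariant_constant:
  assumes h: "h holomorphic_on ball 0 1" and inv: "\<And>z. z \<in> ball 0 1 \<Longrightarrow> h (\<phi> z) = h z"
    and z: "z \<in> ball 0 1"
  shows "h z = h a"
proof -
  define f where "f = (\<lambda>z. h z - h a)"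
  have f: "f holomorphic_on ball 0 1" unfolding f_def using h by (intro holomorphic_intros)
  have ab: "a \<in> ball 0 1" using a by simp
  show ?thesis
  proof (cases "f constant_on ball 0 1")
    case True
    then obtain y where "\<And>x. x \<in> ball 0 1 \<Longrightarrow> h x - h a = y" unfolding constant_on_def f_def by blast
    from this[OF z] this[OF ab] show ?thesis by simp
  next
    case False
    have fa: "f a = 0" by (simp add: f_def)
    obtain g r n where n: "0 < n" and r: "0 < r" "ball a r \<subseteq> ball 0 1"
      and g: "g holomorphic_on ball a r"
      and fg: "\<And>w. w \<in> ball a r \<Longrightarrow> f w = (w - a) ^ n * g w" and gnz: "\<And>w. w \<in> ball a r \<Longrightarrow> g w \<noteq> 0"
      by (rule holomorphic_factor_zero_nonconstant[OF f open_ball connected_ball ab fa False])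
         (rule that; assumption)
    define G where "G = (\<lambda>w. (1 - cnj a * w) ^ n * g w)"
    have fG: "f w = b w ^ n * G w" if "w \<in> ball a r" for w
    proof -
      have "1 - cnj a * w \<noteq> 0" using blaschke_denom_nonzero[OF a, of w] r that by auto
      thus ?thesis by (simp add: fg[OF that] G_def blaschke_def power_divide)
    qed
    have ar: "a \<in> ball a r" using r by simp
    have Ga: "G a \<noteq> 0"
      using gnz[OF ar] blaschke_denom_nonzero[OF a, of a] a by (simp add: G_def)
    have Gc: "isCont G a"
    proof -
      have "continuous_on (ball a r) G"
        unfolding G_def by (intro continuous_intros holomorphic_on_imp_continuous_on[OF g])
      thus ?thesis using ar by (simp add: continuous_on_eq_continuous_at)
    qed
    have \<phi>c: "isCont \<phi> a"
      using holomorphic_on_imp_continuous_on[OF \<phi>_holo] ab by (simp add: continuous_on_eq_continuous_at)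
    have \<phi>a: "\<phi> a = a" by (rule rotation_fixes[OF a \<mu>])
    have \<phi>lim: "(\<phi> \<longlongrightarrow> a) (at a)" using \<phi>c \<phi>a by (simp add: isCont_def)
    have ev: "\<forall>\<^sub>F w in at a. \<mu> ^ n * G (\<phi> w) = G w"
    proof -
      have "\<forall>\<^sub>F w in at a. \<phi> w \<in> ball a r"
        by (rule topological_tendstoD[OF \<phi>lim]) (use ar in auto)
      moreover have "\<forall>\<^sub>F w in at a. w \<in> ball a r - {a}"
        by (rule eventually_at_in_open) (use ar in auto)
      ultimately show ?thesis
      proof eventually_elim
        case (elim w)
        have w1: "w \<in> ball 0 1" using elim r by auto
        have "f (\<phi> w) = f w" using inv[OF w1] by (simp add: f_def)
        hence "b (\<phi> w) ^ n * G (\<phi> w) = b w ^ n * G w" using fG elim by auto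
        hence "b w ^ n * (\<mu> ^ n * G (\<phi> w)) = b w ^ n * G w"
          by (simp add: b_\<phi>[OF w1] power_mult_distrib mult_ac)
        moreover have "b w \<noteq> 0" using blaschke_eq_0_iff[OF a, of w] w1 elim by auto
        ultimately show ?case by simp
      qed
    qed
    have "((\<lambda>w. G (\<phi> w)) \<longlongrightarrow> G a) (at a)"
      by (rule isCont_tendsto_compose[OF Gc \<phi>lim])
    hence "((\<lambda>w. \<mu> ^ n * G (\<phi> w)) \<longlongrightarrow> \<mu> ^ n * G a) (at a)" by (intro tendsto_intros)
    hence "(G \<longlongrightarrow> \<mu> ^ n * G a) (at a)" by (rule Lim_transform_eventually[OF _ ev])
    moreover have "(G \<longlongrightarrow> G a) (at a)" using Gc by (simp add: isCont_def)
    ultimately have "\<mu> ^ n * G a = G a" by (rule tendsto_unique[OF at_neq_bot])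
    hence "\<mu> ^ n = 1" using Ga by simp
    with irr[OF n] show ?thesis by simp
  qed
qed

text \<open>
  With \<open>T\<close> the operator, \<open>(T - c) (b g) = \<mu> b (T - c / \<mu>) g\<close>. To solve \<open>(T - c / \<mu>) g = f\<close>, solve
  \<open>(T - c) h = \<mu> b f\<close> and divide \<open>h\<close> by \<open>b\<close>. The division is possible because both sides vanish at \<open>a\<close>,
  and \<open>\<psi> a \<noteq> c\<close> because the constant \<open>1\<close> lies in the range of \<open>T - c\<close>. As \<open>b\<close> acts isometrically, the
  bound does not change.
\<close>

lemma resolvent_bound_rotate:
  assumes rb: "resolvent_bound \<psi> \<phi> c M"
  shows "resolvent_bound \<psi> \<phi> (c / \<mu>) M"
proof -
  have M: "0 \<le> M" using rb by (simp add: resolvent_bound_def)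
  have solve: "\<And>f. hardy_class f \<Longrightarrow> \<exists>g. hardy_class g \<and> H2_norm g \<le> M * H2_norm f \<and>
      (\<forall>z\<in>ball 0 1. \<psi> z * g (\<phi> z) - c * g z = f z)"
    using rb unfolding resolvent_bound_def by blast
  have uniq: "\<And>g. hardy_class g \<Longrightarrow> (\<forall>z\<in>ball 0 1. \<psi> z * g (\<phi> z) - c * g z = 0) \<Longrightarrow> (\<forall>z\<in>ball 0 1. g z = 0)"
    using rb unfolding resolvent_bound_def by blast
  have ab: "a \<in> ball 0 1" using a by simp
  have \<phi>a: "\<phi> a = a" by (rule rotation_fixes[OF a \<mu>])
  have nc: "\<psi> a \<noteq> c"
  proof -
    obtain g where "\<And>z. z \<in> ball 0 1 \<Longrightarrow> \<psi> z * g (\<phi> z) - c * g z = 1"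
      using solve[OF hardy_class_const[of 1]] by blast
    from this[OF ab] show ?thesis by (auto simp: \<phi>a)
  qed
  show ?thesis
    unfolding resolvent_bound_def
  proof (intro conjI allI impI)
    show "0 \<le> M" by (rule M)
    fix f assume f: "hardy_class f"
    note bf = hardy_blaschke_mult[OF a f]
    define f' where "f' = (\<lambda>z. \<mu> * (b z * f z))"
    have f': "hardy_class f'" "H2_norm f' \<le> H2_norm f"
      unfolding f'_def using hardy_scale[OF bf(1), of \<mu>] bf(2) \<mu> by auto
    obtain h where h: "hardy_class h" "H2_norm h \<le> M * H2_norm f'"
      and eq: "\<And>z. z \<in> ball 0 1 \<Longrightarrow> \<psi> z * h (\<phi> z) - c * h z = f' z"
      using solve[OF f'(1)] by blast
    have "(\<psi> a - c) * h a = 0"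
      using eq[OF ab] by (simp add: \<phi>a f'_def blaschke_def algebra_simps)
    hence ha: "h a = 0" using nc by simp
    obtain g where g: "hardy_class g" "H2_norm g \<le> H2_norm h" and hg: "\<And>z. norm z < 1 \<Longrightarrow> h z = b z * g z"
      using hardy_blaschke_divide[OF a h(1) ha] by blast
    have gh: "g holomorphic_on ball 0 1" "f holomorphic_on ball 0 1" using g f hardy_class_holo by auto
    have "\<psi> z * g (\<phi> z) - c / \<mu> * g z - f z = 0" if z: "z \<in> ball 0 1" for z
    proof (rule blaschke_mult_eq_0[OF a _ _ z])
      show "(\<lambda>z. \<psi> z * g (\<phi> z) - c / \<mu> * g z - f z) holomorphic_on ball 0 1"
        using \<psi>_holo gh compose_\<phi>_holo by (intro holomorphic_intros) auto
      fix w :: complex assume w: "w \<in> ball 0 1"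
      have "\<psi> w * (\<mu> * b w * g (\<phi> w)) - c * (b w * g w) = \<mu> * (b w * f w)"
        using eq[OF w] hg[of w] hg[of "\<phi> w"] \<phi>_ball[OF w] w b_\<phi>[OF w] by (simp add: f'_def)
      hence "\<mu> * (b w * (\<psi> w * g (\<phi> w) - c / \<mu> * g w - f w)) = 0"
        using \<mu>_nz by (simp add: algebra_simps)
      thus "b w * (\<psi> w * g (\<phi> w) - c / \<mu> * g w - f w) = 0" using \<mu>_nz by simp
    qed
    moreover have "H2_norm g \<le> M * H2_norm f"
      using g(2) h(2) mult_left_mono[OF f'(2) M] by linarith
    ultimately show "\<exists>g. hardy_class g \<and> H2_norm g \<le> M * H2_norm f \<and>
        (\<forall>z\<in>ball 0 1. \<psi> z * g (\<phi> z) - c / \<mu> * g z = f z)"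
      using g(1) by (intro exI[of _ g]) auto
  next
    fix g assume g: "hardy_class g" and 0: "\<forall>z\<in>ball 0 1. \<psi> z * g (\<phi> z) - c / \<mu> * g z = 0"
    have "\<forall>z\<in>ball 0 1. b z * g z = 0"
    proof (rule uniq[OF hardy_blaschke_mult(1)[OF a g]], intro ballI)
      fix z :: complex assume z: "z \<in> ball 0 1"
      have "\<psi> z * (b (\<phi> z) * g (\<phi> z)) - c * (b z * g z) = \<mu> * b z * (\<psi> z * g (\<phi> z) - c / \<mu> * g z)"
        using \<mu>_nz by (simp add: b_\<phi>[OF z] algebra_simps)
      thus "\<psi> z * (b (\<phi> z) * g (\<phi> z)) - c * (b z * g z) = 0" using 0 z by simp
    qed
    thus "\<forall>z\<in>ball 0 1. g z = 0" using blaschke_mult_eq_0[OF a hardy_class_holo[OF g]] by blast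
  qed
qed

lemma hardy_rotation:
  assumes f: "hardy_class f" and \<nu>: "norm \<nu> = 1"
  shows "hardy_class (\<lambda>z. f (rotation_about a \<nu> z))"
    "H2_norm (\<lambda>z. f (rotation_about a \<nu> z)) \<le> 4 / (1 - norm a) * H2_norm f"
proof -
  let ?E = "sqrt (4 / (1 - norm a))"
  have a': "norm (- a) < 1" using a by simp
  note c1 = hardy_class_compose[OF f blaschke_holomorphic[OF a'] norm_blaschke_less[OF a']]
  have h: "(\<lambda>z. \<nu> * b z) holomorphic_on ball 0 1"
    by (intro holomorphic_intros blaschke_holomorphic[OF a])
  have m: "norm (\<nu> * b z) < 1" if "norm z < 1" for z
    using norm_blaschke_less[OF a that] \<nu> by (simp add: norm_mult)
  note c2 = hardy_class_compose[OF c1(1) h m]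
  show "hardy_class (\<lambda>z. f (rotation_about a \<nu> z))" using c2(1) by (simp add: rotation_about_def)
  have "H2_norm (\<lambda>z. f (rotation_about a \<nu> z)) \<le> ?E * H2_norm (\<lambda>z. f (blaschke (- a) z))"
    using c2(2) \<nu> by (simp add: rotation_about_def blaschke_def norm_mult)
  also have "\<dots> \<le> ?E * (?E * H2_norm f)"
    using c1(2) a by (intro mult_left_mono) (auto simp: blaschke_def)
  also have "\<dots> = 4 / (1 - norm a) * H2_norm f"
    using a by (simp flip: mult.assoc)
  finally show "H2_norm (\<lambda>z. f (rotation_about a \<nu> z)) \<le> 4 / (1 - norm a) * H2_norm f" .
qed

lemma orbit_product_Suc:
  assumes "z \<in> ball 0 1"
  shows "orbit_product \<psi> a \<mu> (Suc n) z = \<psi> z * orbit_product \<psi> a \<mu> n (\<phi> z)"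
proof -
  have "rotation_about a (\<mu> ^ j) (\<phi> z) = rotation_about a (\<mu> ^ Suc j) z" for j
    using rotation_rotation[OF a \<mu>, of z "\<mu> ^ j"] assms by (simp add: mult.commute)
  thus ?thesis
    using rotation_one[OF a, of z] assms
    by (simp add: orbit_product_def prod.lessThan_Suc_shift del: prod.lessThan_Suc power_Suc)
qed

text \<open>
  The solution is the Neumann series with terms \<open>- T\<^sup>n f / c\<^sup>n\<^sup>+\<^sup>1\<close>, which converges geometrically
  because compositions with the iterates of \<open>\<phi>\<close> are uniformly bounded.
\<close>

lemma resolvent_bound_outside:
  assumes C: "0 \<le> C" and P: "\<And>n z. norm z < 1 \<Longrightarrow> norm (orbit_product \<psi> a \<mu> n z) \<le> C * q ^ n"
    and q: "0 \<le> q" "q < norm c"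
  shows "\<exists>M. resolvent_bound \<psi> \<phi> c M"
proof -
  let ?P = "orbit_product \<psi> a \<mu>" and ?R = "\<lambda>n. rotation_about a (\<mu> ^ n)"
  define K where "K = 4 / (1 - norm a)"
  have K: "0 \<le> K" using a by (simp add: K_def)
  have c0: "c \<noteq> 0" "0 < norm c" using q by auto
  define \<rho> where "\<rho> = q / norm c"
  have \<rho>: "0 \<le> \<rho>" "\<rho> < 1" using q c0 by (auto simp: \<rho>_def)
  have Tn: "hardy_class (\<lambda>z. ?P n z * f (?R n z)) \<and>
      H2_norm (\<lambda>z. ?P n z * f (?R n z)) \<le> C * q ^ n * (K * H2_norm f)" if f: "hardy_class f" for f n
  proof -
    note r = hardy_rotation[OF f norm_power_unit[OF \<mu>], of n]
    note m = hardy_bounded_mult[OF r(1) hardy_class_holo[OF orbit_product_regular(2)[OF a \<mu> \<psi>]] P, of n]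
    have "H2_norm (\<lambda>z. ?P n z * f (?R n z)) \<le> C * q ^ n * H2_norm (\<lambda>z. f (?R n z))" by (rule m(2))
    also have "\<dots> \<le> C * q ^ n * (K * H2_norm f)"
      using r(2) C q by (intro mult_left_mono) (auto simp: K_def)
    finally show ?thesis using m(1) by blast
  qed
  have R_Suc: "?R n (\<phi> z) = ?R (Suc n) z" if "z \<in> ball 0 1" for n z
    using rotation_rotation[OF a \<mu>, of z "\<mu> ^ n"] that by (simp add: mult.commute)
  have "resolvent_bound \<psi> \<phi> c (C * K / norm c / (1 - \<rho>))"
    unfolding resolvent_bound_def
  proof (intro conjI allI impI)
    show "0 \<le> C * K / norm c / (1 - \<rho>)" using C K \<rho> by simp
    fix f assume f: "hardy_class f"
    define u where "u = (\<lambda>n z. (- 1 / c ^ Suc n) * (?P n z * f (?R n z)))"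
    have u: "hardy_class (u n)" "H2_norm (u n) \<le> (C * K / norm c * H2_norm f) * \<rho> ^ n" for n
    proof -
      note t = Tn[OF f, of n]
      show "hardy_class (u n)" unfolding u_def using hardy_scale(1) t by blast
      have "H2_norm (u n) \<le> norm (- 1 / c ^ Suc n) * H2_norm (\<lambda>z. ?P n z * f (?R n z))"
        unfolding u_def using hardy_scale(2) t by blast
      also have "\<dots> \<le> norm (- 1 / c ^ Suc n) * (C * q ^ n * (K * H2_norm f))"
        using t by (intro mult_left_mono) auto
      also have "\<dots> = (C * K / norm c * H2_norm f) * \<rho> ^ n"
        using c0 by (simp add: norm_divide norm_mult norm_power \<rho>_def power_divide)
      finally show "H2_norm (u n) \<le> (C * K / norm c * H2_norm f) * \<rho> ^ n" .
    qed
    have A: "0 \<le> C * K / norm c * H2_norm f" using C K H2_norm_nonneg[OF f] by simp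
    note ser = hardy_series[of u, OF u A \<rho>]
    define F where "F = (\<lambda>z. \<Sum>n. u n z)"
    have "\<psi> z * F (\<phi> z) - c * F z = f z" if z: "z \<in> ball 0 1" for z
    proof -
      have s1: "summable (\<lambda>n. u n z)" and s2: "summable (\<lambda>n. u n (\<phi> z))"
        using ser(3) \<phi>_maps z by auto
      have rec: "\<psi> z * u n (\<phi> z) = c * u (Suc n) z" for n
        using c0 by (simp add: u_def orbit_product_Suc[OF z] R_Suc[OF z] del: power_Suc)
          (simp add: field_simps)
      have "(\<lambda>n. \<psi> z * u n (\<phi> z)) sums (\<psi> z * F (\<phi> z))"
        unfolding F_def by (intro sums_mult summable_sums s2)
      hence "(\<lambda>n. c * u (Suc n) z) sums (\<psi> z * F (\<phi> z))" by (simp only: rec)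
      hence "(\<lambda>n. c * u n z) sums (\<psi> z * F (\<phi> z) + c * u 0 z)"
        using sums_Suc[of "\<lambda>n. c * u n z"] by simp
      moreover have "(\<lambda>n. c * u n z) sums (c * F z)"
        unfolding F_def by (intro sums_mult summable_sums s1)
      ultimately have "\<psi> z * F (\<phi> z) + c * u 0 z = c * F z" by (rule sums_unique2)
      moreover have "c * u 0 z = - f z"
        using c0 rotation_one[OF a, of z] z by (simp add: u_def orbit_product_def)
      ultimately show ?thesis by (simp add: algebra_simps)
    qed
    thus "\<exists>g. hardy_class g \<and> H2_norm g \<le> C * K / norm c / (1 - \<rho>) * H2_norm f \<and>
        (\<forall>z\<in>ball 0 1. \<psi> z * g (\<phi> z) - c * g z = f z)"
      using ser(1,2) by (intro exI[of _ F]) (auto simp: F_def)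
  next
    fix g assume g: "hardy_class g" and 0: "\<forall>z\<in>ball 0 1. \<psi> z * g (\<phi> z) - c * g z = 0"
    have it: "?P n z * g (?R n z) = c ^ n * g z" if "z \<in> ball 0 1" for n z
      using that
    proof (induction n arbitrary: z)
      case 0
      thus ?case using rotation_one[OF a, of z] by (simp add: orbit_product_def)
    next
      case (Suc n)
      have "?P (Suc n) z * g (?R (Suc n) z) = \<psi> z * (?P n (\<phi> z) * g (?R n (\<phi> z)))"
        by (simp add: orbit_product_Suc[OF Suc.prems] R_Suc[OF Suc.prems] del: power_Suc)
      also have "\<dots> = c ^ n * (\<psi> z * g (\<phi> z))"
        using Suc.IH[OF \<phi>_ball[OF Suc.prems]] by simp
      also have "\<psi> z * g (\<phi> z) = c * g z" using 0 Suc.prems by simp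
      finally show ?case by simp
    qed
    have n: "norm c ^ n * H2_norm g \<le> C * q ^ n * (K * H2_norm g)" for n
    proof -
      have e: "(\<lambda>z. 1 / c ^ n * (?P n z * g (?R n z))) z = g z" if "z \<in> ball 0 1" for z
        using it[OF that, of n] c0 by simp
      have "H2_norm g = H2_norm (\<lambda>z. 1 / c ^ n * (?P n z * g (?R n z)))"
        by (rule H2_norm_cong) (use e in auto)
      also have "\<dots> \<le> norm (1 / c ^ n) * H2_norm (\<lambda>z. ?P n z * g (?R n z))"
        using hardy_scale(2) Tn[OF g] by blast
      also have "\<dots> \<le> norm (1 / c ^ n) * (C * q ^ n * (K * H2_norm g))"
        using Tn[OF g] by (intro mult_left_mono) auto
      finally show ?thesis using c0 by (simp add: norm_divide norm_power field_simps)
    qed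
    have "H2_norm g \<le> (C * K * H2_norm g) * \<rho> ^ n" for n
      using n[of n] c0 by (simp add: \<rho>_def power_divide field_simps)
    moreover have "(\<lambda>n. (C * K * H2_norm g) * \<rho> ^ n) \<longlonglongrightarrow> (C * K * H2_norm g) * 0"
      by (intro tendsto_mult tendsto_const LIMSEQ_realpow_zero \<rho>)
    ultimately have "H2_norm g \<le> (C * K * H2_norm g) * 0"
      by (intro LIMSEQ_le_const[of "\<lambda>n. (C * K * H2_norm g) * \<rho> ^ n"]) auto
    thus "\<forall>z\<in>ball 0 1. g z = 0" using H2_norm_zero_imp[OF g] by auto
  qed
  thus ?thesis by blast
qed

end

section \<open>Averages of resolvents along an orbit\<close>

lemma hardy_average:
  fixes g :: "nat \<Rightarrow> complex \<Rightarrow> complex"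
  assumes g: "\<And>k. hardy_class (g k)" "\<And>k. H2_norm (g k) \<le> B" and B: "0 \<le> B"
  shows "hardy_class (\<lambda>z. 1 / of_nat N * (\<Sum>k<N. g k z))"
    "H2_norm (\<lambda>z. 1 / of_nat N * (\<Sum>k<N. g k z)) \<le> B"
proof -
  note s = hardy_sum[of N g, OF g(1)]
  note h = hardy_scale[OF conjunct1[OF s], of "1 / of_nat N"]
  show "hardy_class (\<lambda>z. 1 / of_nat N * (\<Sum>k<N. g k z))" by (rule h(1))
  have "H2_norm (\<lambda>z. 1 / of_nat N * (\<Sum>k<N. g k z)) \<le> 1 / real N * (\<Sum>k<N. H2_norm (g k))"
    using order_trans[OF h(2) mult_left_mono[OF conjunct2[OF s]]] by (simp add: norm_divide)
  also have "\<dots> \<le> 1 / real N * (\<Sum>k<N. B)"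
    by (intro mult_left_mono sum_mono g) auto
  also have "\<dots> \<le> B" using B by simp
  finally show "H2_norm (\<lambda>z. 1 / of_nat N * (\<Sum>k<N. g k z)) \<le> B" .
qed

text \<open>
  In this locale \<open>c\<close> lies in the resolvent set. The inverses of \<open>T - \<zeta> k\<close>, where the points
  \<open>\<zeta> k = c / \<mu>\<^sup>k\<close> run through a dense orbit on the circle of radius \<open>|c|\<close>, are averaged over \<open>k\<close>. Such an
  average replaces a contour integral of the resolvent around that circle.
\<close>

locale orbit_resolvents = weighted_rotation +
  fixes c :: complex and M :: real
  assumes rb: "resolvent_bound \<psi> \<phi> c M" and c: "c \<noteq> 0"
begin

lemma M_nonneg: "0 \<le> M" using rb by (simp add: resolvent_bound_def)

definition \<zeta> :: "nat \<Rightarrow> complex" where "\<zeta> k = c / \<mu> ^ k"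

lemma \<zeta>_Suc: "\<zeta> k = \<mu> * \<zeta> (Suc k)" and norm_\<zeta>: "norm (\<zeta> k) = norm c"
  using \<mu>_nz \<mu> by (auto simp: \<zeta>_def norm_divide norm_power)

lemma resolvent_bound_\<zeta>: "resolvent_bound \<psi> \<phi> (\<zeta> k) M" for k
proof (induction k)
  case (Suc k)
  have "\<zeta> (Suc k) = \<zeta> k / \<mu>" using \<zeta>_Suc[of k] \<mu>_nz by simp
  thus ?case using resolvent_bound_rotate[OF Suc] by simp
qed (use rb in \<open>simp add: \<zeta>_def\<close>)

definition resolvent :: "nat \<Rightarrow> (complex \<Rightarrow> complex) \<Rightarrow> complex \<Rightarrow> complex" where
  "resolvent k f = (SOME g. hardy_class g \<and> H2_norm g \<le> M * H2_norm f \<and>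
    (\<forall>z\<in>ball 0 1. \<psi> z * g (\<phi> z) - \<zeta> k * g z = f z))"

lemma resolvent_all: "hardy_class (resolvent k f) \<and> H2_norm (resolvent k f) \<le> M * H2_norm f \<and>
    (\<forall>z\<in>ball 0 1. \<psi> z * resolvent k f (\<phi> z) - \<zeta> k * resolvent k f z = f z)" if "hardy_class f" for k f
proof -
  have "\<exists>g. hardy_class g \<and> H2_norm g \<le> M * H2_norm f \<and>
    (\<forall>z\<in>ball 0 1. \<psi> z * g (\<phi> z) - \<zeta> k * g z = f z)"
    using resolvent_bound_\<zeta>[of k] that unfolding resolvent_bound_def by blast
  from someI_ex[OF this] show ?thesis unfolding resolvent_def .
qed

lemma resolvent_hardy: "hardy_class (resolvent k f)" and resolvent_norm: "H2_norm (resolvent k f) \<le> M * H2_norm f" if "hardy_class f" for k f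
  using resolvent_all[OF that] by blast+

lemma resolvent_eq: "\<psi> z * resolvent k f (\<phi> z) = f z + \<zeta> k * resolvent k f z" if "hardy_class f" "z \<in> ball 0 1" for k f z
proof -
  have "\<psi> z * resolvent k f (\<phi> z) - \<zeta> k * resolvent k f z = f z" using resolvent_all[OF that(1)] that(2) by blast
  thus ?thesis by (simp add: algebra_simps)
qed

lemma resolvent_unique: "g z = resolvent k f z"
  if f: "hardy_class f" and g: "hardy_class g"
    and eq: "\<And>z. z \<in> ball 0 1 \<Longrightarrow> \<psi> z * g (\<phi> z) - \<zeta> k * g z = f z" and z: "z \<in> ball 0 1" for k f g z
proof -
  have "\<forall>z\<in>ball 0 1. \<psi> z * (g (\<phi> z) - resolvent k f (\<phi> z)) - \<zeta> k * (g z - resolvent k f z) = 0"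
  proof
    fix w :: complex assume w: "w \<in> ball 0 1"
    show "\<psi> w * (g (\<phi> w) - resolvent k f (\<phi> w)) - \<zeta> k * (g w - resolvent k f w) = 0"
      using eq[OF w] resolvent_eq[OF f w, of k] by (simp add: algebra_simps)
  qed
  hence "\<forall>z\<in>ball 0 1. g z - resolvent k f z = 0"
    using resolvent_bound_\<zeta>[of k] hardy_diff(1)[OF g resolvent_hardy[OF f]] unfolding resolvent_bound_def by blast
  thus ?thesis using z by auto
qed

lemma resolvent_linear: "\<alpha> * resolvent k f z + resolvent k f' z = resolvent k (\<lambda>z. \<alpha> * f z + f' z) z"
  if f: "hardy_class f" "hardy_class f'" and z: "z \<in> ball 0 1" for k f f' \<alpha> z
proof (rule resolvent_unique[OF _ _ _ z, where g = "\<lambda>z. \<alpha> * resolvent k f z + resolvent k f' z"])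
  show "hardy_class (\<lambda>z. \<alpha> * f z + f' z)" by (intro hardy_add(1) hardy_scale(1) f)
  show "hardy_class (\<lambda>z. \<alpha> * resolvent k f z + resolvent k f' z)" by (intro hardy_add(1) hardy_scale(1) resolvent_hardy f)
  fix w :: complex assume w: "w \<in> ball 0 1"
  have "\<psi> w * (\<alpha> * resolvent k f (\<phi> w) + resolvent k f' (\<phi> w))
      = \<alpha> * (\<psi> w * resolvent k f (\<phi> w)) + \<psi> w * resolvent k f' (\<phi> w)" by (simp add: algebra_simps)
  thus "\<psi> w * (\<alpha> * resolvent k f (\<phi> w) + resolvent k f' (\<phi> w)) - \<zeta> k * (\<alpha> * resolvent k f w + resolvent k f' w) = \<alpha> * f w + f' w"
    using resolvent_eq[OF f(1) w] resolvent_eq[OF f(2) w] by (simp add: algebra_simps)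
qed

lemma resolvent_blaschke: "b z * resolvent (Suc k) f z / \<mu> = resolvent k (\<lambda>z. b z * f z) z" if f: "hardy_class f" and z: "z \<in> ball 0 1" for k f z
proof (rule resolvent_unique[OF _ _ _ z, where g = "\<lambda>z. b z * resolvent (Suc k) f z / \<mu>"])
  show "hardy_class (\<lambda>z. b z * f z)" by (rule hardy_blaschke_mult(1)[OF a f])
  show "hardy_class (\<lambda>z. b z * resolvent (Suc k) f z / \<mu>)"
    using hardy_scale(1)[OF hardy_blaschke_mult(1)[OF a resolvent_hardy[OF f]], of "1 / \<mu>"] by simp
  fix w :: complex assume w: "w \<in> ball 0 1"
  have "\<psi> w * (b (\<phi> w) * resolvent (Suc k) f (\<phi> w) / \<mu>) = b w * (\<psi> w * resolvent (Suc k) f (\<phi> w))"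
    using \<mu>_nz by (simp add: b_\<phi>[OF w])
  thus "\<psi> w * (b (\<phi> w) * resolvent (Suc k) f (\<phi> w) / \<mu>) - \<zeta> k * (b w * resolvent (Suc k) f w / \<mu>) = b w * f w"
    using resolvent_eq[OF f w] \<zeta>_Suc[of k] \<mu>_nz by (simp add: algebra_simps)
qed

lemma resolvent_commute: "\<psi> z * resolvent k f (\<phi> z) = resolvent k (\<lambda>z. \<psi> z * f (\<phi> z)) z" if f: "hardy_class f" and z: "z \<in> ball 0 1" for k f z
proof (rule resolvent_unique[OF _ _ _ z, where g = "\<lambda>z. \<psi> z * resolvent k f (\<phi> z)"])
  fix w :: complex assume w: "w \<in> ball 0 1"
  show "\<psi> w * (\<psi> (\<phi> w) * resolvent k f (\<phi> (\<phi> w))) - \<zeta> k * (\<psi> w * resolvent k f (\<phi> w)) = \<psi> w * f (\<phi> w)"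
    using resolvent_eq[OF f \<phi>_ball[OF w]] by (simp add: algebra_simps)
qed (intro operator_hardy resolvent_hardy f)+

definition average :: "nat \<Rightarrow> (complex \<Rightarrow> complex) \<Rightarrow> complex \<Rightarrow> complex" where
  "average N f z = 1 / of_nat N * (\<Sum>k<N. \<zeta> k * resolvent k f z)"

lemma average_hardy: "hardy_class (average N f)" "H2_norm (average N f) \<le> norm c * M * H2_norm f" if f: "hardy_class f" for N f
proof -
  have n: "H2_norm (\<lambda>z. \<zeta> k * resolvent k f z) \<le> norm c * M * H2_norm f" for k
  proof -
    have "H2_norm (\<lambda>z. \<zeta> k * resolvent k f z) \<le> norm (\<zeta> k) * H2_norm (resolvent k f)" by (rule hardy_scale(2)[OF resolvent_hardy[OF f]])
    also have "\<dots> \<le> norm c * (M * H2_norm f)"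
      unfolding norm_\<zeta> using resolvent_norm[OF f] by (intro mult_left_mono) auto
    finally show ?thesis by (simp add: mult.assoc)
  qed
  have B: "0 \<le> norm c * M * H2_norm f" using M_nonneg H2_norm_nonneg[OF f] by simp
  show "hardy_class (average N f)" "H2_norm (average N f) \<le> norm c * M * H2_norm f"
    unfolding average_def[abs_def] using hardy_average[OF hardy_scale(1)[OF resolvent_hardy[OF f]] n B] by auto
qed

lemma average_linear: "average N (\<lambda>z. \<alpha> * f z + f' z) z = \<alpha> * average N f z + average N f' z"
  if f: "hardy_class f" "hardy_class f'" and z: "z \<in> ball 0 1" for N f f' \<alpha> z
proof -
  have "(\<Sum>k<N. \<zeta> k * resolvent k (\<lambda>z. \<alpha> * f z + f' z) z) = (\<Sum>k<N. \<alpha> * (\<zeta> k * resolvent k f z) + \<zeta> k * resolvent k f' z)"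
    by (intro sum.cong refl) (simp only: resolvent_linear[OF f z, symmetric]; simp add: algebra_simps)
  also have "\<dots> = \<alpha> * (\<Sum>k<N. \<zeta> k * resolvent k f z) + (\<Sum>k<N. \<zeta> k * resolvent k f' z)"
    by (simp add: sum.distrib sum_distrib_left)
  finally show ?thesis by (simp add: average_def algebra_simps add_divide_distrib)
qed

text \<open>
  Multiplication by \<open>b\<close> shifts the orbit by one step, which changes an average of \<open>N\<close> bounded terms
  by \<open>O(1 / N)\<close>.
\<close>

lemma average_blaschke: "(\<lambda>N. average N (\<lambda>z. b z * f z) z - b z * average N f z) \<longlonglongrightarrow> 0"
  if f: "hardy_class f" and z: "z \<in> ball 0 1" for f z
proof -
  define B where "B = sqrt (4 / (1 - norm z)) * (M * H2_norm f)"
  have GB: "norm (resolvent k f z) \<le> B" for k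
  proof -
    have "norm (resolvent k f z) \<le> sqrt (4 / (1 - norm z)) * H2_norm (resolvent k f)"
      by (rule hardy_point_evaluation[OF resolvent_hardy[OF f]]) (use z in auto)
    also have "\<dots> \<le> B" unfolding B_def using resolvent_norm[OF f] z by (intro mult_left_mono) auto
    finally show ?thesis .
  qed
  have "average N (\<lambda>z. b z * f z) z - b z * average N f z = b z / of_nat N * (\<zeta> N * resolvent N f z - \<zeta> 0 * resolvent 0 f z)" for N
  proof -
    have t: "\<zeta> k * resolvent k (\<lambda>z. b z * f z) z = b z * (\<zeta> (Suc k) * resolvent (Suc k) f z)" for k
      using \<mu>_nz by (simp add: resolvent_blaschke[OF f z, symmetric] \<zeta>_Suc[of k])
    have "average N (\<lambda>z. b z * f z) z - b z * average N f z
        = b z / of_nat N * (\<Sum>k<N. \<zeta> (Suc k) * resolvent (Suc k) f z - \<zeta> k * resolvent k f z)"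
      by (simp add: average_def t sum_distrib_left[symmetric] sum_subtractf) (simp add: algebra_simps diff_divide_distrib)
    thus ?thesis by (simp only: sum_lessThan_telescope[of "\<lambda>k. \<zeta> k * resolvent k f z" N])
  qed
  moreover have "norm (b z / of_nat N * (\<zeta> N * resolvent N f z - \<zeta> 0 * resolvent 0 f z)) \<le> (2 * norm c * B) / real N" for N
  proof -
    have "norm (\<zeta> k * resolvent k f z) \<le> norm c * B" for k
      unfolding norm_mult norm_\<zeta> using GB by (intro mult_left_mono) auto
    hence "norm (\<zeta> N * resolvent N f z - \<zeta> 0 * resolvent 0 f z) \<le> norm c * B + norm c * B"
      by (intro order_trans[OF norm_triangle_ineq4] add_mono)
    moreover have "norm (b z / of_nat N) \<le> 1 / real N"
      using norm_blaschke_le[OF a, of z] z by (simp add: norm_divide divide_right_mono)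
    ultimately have "norm (b z / of_nat N) * norm (\<zeta> N * resolvent N f z - \<zeta> 0 * resolvent 0 f z) \<le> 1 / real N * (norm c * B + norm c * B)"
      by (intro mult_mono) auto
    thus ?thesis by (simp only: norm_mult) (simp add: mult_ac)
  qed
  ultimately have le: "norm (average N (\<lambda>z. b z * f z) z - b z * average N f z) \<le> (2 * norm c * B) / real N" for N
    by simp
  show ?thesis
    by (rule Lim_null_comparison[OF always_eventually lim_const_over_n]) (use le in blast)
qed

definition defect :: "nat \<Rightarrow> (complex \<Rightarrow> complex) \<Rightarrow> complex \<Rightarrow> complex" where
  "defect N f z = average N f z - average N (\<lambda>_. 1) z * f z"

text \<open>
  If \<open>f - f a = b g\<close>, then \<open>\<kappa>\<close> times the norm of \<open>f\<close> bounds the norm of \<open>g\<close>.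
\<close>

definition \<kappa> :: real where "\<kappa> = 1 + sqrt (4 / (1 - norm a))"

lemma \<kappa>: "1 \<le> \<kappa>" using a by (simp add: \<kappa>_def)

lemma hardy_one: "hardy_class (\<lambda>_. 1)" by (rule hardy_class_const)

text \<open>
  The averages act asymptotically as multiplication by their value at the constant \<open>1\<close>. The defect vanishes on
  constants and, by \<open>average_blaschke\<close>, commutes with \<open>b\<close> up to a null sequence. Splitting off the value
  at \<open>a\<close> \<open>m\<close> times therefore leaves \<open>b\<^sup>m\<close> times a quantity bounded by a multiple of \<open>\<kappa>\<^sup>m\<close>, which is
  small when \<open>|b z| < 1 / \<kappa>\<close>.
\<close>

lemma defect_tendsto_0: "(\<lambda>N. defect N f z) \<longlonglongrightarrow> 0"
  if f: "hardy_class f" and z: "z \<in> ball 0 1" and small: "norm (b z) < 1 / \<kappa>" for f z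
proof -
  define E where "E = sqrt (4 / (1 - norm z))"
  have E: "0 \<le> E" using z by (simp add: E_def)
  have ev: "norm (g z) \<le> E * H2_norm g" if "hardy_class g" for g
    unfolding E_def by (rule hardy_point_evaluation[OF that]) (use z in auto)
  define C where "C = E * (norm c * M) + E * (norm c * M) * E"
  have C: "0 \<le> C" unfolding C_def using E M_nonneg by (intro add_nonneg_nonneg mult_nonneg_nonneg) auto
  have DC: "norm (defect N g z) \<le> C * H2_norm g" if g: "hardy_class g" for N g
  proof -
    have "norm (average N g z) \<le> E * (norm c * M * H2_norm g)"
      by (rule order_trans[OF ev[OF average_hardy(1)[OF g]] mult_left_mono[OF average_hardy(2)[OF g] E]])
    moreover have "norm (average N (\<lambda>_. 1) z) \<le> E * (norm c * M)"
    proof -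
      have "norm (average N (\<lambda>_. 1) z) \<le> E * (norm c * M * H2_norm (\<lambda>_. 1::complex))"
        by (rule order_trans[OF ev[OF average_hardy(1)[OF hardy_one]] mult_left_mono[OF average_hardy(2)[OF hardy_one] E]])
      also have "\<dots> \<le> E * (norm c * M * 1)"
        using H2_norm_const[of 1] M_nonneg E by (intro mult_left_mono) auto
      finally show ?thesis by simp
    qed
    ultimately have "norm (defect N g z) \<le> E * (norm c * M * H2_norm g) + E * (norm c * M) * (E * H2_norm g)"
      unfolding defect_def using ev[OF g] E M_nonneg
      by (intro order_trans[OF norm_triangle_ineq4] add_mono) (auto simp: norm_mult intro!: mult_mono)
    thus ?thesis by (simp add: C_def algebra_simps)
  qed
  have bz: "norm (b z) \<le> 1" using norm_blaschke_le[OF a, of z] z by simp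
  have step: "\<forall>\<epsilon>>0. \<forall>\<^sub>F N in sequentially. norm (defect N f z) \<le> (norm (b z) * \<kappa>) ^ m * (C * H2_norm f) + \<epsilon>"
    if "hardy_class f" for m f
    using that
  proof (induction m arbitrary: f)
    case 0
    have "norm (defect N f z) \<le> C * H2_norm f + \<epsilon>" if "\<epsilon> > 0" for \<epsilon> N
      using DC[OF 0, of N] that by linarith
    thus ?case by (auto intro: always_eventually)
  next
    case (Suc m)
    note f = Suc.prems
    have fz: "hardy_class (\<lambda>w. f w - f a)" by (rule hardy_diff(1)[OF f hardy_class_const])
    obtain g where g: "hardy_class g" "H2_norm g \<le> H2_norm (\<lambda>w. f w - f a)"
      and fg: "\<And>w. norm w < 1 \<Longrightarrow> f w - f a = b w * g w"
      using hardy_blaschke_divide[OF a fz] by auto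
    have gn: "H2_norm g \<le> \<kappa> * H2_norm f"
    proof -
      have "H2_norm (\<lambda>w. f w - f a) \<le> H2_norm f + norm (f a)"
        using hardy_diff(2)[OF f hardy_class_const[of "f a"]] H2_norm_const[of "f a"] by linarith
      thus ?thesis using g(2) hardy_point_evaluation[OF f a] by (simp add: \<kappa>_def algebra_simps)
    qed
    have Deq: "defect N f z = b z * defect N g z + (average N (\<lambda>z. b z * g z) z - b z * average N g z)" for N
    proof -
      have "average N f z = average N (\<lambda>w. f a * 1 + b w * g w) z"
      proof -
        have e: "hardy_class (\<lambda>w. f a * 1 + b w * g w)"
          by (intro hardy_add(1) hardy_blaschke_mult(1)[OF a g(1)] hardy_class_const)
        have "resolvent k f z = resolvent k (\<lambda>w. f a * 1 + b w * g w) z" for k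
        proof (rule resolvent_unique[OF e resolvent_hardy[OF f] _ z])
          fix w :: complex assume w: "w \<in> ball 0 1"
          show "\<psi> w * resolvent k f (\<phi> w) - \<zeta> k * resolvent k f w = f a * 1 + b w * g w"
            using resolvent_eq[OF f w, of k] fg[of w] w by (simp add: algebra_simps)
        qed
        thus ?thesis by (simp add: average_def)
      qed
      also have "\<dots> = f a * average N (\<lambda>_. 1) z + average N (\<lambda>w. b w * g w) z"
        by (rule average_linear[OF hardy_one hardy_blaschke_mult(1)[OF a g(1)] z])
      finally have 1: "average N f z = f a * average N (\<lambda>_. 1) z + average N (\<lambda>w. b w * g w) z" .
      have 2: "f z = f a + b z * g z" using fg[of z] z by (simp add: algebra_simps)
      show ?thesis unfolding defect_def 1 2 by (simp add: algebra_simps)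
    qed
    show ?case
    proof (intro allI impI)
      fix \<epsilon> :: real assume \<epsilon>: "\<epsilon> > 0"
      have "\<forall>\<^sub>F N in sequentially. norm (defect N g z) \<le> (norm (b z) * \<kappa>) ^ m * (C * H2_norm g) + \<epsilon> / 2"
        using Suc.IH[OF g(1)] \<epsilon> half_gt_zero by blast
      moreover have "\<forall>\<^sub>F N in sequentially. norm (average N (\<lambda>z. b z * g z) z - b z * average N g z) < \<epsilon> / 2"
        using tendstoD[OF average_blaschke[OF g(1) z], of "\<epsilon> / 2"] \<epsilon> by simp
      ultimately show "\<forall>\<^sub>F N in sequentially. norm (defect N f z) \<le> (norm (b z) * \<kappa>) ^ Suc m * (C * H2_norm f) + \<epsilon>"
      proof eventually_elim
        case (elim N)
        have p: "0 \<le> (norm (b z) * \<kappa>) ^ m" using \<kappa> by simp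
        have "norm (defect N f z) \<le> norm (b z) * norm (defect N g z) + norm (average N (\<lambda>z. b z * g z) z - b z * average N g z)"
          unfolding Deq[of N] by (rule order_trans[OF norm_triangle_ineq]) (simp add: norm_mult)
        also have "\<dots> \<le> norm (b z) * ((norm (b z) * \<kappa>) ^ m * (C * H2_norm g) + \<epsilon> / 2) + \<epsilon> / 2"
          using elim by (intro add_mono mult_left_mono) auto
        also have "\<dots> \<le> norm (b z) * ((norm (b z) * \<kappa>) ^ m * (C * (\<kappa> * H2_norm f))) + 1 * (\<epsilon> / 2) + \<epsilon> / 2"
          unfolding distrib_left
          using gn bz p C \<epsilon> by (intro add_mono mult_left_mono mult_right_mono) auto
        finally show ?case by (simp add: algebra_simps)
      qed
    qed
  qed
  have q: "0 \<le> norm (b z) * \<kappa>" "norm (b z) * \<kappa> < 1" using small \<kappa> by (auto simp: field_simps)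
  have "(\<lambda>m. (norm (b z) * \<kappa>) ^ m * (C * H2_norm f)) \<longlonglongrightarrow> 0 * (C * H2_norm f)"
    by (intro tendsto_mult tendsto_const LIMSEQ_realpow_zero q)
  hence qlim: "(\<lambda>m. (norm (b z) * \<kappa>) ^ m * (C * H2_norm f)) \<longlonglongrightarrow> 0" by simp
  show ?thesis
  proof (rule tendstoI)
    fix e :: real assume e: "e > 0"
    hence "0 < e / 2" by simp
    from eventually_happens'[OF sequentially_bot order_tendstoD(2)[OF qlim this]]
    obtain m where m: "(norm (b z) * \<kappa>) ^ m * (C * H2_norm f) < e / 2" by blast
    have "\<forall>\<^sub>F N in sequentially. norm (defect N f z) \<le> (norm (b z) * \<kappa>) ^ m * (C * H2_norm f) + e / 4"
      using step[OF f, of m] e by auto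
    thus "\<forall>\<^sub>F N in sequentially. dist (defect N f z) 0 < e"
      by eventually_elim (use m e in auto)
  qed
qed

definition near :: "complex set" where "near = {z \<in> ball 0 1. norm (b z) < 1 / \<kappa>}"

lemma near: "open near" "near \<noteq> {}" "near \<subseteq> ball 0 1"
proof -
  have "open (ball 0 1 \<inter> b -` ball 0 (1 / \<kappa>))"
    by (rule continuous_open_preimage[OF holomorphic_on_imp_continuous_on[OF blaschke_holomorphic[OF a]]]) auto
  also have "ball 0 1 \<inter> b -` ball 0 (1 / \<kappa>) = near" by (auto simp: near_def)
  finally show "open near" .
  have "a \<in> near" using a \<kappa> by (simp add: near_def blaschke_def)
  thus "near \<noteq> {}" by blast
qed (auto simp: near_def)

text \<open>
  The averages of \<open>\<zeta>\<^sup>n\<^sup>+\<^sup>1 (T - \<zeta>)\<^sup>-\<^sup>1 1\<close>; in the limit, \<open>T\<close> raises \<open>n\<close> by one.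
\<close>

definition moment :: "nat \<Rightarrow> nat \<Rightarrow> complex \<Rightarrow> complex" where
  "moment n N z = 1 / of_nat N * (\<Sum>k<N. \<zeta> k ^ Suc n * resolvent k (\<lambda>_. 1) z)"

lemma moment_hardy: "hardy_class (moment n N)" "H2_norm (moment n N) \<le> norm c ^ Suc n * M" for n N
proof -
  have n: "H2_norm (\<lambda>z. \<zeta> k ^ Suc n * resolvent k (\<lambda>_. 1) z) \<le> norm c ^ Suc n * M" for k
  proof -
    have "H2_norm (\<lambda>z. \<zeta> k ^ Suc n * resolvent k (\<lambda>_. 1) z) \<le> norm (\<zeta> k ^ Suc n) * H2_norm (resolvent k (\<lambda>_. 1))"
      by (rule hardy_scale(2)[OF resolvent_hardy[OF hardy_one]])
    also have "\<dots> \<le> norm c ^ Suc n * (M * 1)"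
      unfolding norm_power norm_\<zeta>
      by (intro mult_left_mono order_trans[OF resolvent_norm[OF hardy_one]]) (use M_nonneg H2_norm_const[of 1] in auto)
    finally show ?thesis by simp
  qed
  have B: "0 \<le> norm c ^ Suc n * M" using M_nonneg by simp
  show "hardy_class (moment n N)" "H2_norm (moment n N) \<le> norm c ^ Suc n * M"
    unfolding moment_def[abs_def] using hardy_average[OF hardy_scale(1)[OF resolvent_hardy[OF hardy_one]] n B] by auto
qed

context
  fixes r :: "nat \<Rightarrow> nat" and h :: "complex \<Rightarrow> complex"
  assumes r: "strict_mono r" and h: "hardy_class h"
    and hlim: "\<And>z. norm z < 1 \<Longrightarrow> (\<lambda>n. average (r n) (\<lambda>_. 1) z) \<longlonglongrightarrow> h z"
begin

lemma limit_holo: "h holomorphic_on ball 0 1" by (rule hardy_class_holo[OF h])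

lemma average_near: "(\<lambda>n. average (r n) f z) \<longlonglongrightarrow> h z * f z" if f: "hardy_class f" and z: "z \<in> near" for f z
proof -
  have zb: "z \<in> ball 0 1" "norm (b z) < 1 / \<kappa>" using z by (auto simp: near_def)
  have "(\<lambda>n. defect (r n) f z + average (r n) (\<lambda>_. 1) z * f z) \<longlonglongrightarrow> 0 + h z * f z"
    using LIMSEQ_subseq_LIMSEQ[OF defect_tendsto_0[OF f zb] r] hlim[of z] zb
    by (intro tendsto_intros) (auto simp: o_def)
  thus ?thesis by (simp add: defect_def)
qed

lemma hardy_\<psi>: "hardy_class \<psi>" using operator_hardy[OF hardy_one] by simp

text \<open>
  Applying \<open>T\<close> to the averages of \<open>1\<close> gives the averages of \<open>T 1 = \<psi>\<close>. In the limit \<open>\<psi> (h \<circ> \<phi>) = h \<psi>\<close>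
  near \<open>a\<close>, hence \<open>h \<circ> \<phi> = h\<close> everywhere.
\<close>

lemma limit_constant: "h z = h a" if z: "z \<in> ball 0 1" for z
proof -
  have "\<psi> z * (h (\<phi> z) - h z) = 0" if z: "z \<in> ball 0 1" for z
  proof (rule zero_on_open_imp_zero[OF _ near _ z])
    show "(\<lambda>z. \<psi> z * (h (\<phi> z) - h z)) holomorphic_on ball 0 1"
      by (intro holomorphic_intros \<psi>_holo compose_\<phi>_holo limit_holo)
    fix w assume w: "w \<in> near"
    hence wb: "w \<in> ball 0 1" using near by blast
    have "\<psi> w * average N (\<lambda>_. 1) (\<phi> w) = average N \<psi> w" for N
    proof -
      have t: "\<psi> w * (\<zeta> k * resolvent k (\<lambda>_. 1) (\<phi> w)) = \<zeta> k * resolvent k \<psi> w" for k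
        using resolvent_commute[OF hardy_one wb, of k] by (simp add: mult_ac)
      have "\<psi> w * (\<Sum>k<N. \<zeta> k * resolvent k (\<lambda>_. 1) (\<phi> w)) = (\<Sum>k<N. \<zeta> k * resolvent k \<psi> w)"
        by (simp only: sum_distrib_left t)
      thus ?thesis by (simp add: average_def algebra_simps)
    qed
    moreover have "(\<lambda>n. \<psi> w * average (r n) (\<lambda>_. 1) (\<phi> w)) \<longlonglongrightarrow> \<psi> w * h (\<phi> w)"
      using hlim \<phi>_ball[OF wb] by (intro tendsto_intros) auto
    ultimately have "(\<lambda>n. average (r n) \<psi> w) \<longlonglongrightarrow> \<psi> w * h (\<phi> w)" by simp
    from LIMSEQ_unique[OF this average_near[OF hardy_\<psi> w]]
    show "\<psi> w * (h (\<phi> w) - h w) = 0" by (simp add: algebra_simps)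
  qed
  moreover have "(\<lambda>z. h (\<phi> z) - h z) holomorphic_on ball 0 1"
    by (intro holomorphic_intros compose_\<phi>_holo limit_holo)
  ultimately have "h (\<phi> z) - h z = 0" if "z \<in> ball 0 1" for z
    using \<psi>_nz holomorphic_mult_eq_0[OF \<psi>_holo, of "\<lambda>z. h (\<phi> z) - h z"] that by blast
  thus ?thesis using invariant_constant[OF limit_holo _ z] by auto
qed

text \<open>
  Averaging \<open>T (T - \<zeta>)\<^sup>-\<^sup>1 f = f + \<zeta> (T - \<zeta>)\<^sup>-\<^sup>1 f\<close> over the orbit gives \<open>T g = f + h f\<close> in the limit, so
  \<open>g\<close> solves \<open>T g = f\<close> when \<open>h\<close> is zero.
\<close>

lemma surjective_of_limit_zero:
  assumes zero: "h a = 0"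
  shows "resolvent_bound \<psi> \<phi> 0 M"
  unfolding resolvent_bound_def
proof (intro conjI allI impI)
  show "0 \<le> M" by (rule M_nonneg)
  fix f assume f: "hardy_class f"
  define U where "U = (\<lambda>N z. 1 / of_nat N * (\<Sum>k<N. resolvent k f z))"
  have U: "hardy_class (U N)" "H2_norm (U N) \<le> M * H2_norm f" for N
    unfolding U_def using hardy_average[OF resolvent_hardy[OF f] resolvent_norm[OF f]] M_nonneg H2_norm_nonneg[OF f] by auto
  obtain s g where s: "strict_mono (s :: nat \<Rightarrow> nat)" and g: "hardy_class g" "H2_norm g \<le> M * H2_norm f"
    and glim: "\<And>z. norm z < 1 \<Longrightarrow> (\<lambda>n. U (r (s n)) z) \<longlonglongrightarrow> g z"
    using hardy_Montel[of "\<lambda>n. U (r n)", OF U] by blast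
  have "\<psi> z * g (\<phi> z) - f z = 0" if z: "z \<in> ball 0 1" for z
  proof (rule zero_on_open_imp_zero[OF _ near _ z])
    show "(\<lambda>z. \<psi> z * g (\<phi> z) - f z) holomorphic_on ball 0 1"
      by (intro holomorphic_intros \<psi>_holo compose_\<phi>_holo hardy_class_holo g f)
    fix w assume w: "w \<in> near"
    hence wb: "w \<in> ball 0 1" using near by blast
    have TU: "\<psi> w * U N (\<phi> w) = f w + average N f w" if N: "N > 0" for N
    proof -
      have "\<psi> w * (\<Sum>k<N. resolvent k f (\<phi> w)) = (\<Sum>k<N. f w + \<zeta> k * resolvent k f w)"
        by (simp add: sum_distrib_left resolvent_eq[OF f wb])
      also have "\<dots> = of_nat N * f w + (\<Sum>k<N. \<zeta> k * resolvent k f w)" by (simp add: sum.distrib)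
      finally have e: "\<psi> w * (\<Sum>k<N. resolvent k f (\<phi> w)) = of_nat N * f w + (\<Sum>k<N. \<zeta> k * resolvent k f w)" .
      have "\<psi> w * U N (\<phi> w) = 1 / of_nat N * (\<psi> w * (\<Sum>k<N. resolvent k f (\<phi> w)))"
        by (simp add: U_def)
      also have "\<dots> = f w + average N f w" unfolding e using N by (simp add: average_def add_divide_distrib)
      finally show ?thesis .
    qed
    have "(\<lambda>n. \<psi> w * U (r (s n)) (\<phi> w)) \<longlonglongrightarrow> \<psi> w * g (\<phi> w)"
      using glim \<phi>_ball[OF wb] by (intro tendsto_intros) auto
    moreover have "\<forall>\<^sub>F n in sequentially. \<psi> w * U (r (s n)) (\<phi> w) = f w + average (r (s n)) f w"
    proof -
      have pos: "r (s n) > 0" if "n > 0" for n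
        using that seq_suble[OF r, of "s n"] seq_suble[OF s, of n] by linarith
      show ?thesis
        using eventually_gt_at_top[of "0::nat"] by eventually_elim (intro TU pos)
    qed
    ultimately have "(\<lambda>n. f w + average (r (s n)) f w) \<longlonglongrightarrow> \<psi> w * g (\<phi> w)"
      by (rule Lim_transform_eventually)
    moreover have "(\<lambda>n. f w + average (r (s n)) f w) \<longlonglongrightarrow> f w + h w * f w"
      using LIMSEQ_subseq_LIMSEQ[OF average_near[OF f w] s] by (intro tendsto_intros) (simp add: o_def)
    ultimately have "\<psi> w * g (\<phi> w) = f w + h w * f w" by (rule LIMSEQ_unique)
    thus "\<psi> w * g (\<phi> w) - f w = 0" using limit_constant[OF wb] zero by simp
  qed
  thus "\<exists>g. hardy_class g \<and> H2_norm g \<le> M * H2_norm f \<and> (\<forall>z\<in>ball 0 1. \<psi> z * g (\<phi> z) - 0 * g z = f z)"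
    using g by (intro exI[of _ g]) auto
next
  fix g assume g: "hardy_class g" and 0: "\<forall>z\<in>ball 0 1. \<psi> z * g (\<phi> z) - 0 * g z = 0"
  have g\<phi>: "g (\<phi> z) = 0" if "z \<in> ball 0 1" for z
    using \<psi>_nz holomorphic_mult_eq_0[OF \<psi>_holo compose_\<phi>_holo[OF hardy_class_holo[OF g]]] 0 that by auto
  show "\<forall>z\<in>ball 0 1. g z = 0"
  proof
    fix z :: complex assume z: "z \<in> ball 0 1"
    have "norm (1 / \<mu>) = 1" using \<mu> by (simp add: norm_divide)
    note i = norm_rotation_less[OF a this] rotation_rotation[OF a this, of z \<mu>]
    have "\<phi> (rotation_about a (1 / \<mu>) z) = z"
      using i(2) z \<mu>_nz rotation_one[OF a, of z] by simp
    thus "g z = 0" using g\<phi>[of "rotation_about a (1 / \<mu>) z"] i(1)[of z] z by simp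
  qed
qed

lemma moment_tendsto: "(\<lambda>i. moment n (r i) z) \<longlonglongrightarrow> h a * orbit_product \<psi> a \<mu> n z" if z: "z \<in> ball 0 1" for n z
  using z
proof (induction n arbitrary: z)
  case 0
  have "moment 0 N z = average N (\<lambda>_. 1) z" for N by (simp add: moment_def average_def)
  thus ?case using hlim[of z] 0 limit_constant[OF 0] by (simp add: orbit_product_def)
next
  case (Suc n)
  note z = Suc.prems
  define x where "x = (1 / \<mu>) ^ Suc n"
  have x1: "x \<noteq> 1"
  proof
    assume "x = 1"
    hence "\<mu> ^ Suc n = 1" using \<mu>_nz by (simp add: x_def power_divide divide_simps del: power_Suc split: if_splits)
    thus False using irr[of "Suc n"] by simp
  qed
  have xn: "norm x = 1" using \<mu> by (simp add: x_def norm_power norm_divide)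
  have dx: "\<zeta> k ^ Suc n = c ^ Suc n * x ^ k" for k
    by (simp add: \<zeta>_def x_def power_divide power_mult[symmetric] mult.commute del: power_Suc)
  have TV: "moment (Suc n) N z = \<psi> z * moment n N (\<phi> z) - 1 / of_nat N * (\<Sum>k<N. \<zeta> k ^ Suc n)" for N
  proof -
    have "\<psi> z * (\<Sum>k<N. \<zeta> k ^ Suc n * resolvent k (\<lambda>_. 1) (\<phi> z))
        = (\<Sum>k<N. \<zeta> k ^ Suc n * (\<psi> z * resolvent k (\<lambda>_. 1) (\<phi> z)))"
      by (simp add: sum_distrib_left mult_ac)
    also have "\<dots> = (\<Sum>k<N. \<zeta> k ^ Suc n + \<zeta> k ^ Suc (Suc n) * resolvent k (\<lambda>_. 1) z)"
      by (intro sum.cong refl) (simp add: resolvent_eq[OF hardy_one z] algebra_simps)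
    also have "\<dots> = (\<Sum>k<N. \<zeta> k ^ Suc n) + (\<Sum>k<N. \<zeta> k ^ Suc (Suc n) * resolvent k (\<lambda>_. 1) z)"
      by (rule sum.distrib)
    finally have e: "(\<Sum>k<N. \<zeta> k ^ Suc (Suc n) * resolvent k (\<lambda>_. 1) z)
        = \<psi> z * (\<Sum>k<N. \<zeta> k ^ Suc n * resolvent k (\<lambda>_. 1) (\<phi> z)) - (\<Sum>k<N. \<zeta> k ^ Suc n)"
      by (simp del: power_Suc)
    show ?thesis unfolding moment_def e by (simp add: algebra_simps diff_divide_distrib del: power_Suc)
  qed
  have "norm (1 / of_nat N * (\<Sum>k<N. \<zeta> k ^ Suc n)) \<le> (norm c ^ Suc n * (2 / norm (1 - x))) / real N" for N
  proof -
    have "norm (1 - x ^ N) \<le> 2"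
      using norm_triangle_ineq4[of 1 "x ^ N"] xn by (simp add: norm_power)
    hence "norm (\<Sum>k<N. x ^ k) \<le> 2 / norm (1 - x)"
      using x1 by (simp add: geometric_sum norm_divide norm_minus_commute divide_right_mono)
    hence "norm c ^ Suc n * norm (\<Sum>k<N. x ^ k) \<le> norm c ^ Suc n * (2 / norm (1 - x))"
      by (intro mult_left_mono) auto
    moreover have "(\<Sum>k<N. \<zeta> k ^ Suc n) = c ^ Suc n * (\<Sum>k<N. x ^ k)"
      unfolding dx by (rule sum_distrib_left[symmetric])
    ultimately have "norm (\<Sum>k<N. \<zeta> k ^ Suc n) \<le> norm c ^ Suc n * (2 / norm (1 - x))"
      by (simp only: norm_mult norm_power)
    hence "norm (\<Sum>k<N. \<zeta> k ^ Suc n) / real N \<le> (norm c ^ Suc n * (2 / norm (1 - x))) / real N"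
      by (intro divide_right_mono) auto
    thus ?thesis by (simp add: norm_mult norm_divide del: power_Suc)
  qed
  hence "(\<lambda>N. 1 / of_nat N * (\<Sum>k<N. \<zeta> k ^ Suc n)) \<longlonglongrightarrow> 0"
    by (intro Lim_null_comparison[OF always_eventually lim_const_over_n]) blast
  from LIMSEQ_subseq_LIMSEQ[OF this r]
  have e0: "(\<lambda>i. 1 / of_nat (r i) * (\<Sum>k<r i. \<zeta> k ^ Suc n)) \<longlonglongrightarrow> 0" by (simp only: o_def)
  have "(\<lambda>i. moment (Suc n) (r i) z) \<longlonglongrightarrow> \<psi> z * (h a * orbit_product \<psi> a \<mu> n (\<phi> z)) - 0"
    unfolding TV by (intro tendsto_diff tendsto_mult tendsto_const Suc.IH \<phi>_ball z e0)
  thus ?case by (simp add: orbit_product_Suc[OF z] mult_ac)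
qed

text \<open>
  \<open>T\<^sup>n\<close> maps the constant \<open>h a\<close> to \<open>h a\<close> times the orbit product, and this is a limit of moments of norm
  at most \<open>|c|\<^sup>n\<^sup>+\<^sup>1 M\<close>.
\<close>

lemma orbit_product_growth:
  assumes nonzero: "h a \<noteq> 0"
  shows "H2_norm (orbit_product \<psi> a \<mu> n) \<le> norm c * M / norm (h a) * norm c ^ n"
proof -
  let ?P = "orbit_product \<psi> a \<mu> n"
  have lim: "(\<lambda>i. moment n (r i) z) \<longlonglongrightarrow> h a * ?P z" if "norm z < 1" for z
    by (rule moment_tendsto) (use that in simp)
  note p = hardy_pointwise_limit[of "\<lambda>i. moment n (r i)", OF moment_hardy lim]
  have "H2_norm ?P = H2_norm (\<lambda>z. 1 / h a * (h a * ?P z))" using nonzero by simp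
  also have "\<dots> \<le> norm (1 / h a) * (norm c ^ Suc n * M)"
    by (rule order_trans[OF hardy_scale(2)[OF p(1)] mult_left_mono[OF p(2)]]) auto
  also have "\<dots> = norm c * M / norm (h a) * norm c ^ n" by (simp add: norm_divide)
  finally show ?thesis .
qed
end

lemma resolvent_dichotomy:
  "resolvent_bound \<psi> \<phi> 0 M \<or> (\<exists>A. \<forall>n. H2_norm (orbit_product \<psi> a \<mu> n) \<le> A * norm c ^ n)"
proof -
  obtain r h where r: "strict_mono (r :: nat \<Rightarrow> nat)" and h: "hardy_class h"
    and hlim: "\<And>z. norm z < 1 \<Longrightarrow> (\<lambda>n. average (r n) (\<lambda>_. 1) z) \<longlonglongrightarrow> h z"
    using hardy_Montel[of "\<lambda>n. average n (\<lambda>_. 1)", OF average_hardy[OF hardy_one]] by blast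
  show ?thesis
  proof (cases "h a = 0")
    case True
    from surjective_of_limit_zero[OF r h hlim this] show ?thesis by blast
  next
    case False
    from orbit_product_growth[OF r h hlim this] show ?thesis by blast
  qed
qed

end

section \<open>The spectrum\<close>

text \<open>
  In the coordinate \<open>blaschke a\<close> both \<open>\<phi>\<close> and its inverse fix \<open>0\<close>, so by the Schwarz lemma neither
  increases the modulus, and \<open>\<phi>\<close> is multiplication by a constant.
\<close>

lemma elliptic_is_rotation:
  assumes el: "elliptic_automorphism \<phi>" and a: "norm a < 1" and fix_a: "\<phi> a = a"
  obtains \<mu> where "norm \<mu> = 1" "\<And>z. z \<in> ball 0 1 \<Longrightarrow> \<phi> z = rotation_about a \<mu> z" "deriv \<phi> a = \<mu>"
proof -
  have \<phi>: "\<phi> holomorphic_on ball 0 1" "\<phi> ` ball 0 1 \<subseteq> ball 0 1"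
    and ex: "\<exists>\<phi>'. \<phi>' holomorphic_on ball 0 1 \<and> \<phi>' ` ball 0 1 \<subseteq> ball 0 1 \<and>
        (\<forall>z\<in>ball 0 1. \<phi>' (\<phi> z) = z \<and> \<phi> (\<phi>' z) = z)"
    using el unfolding elliptic_automorphism_def disk_automorphism_def by simp_all
  obtain \<phi>' where "\<phi>' holomorphic_on ball 0 1 \<and> \<phi>' ` ball 0 1 \<subseteq> ball 0 1 \<and>
        (\<forall>z\<in>ball 0 1. \<phi>' (\<phi> z) = z \<and> \<phi> (\<phi>' z) = z)"
    using ex by (rule exE)
  hence \<phi>': "\<phi>' holomorphic_on ball 0 1" "\<phi>' ` ball 0 1 \<subseteq> ball 0 1"
    and inv: "\<And>z. z \<in> ball 0 1 \<Longrightarrow> \<phi>' (\<phi> z) = z \<and> \<phi> (\<phi>' z) = z"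
    by simp_all
  have ab: "a \<in> ball 0 1" using a by simp
  have a': "norm (- a) < 1" using a by simp
  have fix_a': "\<phi>' a = a" using inv[OF ab] fix_a by simp
  let ?b = "blaschke a" and ?\<beta> = "blaschke (- a)"
  have conj: "(\<lambda>u. ?b (\<sigma> (?\<beta> u))) holomorphic_on ball 0 1 \<and> ?b (\<sigma> (?\<beta> 0)) = 0 \<and>
      (\<forall>u. norm u < 1 \<longrightarrow> norm (?b (\<sigma> (?\<beta> u))) < 1)"
    if \<sigma>: "\<sigma> holomorphic_on ball 0 1" "\<sigma> ` ball 0 1 \<subseteq> ball 0 1" "\<sigma> a = a" for \<sigma>
  proof -
    have 1: "(\<lambda>u. \<sigma> (?\<beta> u)) holomorphic_on ball 0 1"
      by (rule holomorphic_on_compose_gen[OF blaschke_holomorphic[OF a'] \<sigma>(1), unfolded o_def])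
         (use norm_blaschke_less[OF a'] in auto)
    have 2: "norm (\<sigma> (?\<beta> u)) < 1" if "norm u < 1" for u
      using norm_blaschke_less[OF a' that] \<sigma>(2) by (force simp: image_subset_iff)
    have "(\<lambda>u. ?b (\<sigma> (?\<beta> u))) holomorphic_on ball 0 1"
      by (rule holomorphic_on_compose_gen[OF 1 blaschke_holomorphic[OF a], unfolded o_def])
         (use 2 in auto)
    moreover have "?\<beta> 0 = a" by (simp add: blaschke_def)
    ultimately show ?thesis using 2 norm_blaschke_less[OF a] \<sigma>(3) by (auto simp: blaschke_def)
  qed
  define F where "F = (\<lambda>u. ?b (\<phi> (?\<beta> u)))"
  define F' where "F' = (\<lambda>u. ?b (\<phi>' (?\<beta> u)))"
  have F: "F holomorphic_on ball 0 1" "F 0 = 0" "\<And>u. norm u < 1 \<Longrightarrow> norm (F u) < 1"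
    using conj[OF \<phi> fix_a] by (auto simp: F_def)
  have F': "F' holomorphic_on ball 0 1" "F' 0 = 0" "\<And>u. norm u < 1 \<Longrightarrow> norm (F' u) < 1"
    using conj[OF \<phi>' fix_a'] by (auto simp: F'_def)
  have F'F: "F' (F u) = u" if u: "norm u < 1" for u
  proof -
    have \<beta>u: "?\<beta> u \<in> ball 0 1" using norm_blaschke_less[OF a' u] by simp
    hence "norm (\<phi> (?\<beta> u)) \<le> 1" using \<phi>(2) by (auto simp: image_subset_iff intro: less_imp_le)
    thus ?thesis using inv[OF \<beta>u] blaschke_inverse[OF a] blaschke_inverse'[OF a, of u] u by (simp add: F_def F'_def)
  qed
  have half: "norm (1/2 :: complex) < 1" by simp
  have "norm (F (1/2)) = norm (1/2 :: complex)"
  proof (rule antisym)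
    show "norm (F (1/2)) \<le> norm (1/2 :: complex)" by (rule Schwarz_Lemma(1)[OF F half])
    have "norm (F' (F (1/2))) \<le> norm (F (1/2))" by (rule Schwarz_Lemma(1)[OF F' F(3)[OF half]])
    thus "norm (1/2 :: complex) \<le> norm (F (1/2))" using F'F[OF half] by simp
  qed
  hence "\<exists>z. norm z < 1 \<and> z \<noteq> 0 \<and> norm (F z) = norm z" by (intro exI[of _ "1/2"]) auto
  then obtain \<mu> where \<mu>: "\<And>z. norm z < 1 \<Longrightarrow> F z = \<mu> * z" "norm \<mu> = 1"
    using Schwarz_Lemma(3)[OF F half] by blast
  have eq: "\<phi> z = rotation_about a \<mu> z" if z: "z \<in> ball 0 1" for z
  proof -
    have "?b (\<phi> z) = \<mu> * ?b z"
      using \<mu>(1)[of "?b z"] norm_blaschke_less[OF a, of z] blaschke_inverse[OF a, of z] z by (simp add: F_def)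
    hence "?\<beta> (?b (\<phi> z)) = rotation_about a \<mu> z" by (simp add: rotation_about_def)
    moreover have "norm (\<phi> z) \<le> 1" using \<phi>(2) z by (auto simp: image_subset_iff intro: less_imp_le)
    ultimately show ?thesis using blaschke_inverse[OF a] by simp
  qed
  have "deriv \<phi> a = \<mu>"
  proof -
    have d: "(\<phi> has_field_derivative deriv \<phi> a) (at a)"
      by (rule holomorphic_derivI[OF \<phi>(1) open_ball ab])
    have nz: "1 - cnj a * a \<noteq> 0" using blaschke_denom_nonzero[OF a, of a] a by simp
    have bd: "(?b has_field_derivative 1 / (1 - cnj a * a)) (at a)"
    proof -
      have n: "((\<lambda>z. z - a) has_field_derivative 1) (at a)"
        by (auto intro!: derivative_eq_intros)
      have dd: "((\<lambda>z. 1 - cnj a * z) has_field_derivative - cnj a) (at a)"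
        by (auto intro!: derivative_eq_intros)
      show ?thesis using DERIV_divide[OF n dd nz] nz by (simp add: blaschke_def[abs_def])
    qed
    have "((\<lambda>z. ?b (\<phi> z)) has_field_derivative 1 / (1 - cnj a * a) * deriv \<phi> a) (at a)"
      by (rule DERIV_chain2[OF _ d]) (simp add: fix_a bd)
    moreover have "((\<lambda>z. \<mu> * ?b z) has_field_derivative \<mu> * (1 / (1 - cnj a * a))) (at a)"
      by (rule DERIV_cmult[OF bd])
    moreover have "\<forall>\<^sub>F z in nhds a. ?b (\<phi> z) = \<mu> * ?b z"
    proof (rule eventually_nhds_in_open[OF open_ball ab, THEN eventually_mono])
      fix z :: complex assume z: "z \<in> ball 0 1"
      show "?b (\<phi> z) = \<mu> * ?b z" using eq[OF z] blaschke_rotation[OF a \<mu>(2), of z] z by simp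
    qed
    ultimately have "1 / (1 - cnj a * a) * deriv \<phi> a = \<mu> * (1 / (1 - cnj a * a))"
      by (metis DERIV_unique DERIV_cong_ev)
    thus ?thesis using nz by simp
  qed
  with \<mu>(2) eq show ?thesis by (intro that[of \<mu>]) auto
qed

theorem theorem2p2p6:
  fixes \<phi> \<psi> v :: "complex \<Rightarrow> complex" and a :: complex
  assumes "elliptic_automorphism \<phi>"
    and "a \<in> ball 0 1" and "\<phi> a = a"
    and "\<psi> \<in> disk_algebra" and "\<exists>z\<in>ball 0 1. \<psi> z \<noteq> 0"
    and "\<not> H2_invertible (weighted_composition \<psi> \<phi>)"
    and "\<forall>k::nat. k > 0 \<longrightarrow> deriv \<phi> a ^ k \<noteq> 1"
    and "is_outer_part v \<psi>"
  shows "H2_spectrum (weighted_composition \<psi> \<phi>) = {c. norm c \<le> norm (v a)}"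
proof -
  have a: "norm a < 1" using assms(2) by simp
  obtain \<mu> where \<mu>: "norm \<mu> = 1" and \<phi>: "\<And>z. z \<in> ball 0 1 \<Longrightarrow> \<phi> z = rotation_about a \<mu> z"
    and d: "deriv \<phi> a = \<mu>"
    by (rule elliptic_is_rotation[OF assms(1) a assms(3)]) blast
  interpret weighted_rotation a \<mu> \<psi>
    by unfold_locales (use a \<mu> assms d in auto)
  have T: "weighted_composition \<psi> \<phi> = weighted_composition \<psi> (rotation_about a \<mu>)"
    by (intro ext) (auto simp: weighted_composition_def \<phi>)
  let ?rb = "\<lambda>c. \<exists>M. resolvent_bound \<psi> (rotation_about a \<mu>) c M"
  have spec: "c \<in> H2_spectrum (weighted_composition \<psi> \<phi>) \<longleftrightarrow> \<not> ?rb c" for c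
    unfolding H2_spectrum_def T
    using resolvent_bound_imp_invertible[of c] invertible_imp_resolvent_bound[of c] by blast
  have not0: "\<not> ?rb 0"
    using resolvent_bound_imp_invertible[of 0] assms(6) unfolding T by auto
  have inner: "\<not> ?rb c" if small: "norm c < norm (v a)" "c \<noteq> 0" for c
  proof
    assume "?rb c"
    then obtain M where "resolvent_bound \<psi> (rotation_about a \<mu>) c M" by blast
    then interpret orbit_resolvents a \<mu> \<psi> c M
      by unfold_locales (use small(2) in auto)
    from resolvent_dichotomy not0
    obtain A where A: "\<And>n. H2_norm (orbit_product \<psi> a \<mu> n) \<le> A * norm c ^ n" by blast
    define k where "k = sqrt ((1 + norm a) / (1 - norm a))"
    have le: "norm (v a) ^ n \<le> k * A * norm c ^ n" for n
    proof -
      have "norm (v a) ^ n \<le> k * H2_norm (orbit_product \<psi> a \<mu> n)"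
        unfolding k_def by (rule orbit_product_lower[OF a \<mu> assms(4,8)])
      also have "\<dots> \<le> k * (A * norm c ^ n)" using A a by (intro mult_left_mono) (auto simp: k_def)
      finally show ?thesis by simp
    qed
    have va: "0 < norm (v a)" using small norm_ge_zero[of c] by linarith
    have "1 \<le> k * A * (norm c / norm (v a)) ^ n" for n
      using le[of n] va by (simp add: power_divide pos_le_divide_eq)
    moreover have "(\<lambda>n. k * A * (norm c / norm (v a)) ^ n) \<longlonglongrightarrow> k * A * 0"
      by (intro tendsto_mult tendsto_const LIMSEQ_realpow_zero) (use small va in auto)
    ultimately have "1 \<le> k * A * 0"
      by (intro LIMSEQ_le_const[of "\<lambda>n. k * A * (norm c / norm (v a)) ^ n"]) auto
    thus False by simp
  qed
  have disk: "\<not> ?rb c" if c: "norm c \<le> norm (v a)" for c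
  proof (cases "c = 0")
    case False
    show ?thesis
    proof
      assume "?rb c"
      then obtain M where rb: "resolvent_bound \<psi> (rotation_about a \<mu>) c M" by blast
      have M: "0 \<le> M" using rb by (simp add: resolvent_bound_def)
      define t where "t = 1 / (2 + norm c * M)"
      have pos: "0 < 2 + norm c * M" using M by (intro add_pos_nonneg) auto
      have t: "0 < t" "t < 1" "t * (norm c * M) < 1"
      proof -
        show "0 < t" using pos by (simp add: t_def)
        have "0 \<le> norm c * M" using M by simp
        thus "t < 1" "t * (norm c * M) < 1" using pos by (simp_all add: t_def pos_divide_less_eq)
      qed
      (* a point of smaller modulus, close enough to \<open>c\<close> to lie in the resolvent set *)
      define c' where "c' = of_real (1 - t) * c"
      have "c' - c = - (of_real t * c)" by (simp add: c'_def algebra_simps)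
      hence "norm (c' - c) = t * norm c" using t(1) by (simp add: norm_mult)
      hence "norm (c' - c) * M < 1" using t(3) by (simp add: mult.assoc)
      from resolvent_bound_perturb[OF rb this] have "?rb c'" .
      moreover have "norm c' = (1 - t) * norm c"
        unfolding c'_def norm_mult norm_of_real using t by simp
      hence "norm c' < norm c" using t False by simp
      hence "norm c' < norm (v a)" using c by linarith
      moreover have "c' \<noteq> 0" using False t by (simp add: c'_def)
      ultimately show False using inner by blast
    qed
  qed (use not0 in simp)
  have outside: "?rb c" if c: "norm (v a) < norm c" for c
  proof -
    define q where "q = (norm (v a) + norm c) / 2"
    have q: "norm (v a) < q" "q < norm c" "0 \<le> q" using c norm_ge_zero[of "v a"] by (auto simp: q_def)
    obtain C where C: "0 \<le> C" "\<And>n z. norm z < 1 \<Longrightarrow> norm (orbit_product \<psi> a \<mu> n z) \<le> C * q ^ n"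
      using orbit_product_upper[OF a \<mu> irr assms(4,8) q(1)] by blast
    show ?thesis by (rule resolvent_bound_outside[OF C q(3,2)])
  qed
  show ?thesis
  proof (rule set_eqI)
    fix c
    show "c \<in> H2_spectrum (weighted_composition \<psi> \<phi>) \<longleftrightarrow> c \<in> {c. norm c \<le> norm (v a)}"
      unfolding spec mem_Collect_eq using disk[of c] outside[of c] not_le by blast
  qed
qed

end
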